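(* Let $\omega_1 = 1$, $\omega_2=\sqrt{2}$, $\omega_3=\sqrt{3}$, $a=\frac{\omega_1+\omega_2+\omega_3}{2}$, and let $$\Lambda_1=\{a+n_1\omega_1+n_2\omega_2+n_3\omega_3 : n_1,n_2,n_3\in\mathbb{Z}_{+}\},\qquad \Lambda=\Lambda_1\cup(-\Lambda_1).$$ Put $P=\omega_1\omega_2\omega_3=\sqrt{6}$ and $Q=\omega_1^2+\omega_2^2+\omega_3^2=6$. For every nonzero integer $k$ define $$b_k=\frac{(-1)^{k+1}}{4\omega_1\sin\left(\pi k\frac{\omega_2}{\omega_1}\right)\sin\left(\pi k\frac{\omega_3}{\omega_1}\right)},\qquad c_k=\frac{(-1)^{k+1}}{4\omega_2\sin\left(\pi k\frac{\omega_1}{\omega_2}\right)\sin\left(\pi k\frac{\omega_3}{\omega_2}\right)},$$ $$d_k=\frac{(-1)^{k+1}}{4\omega_3\sin\left(\pi k\frac{\omega_1}{\omega_3}\right)\sin\left(\pi k\frac{\omega_2}{\omega_3}\right)}.$$ Then the following identity holds in the space $\mathcal{S}'(\mathbb{R})$ of tempered distributions: $$\widehat{\delta}_\Lambda=-\frac{1}{8\pi^2P}\,\delta_0''-\frac{Q}{24P}\,\delta_0+\sum_{k\in\mathbb{Z},\,k\neq 0}\left(b_k\delta_k+c_k\delta_{k/\sqrt{2}}+d_k\delta_{k/\sqrt{3}}\right),$$ where the series converges unconditionally in $\mathcal{S}'(\mathbb{R})$ (that is, after testing against any Schwartz function one gets an absolutely convergent series). In particular, $$\operatorname{supp}\wi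dehat{\delta}_\Lambda=\mathbb{Z}\cup\left(\tfrac{1}{\sqrt{2}}\mathbb{Z}\right)\cup\left(\tfrac{1}{\sqrt{3}}\mathbb{Z}\right).$$
   Context: $\mathbb{Z}_+$ denotes the set of nonnegative integers. For a discrete (locally finite) set $\Lambda\subset\mathbb{R}$, $\delta_\Lambda=\sum_{\lambda\in\Lambda}\delta_\lambda$ is the measure with unit mass at each point of $\Lambda$. For the set $\Lambda$ of the claim one has $\#(\Lambda\cap[-R,R])=O(R^3)$ as $R\to\infty$, so $\delta_\Lambda$ is a tempered distribution. Here $\delta_x$ is the Dirac mass at $x$, and $\delta_0''$ is the second distributional derivative of $\delta_0$, so $\langle\delta_0'',f\rangle=f''(0)$. The Fourier transform of a Schwartz function $f\in\mathcal{S}(\mathbb{R})$ is normalized as $\widehat{f}(t)=\int_{\mathbb{R}}e^{-2\pi i t x}f(x)\,dx$, and the Fourier transform of a tempered distribution $u$ is defined by $\langle\widehat{u},f\rangle=\langle u,\widehat{f}\rangle$ for all $f\in\mathcal{S}(\mathbb{R})$ (bilinear pairing). *)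

theory Defs
  imports "HOL-Analysis.Analysis"
begin

definition vderiv :: "(real \<Rightarrow> complex) \<Rightarrow> real \<Rightarrow> complex"
  where "vderiv f = (\<lambda>x. vector_derivative f (at x))"

definition smooth :: "(real \<Rightarrow> complex) \<Rightarrow> bool"
  where "smooth f \<longleftrightarrow> (\<forall>n x. (vderiv ^^ n) f differentiable (at x))"

definition schwartz :: "(real \<Rightarrow> complex) \<Rightarrow> bool"
  where "schwartz f \<longleftrightarrow>
    smooth f \<and> (\<forall>m n. bounded (range (\<lambda>x. x ^ m *\<^sub>R (vderiv ^^ n) f x)))"

definition schwartz_seminorm :: "nat \<Rightarrow> nat \<Rightarrow> (real \<Rightarrow> complex) \<Rightarrow> real"
  where "schwartz_seminorm m n f = (SUP x. norm (x ^ m *\<^sub>R (vderiv ^^ n) f x))"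

definition fourier :: "(real \<Rightarrow> complex) \<Rightarrow> real \<Rightarrow> complex"
  where "fourier f = (\<lambda>t. LINT x|lborel. exp (- 2 * pi * \<i> * t * x) * f x)"

text \<open>
  A distribution is represented by a functional on all functions of type
  \<^typ>\<open>real \<Rightarrow> complex\<close>; only its values on Schwartz functions are meaningful. Two
  tempered distributions are equal iff they agree on all Schwartz functions.
\<close>

type_synonym functional = "(real \<Rightarrow> complex) \<Rightarrow> complex"

definition tempered_distribution :: "functional \<Rightarrow> bool"
  where "tempered_distribution u \<longleftrightarrow>
    (\<forall>f g. schwartz f \<longrightarrow> schwartz g \<longrightarrow> u (\<lambda>x. f x + g x) = u f + u g) \<and>
    (\<forall>c f. schwartz f \<longrightarrow> u (\<lambda>x. c * f x) = c * u f) \<and>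
    (\<exists>C N. \<forall>f. schwartz f \<longrightarrow> norm (u f) \<le> C * (\<Sum>m\<le>N. \<Sum>n\<le>N. schwartz_seminorm m n f))"

definition dirac :: "real \<Rightarrow> functional"
  where "dirac x f = f x"

text \<open>
  The pairing of a Schwartz function with the measure having unit mass at each point of
  \<open>\<Lambda>\<close>. It is intended for sets with polynomially growing counting function, where the sum
  converges absolutely; the library assigns the value 0 to a sum that does not converge.
\<close>

definition dirac_comb :: "real set \<Rightarrow> functional"
  where "dirac_comb \<Lambda> f = (\<Sum>\<^sub>\<infinity>x\<in>\<Lambda>. dirac x f)"

definition distr_deriv :: "functional \<Rightarrow> functional"
  where "distr_deriv u f = - u (vderiv f)"

definition distr_fourier :: "functional \<Rightarrow> functional"
  where "distr_fourier u f = u (fourier f)"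

definition vanishes_on :: "functional \<Rightarrow> real set \<Rightarrow> bool"
  where "vanishes_on u U \<longleftrightarrow>
    (\<forall>\<phi>. smooth \<phi> \<longrightarrow> compact (closure {x. \<phi> x \<noteq> 0}) \<longrightarrow> closure {x. \<phi> x \<noteq> 0} \<subseteq> U \<longrightarrow> u \<phi> = 0)"

definition distr_supp :: "functional \<Rightarrow> real set"
  where "distr_supp u = - \<Union>{U. open U \<and> vanishes_on u U}"

end

theory Submission
  imports Defs "HOL-Probability.Sinc_Integral"
begin

text \<open>
  Write \<open>s\<^sub>j(t) = sin (\<pi> w\<^sub>j t)\<close>. If \<open>f = s\<^sub>2 s\<^sub>3 g\<close> with \<open>g\<close> Schwartz, then the Fourier transform
  of \<open>f\<close> is a second difference, with steps \<open>w\<^sub>2\<close> and \<open>w\<^sub>3\<close>, of that of \<open>g\<close>; summing over the lattice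
  cone telescopes in two directions, and the remaining sum over \<open>w\<^sub>1 (\<int> + 1/2)\<close> is evaluated by Poisson
  summation. If \<open>f = \<sigma> g\<close> with \<open>\<sigma>(t) = \<Prod>\<^sub>j s\<^sub>j(t) / (\<pi> w\<^sub>j t)\<close>, the Fourier transform of \<open>f\<close> is a third
  difference of a triple antiderivative of that of \<open>g\<close>, everything telescopes, and Fourier inversion gives
  the contribution of the triple pole at \<open>0\<close>. An arbitrary Schwartz function is a sum of functions of these
  kinds: the ratios of the \<open>w\<^sub>j\<close> are badly approximable, so
  \<open>D = \<sigma>\<^sup>2 + (s\<^sub>2 s\<^sub>3)\<^sup>2 + (s\<^sub>1 s\<^sub>3)\<^sup>2 + (s\<^sub>1 s\<^sub>2)\<^sup>2\<close> is bounded below by a negative power of \<open>1 + \<bar>t\<bar>\<close>, and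
  \<open>f = \<Sum>\<^sub>q (f q / D) q\<close>, where \<open>q\<close> runs over the four functions whose squares add up to \<open>D\<close>.
\<close>

subsection \<open>Smooth functions with controlled derivatives\<close>

lemma vderiv_eqI: "(\<And>x. (f has_vector_derivative f' x) (at x)) \<Longrightarrow> vderiv f = f'"
  unfolding vderiv_def by (auto intro: vector_derivative_at)

lemma has_vector_derivative_vderiv:
  "f differentiable (at x) \<Longrightarrow> (f has_vector_derivative vderiv f x) (at x)"
  unfolding vderiv_def by (simp add: vector_derivative_works)

lemma has_vector_derivative_affine:
  fixes f :: "real \<Rightarrow> complex"
  assumes "\<And>x. (f has_vector_derivative f' x) (at x)"
  shows "((\<lambda>x. f (a * x + b)) has_vector_derivative a * f' (a * x + b)) (at x)"
proof -
  have "((\<lambda>x. a * x + b) has_vector_derivative a) (at x)"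
    by (auto intro!: derivative_eq_intros)
  from vector_diff_chain_at[OF this assms] show ?thesis
    by (simp add: o_def scaleR_conv_of_real)
qed

definition smooth_class :: "((real \<Rightarrow> complex) \<Rightarrow> bool) \<Rightarrow> (real \<Rightarrow> complex) \<Rightarrow> bool" where
  "smooth_class B f \<longleftrightarrow> (\<forall>n. B ((vderiv ^^ n) f) \<and> (\<forall>x. (vderiv ^^ n) f differentiable (at x)))"

lemma smooth_iff_smooth_class: "smooth f \<longleftrightarrow> smooth_class (\<lambda>_. True) f"
  by (simp add: smooth_def smooth_class_def)

lemma smooth_class_mem: "smooth_class B f \<Longrightarrow> B f"
  unfolding smooth_class_def by (metis funpow_0)

lemma smooth_class_vderiv: "smooth_class B f \<Longrightarrow> smooth_class B (vderiv f)"
  unfolding smooth_class_def by (metis comp_apply funpow_Suc_right)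

lemma smooth_class_has_vderiv: "smooth_class B f \<Longrightarrow> (f has_vector_derivative vderiv f x) (at x)"
  unfolding smooth_class_def by (metis funpow_0 has_vector_derivative_vderiv)

lemma smooth_class_coinduct [consumes 1, case_names mem deriv]:
  assumes "P f"
    and mem: "\<And>f. P f \<Longrightarrow> B f"
    and deriv: "\<And>f. P f \<Longrightarrow> \<exists>f'. P f' \<and> (\<forall>x. (f has_vector_derivative f' x) (at x))"
  shows "smooth_class B f"
proof -
  have "P ((vderiv ^^ n) f)" for n
  proof (induction n)
    case (Suc n)
    with deriv vderiv_eqI show ?case by fastforce
  qed (simp add: assms(1))
  then show ?thesis
    unfolding smooth_class_def using mem deriv
    by (metis has_vector_derivative_def differentiableI)
qed

lemma smooth_class_add:
  assumes closed_B: "\<And>f g. B f \<Longrightarrow> B g \<Longrightarrow> B (\<lambda>x. f x + g x)"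
    and "smooth_class B f" "smooth_class B g"
  shows "smooth_class B (\<lambda>x. f x + g x)"
proof -
  define P where
    "P h \<longleftrightarrow> (\<exists>f g. smooth_class B f \<and> smooth_class B g \<and> h = (\<lambda>x. f x + g x))" for h
  have "P (\<lambda>x. f x + g x)" using assms(2,3) by (auto simp: P_def)
  then show ?thesis
  proof (cases rule: smooth_class_coinduct)
    case (mem h)
    then show "B h" by (auto simp: P_def dest!: smooth_class_mem intro: closed_B)
  next
    case (deriv h)
    then obtain f g where "smooth_class B f" "smooth_class B g" "h = (\<lambda>x. f x + g x)"
      by (auto simp: P_def)
    then show "\<exists>h'. P h' \<and> (\<forall>x. (h has_vector_derivative h' x) (at x))"
      by (intro exI[of _ "\<lambda>x. vderiv f x + vderiv g x"])
        (auto simp: P_def intro!: has_vector_derivative_add smooth_class_has_vderiv smooth_class_vderiv)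
  qed
qed

inductive sum_of_products :: "((real \<Rightarrow> complex) \<Rightarrow> bool) \<Rightarrow> ((real \<Rightarrow> complex) \<Rightarrow> bool)
    \<Rightarrow> (real \<Rightarrow> complex) \<Rightarrow> bool" for B\<^sub>1 B\<^sub>2 where
  product: "B\<^sub>1 f \<Longrightarrow> B\<^sub>2 g \<Longrightarrow> sum_of_products B\<^sub>1 B\<^sub>2 (\<lambda>x. f x * g x)"
| sum: "sum_of_products B\<^sub>1 B\<^sub>2 f \<Longrightarrow> sum_of_products B\<^sub>1 B\<^sub>2 g \<Longrightarrow> sum_of_products B\<^sub>1 B\<^sub>2 (\<lambda>x. f x + g x)"

lemma smooth_class_mult:
  assumes mult: "\<And>f g. B\<^sub>1 f \<Longrightarrow> B\<^sub>2 g \<Longrightarrow> B (\<lambda>x. f x * g x)"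
    and add: "\<And>f g. B f \<Longrightarrow> B g \<Longrightarrow> B (\<lambda>x. f x + g x)"
    and "smooth_class B\<^sub>1 f" "smooth_class B\<^sub>2 g"
  shows "smooth_class B (\<lambda>x. f x * g x)"
proof -
  let ?P = "sum_of_products (smooth_class B\<^sub>1) (smooth_class B\<^sub>2)"
  have "?P (\<lambda>x. f x * g x)"
    by (intro sum_of_products.product assms(3,4))
  then show ?thesis
  proof (cases rule: smooth_class_coinduct)
    case (mem h)
    then show "B h"
    proof induction
      case (product f g)
      then show ?case by (intro mult smooth_class_mem[of B\<^sub>1] smooth_class_mem[of B\<^sub>2])
    next
      case (sum f g)
      then show ?case by (intro add)
    qed
  next
    case (deriv h)
    then show "\<exists>h'. ?P h' \<and> (\<forall>x. (h has_vector_derivative h' x) (at x))"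
    proof induction
      case (product f g)
      then have "((\<lambda>x. f x * g x) has_vector_derivative f x * vderiv g x + vderiv f x * g x) (at x)" for x
        by (intro has_vector_derivative_mult smooth_class_has_vderiv)
      with product show ?case
        by (intro exI[of _ "\<lambda>x. f x * vderiv g x + vderiv f x * g x"])
          (auto intro!: sum_of_products.intros smooth_class_vderiv)
    next
      case (sum f g)
      then show ?case
        by (blast intro: sum_of_products.sum has_vector_derivative_add)
    qed
  qed
qed

lemma smooth_class_affine:
  assumes closed_B: "\<And>f c. B f \<Longrightarrow> B (\<lambda>x. c * f (a * x + b))" and smooth_f: "smooth_class B f"
  shows "smooth_class B (\<lambda>x. f (a * x + b))"
proof -
  define P where "P h \<longleftrightarrow> (\<exists>f c. smooth_class B f \<and> h = (\<lambda>x. c * f (a * x + b)))" for h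
  have "P (\<lambda>x. f (a * x + b))" unfolding P_def using smooth_f by (intro exI[of _ f] exI[of _ 1]) simp
  then show ?thesis
  proof (cases rule: smooth_class_coinduct)
    case (mem h)
    then show "B h" by (auto simp: P_def dest!: smooth_class_mem intro: closed_B)
  next
    case (deriv h)
    then obtain f c where smooth_f: "smooth_class B f" and h_eq: "h = (\<lambda>x. c * f (a * x + b))"
      by (auto simp: P_def)
    have "(h has_vector_derivative (c * a) * vderiv f (a * x + b)) (at x)" for x
      unfolding h_eq mult.assoc
      by (intro has_vector_derivative_mult_right has_vector_derivative_affine
          smooth_class_has_vderiv[OF smooth_f])
    with smooth_class_vderiv[OF smooth_f] show "\<exists>h'. P h' \<and> (\<forall>x. (h has_vector_derivative h' x) (at x))"
      by (auto simp: P_def)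
  qed
qed

subsection \<open>Schwartz functions and their multipliers\<close>

definition poly_bounded :: "(real \<Rightarrow> complex) \<Rightarrow> bool" where
  "poly_bounded f \<longleftrightarrow> (\<exists>C N. \<forall>x. norm (f x) \<le> C * (1 + \<bar>x\<bar>) ^ N)"

definition rapid_decay :: "(real \<Rightarrow> complex) \<Rightarrow> bool" where
  "rapid_decay f \<longleftrightarrow> (\<forall>m. \<exists>C. \<forall>x. norm (f x) \<le> C / (1 + \<bar>x\<bar>) ^ m)"

definition multiplier :: "(real \<Rightarrow> complex) \<Rightarrow> bool" where
  "multiplier = smooth_class poly_bounded"

lemma poly_boundedE:
  assumes "poly_bounded f"
  obtains C N where "C \<ge> 0" "\<And>x. norm (f x) \<le> C * (1 + \<bar>x\<bar>) ^ N"
proof -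
  obtain C N where bound: "\<And>x. norm (f x) \<le> C * (1 + \<bar>x\<bar>) ^ N"
    using assms unfolding poly_bounded_def by blast
  moreover have "0 \<le> C" using order_trans[OF norm_ge_zero bound[of 0]] by simp
  ultimately show thesis using that by blast
qed

lemma rapid_decayE:
  assumes "rapid_decay f"
  obtains C where "C \<ge> 0" "\<And>x. norm (f x) \<le> C / (1 + \<bar>x\<bar>) ^ m"
proof -
  obtain C where bound: "\<And>x. norm (f x) \<le> C / (1 + \<bar>x\<bar>) ^ m"
    using assms unfolding rapid_decay_def by blast
  moreover have "0 \<le> C" using order_trans[OF norm_ge_zero bound[of 0]] by simp
  ultimately show thesis using that by blast
qed

lemma poly_boundedI: "(\<And>x. norm (f x) \<le> C * (1 + \<bar>x\<bar>) ^ N) \<Longrightarrow> poly_bounded f"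
  unfolding poly_bounded_def by blast

lemma bounded_imp_poly_bounded: "(\<And>x. norm (f x) \<le> C) \<Longrightarrow> poly_bounded f"
  by (rule poly_boundedI[of _ C 0]) auto

lemma poly_bounded_power: "poly_bounded (\<lambda>x. of_real (x ^ m))"
  by (rule poly_boundedI[of _ 1 m]) (auto simp: norm_power intro!: power_mono)

lemma poly_bounded_add:
  assumes "poly_bounded f" "poly_bounded g" shows "poly_bounded (\<lambda>x. f x + g x)"
proof -
  obtain C N where f_bound: "C \<ge> 0" "\<And>x. norm (f x) \<le> C * (1 + \<bar>x\<bar>) ^ N"
    using assms(1) poly_boundedE by blast
  obtain D M where g_bound: "D \<ge> 0" "\<And>x. norm (g x) \<le> D * (1 + \<bar>x\<bar>) ^ M"
    using assms(2) poly_boundedE by blast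
  show ?thesis
  proof (rule poly_boundedI)
    fix x
    have "norm (f x + g x) \<le> C * (1 + \<bar>x\<bar>) ^ N + D * (1 + \<bar>x\<bar>) ^ M"
      by (intro norm_triangle_mono f_bound g_bound)
    also have "\<dots> \<le> C * (1 + \<bar>x\<bar>) ^ (N + M) + D * (1 + \<bar>x\<bar>) ^ (N + M)"
      using f_bound(1) g_bound(1) by (intro add_mono mult_left_mono power_increasing) auto
    finally show "norm (f x + g x) \<le> (C + D) * (1 + \<bar>x\<bar>) ^ (N + M)" by (simp add: algebra_simps)
  qed
qed

lemma poly_bounded_mult:
  assumes "poly_bounded f" "poly_bounded g" shows "poly_bounded (\<lambda>x. f x * g x)"
proof -
  obtain C N where f_bound: "C \<ge> 0" "\<And>x. norm (f x) \<le> C * (1 + \<bar>x\<bar>) ^ N"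
    using assms(1) poly_boundedE by blast
  obtain D M where g_bound: "D \<ge> 0" "\<And>x. norm (g x) \<le> D * (1 + \<bar>x\<bar>) ^ M"
    using assms(2) poly_boundedE by blast
  have "norm (f x * g x) \<le> (C * D) * (1 + \<bar>x\<bar>) ^ (N + M)" for x
    using mult_mono[OF f_bound(2)[of x] g_bound(2)[of x]] f_bound(1)
    by (simp add: norm_mult power_add mult_ac)
  then show ?thesis by (rule poly_boundedI)
qed

lemma rapid_decay_add:
  assumes "rapid_decay f" "rapid_decay g" shows "rapid_decay (\<lambda>x. f x + g x)"
  unfolding rapid_decay_def
proof
  fix m
  obtain C where f_bound: "\<And>x. norm (f x) \<le> C / (1 + \<bar>x\<bar>) ^ m"
    using rapid_decayE[OF assms(1)] by blast
  obtain D where g_bound: "\<And>x. norm (g x) \<le> D / (1 + \<bar>x\<bar>) ^ m"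
    using rapid_decayE[OF assms(2)] by blast
  have "norm (f x + g x) \<le> (C + D) / (1 + \<bar>x\<bar>) ^ m" for x
    unfolding add_divide_distrib by (intro norm_triangle_mono f_bound g_bound)
  then show "\<exists>C. \<forall>x. norm (f x + g x) \<le> C / (1 + \<bar>x\<bar>) ^ m" by blast
qed

lemma rapid_decay_mult:
  assumes "rapid_decay f" "poly_bounded g" shows "rapid_decay (\<lambda>x. f x * g x)"
  unfolding rapid_decay_def
proof
  fix m
  obtain D N where g_bound: "D \<ge> 0" "\<And>x. norm (g x) \<le> D * (1 + \<bar>x\<bar>) ^ N"
    using assms(2) poly_boundedE by blast
  obtain C where f_bound: "C \<ge> 0" "\<And>x. norm (f x) \<le> C / (1 + \<bar>x\<bar>) ^ (m + N)"
    using rapid_decayE[OF assms(1)] by blast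
  have "norm (f x * g x) \<le> (C * D) / (1 + \<bar>x\<bar>) ^ m" for x
  proof -
    have "norm (f x * g x) \<le> C / (1 + \<bar>x\<bar>) ^ (m + N) * (D * (1 + \<bar>x\<bar>) ^ N)"
      unfolding norm_mult using f_bound by (intro mult_mono f_bound(2) g_bound(2)) auto
    also have "\<dots> = C * D / (1 + \<bar>x\<bar>) ^ m" by (simp add: power_add add_nonneg_eq_0_iff)
    finally show ?thesis .
  qed
  then show "\<exists>C. \<forall>x. norm (f x * g x) \<le> C / (1 + \<bar>x\<bar>) ^ m" by blast
qed

lemma rapid_decay_scale:
  assumes decay_f: "rapid_decay f" and "a \<noteq> 0" shows "rapid_decay (\<lambda>x. f (a * x))"
  unfolding rapid_decay_def
proof
  fix m
  define \<kappa> where "\<kappa> = max 1 (1 / \<bar>a\<bar>)"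
  have "\<kappa> > 0" by (simp add: \<kappa>_def)
  obtain C where C_bound: "C \<ge> 0" "\<And>x. norm (f x) \<le> C / (1 + \<bar>x\<bar>) ^ m"
    using rapid_decayE[OF decay_f] by blast
  have "norm (f (a * x)) \<le> C * \<kappa> ^ m / (1 + \<bar>x\<bar>) ^ m" for x
  proof -
    have "1 + \<bar>x\<bar> \<le> \<kappa> * 1 + \<kappa> * \<bar>a * x\<bar>"
    proof (rule add_mono)
      have "\<bar>x\<bar> = 1 / \<bar>a\<bar> * \<bar>a * x\<bar>" using assms(2) by (simp add: abs_mult)
      also have "\<dots> \<le> \<kappa> * \<bar>a * x\<bar>" by (intro mult_right_mono) (auto simp: \<kappa>_def)
      finally show "\<bar>x\<bar> \<le> \<kappa> * \<bar>a * x\<bar>" .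
    qed (simp add: \<kappa>_def)
    then have "(1 + \<bar>x\<bar>) ^ m \<le> (\<kappa> * (1 + \<bar>a * x\<bar>)) ^ m"
      by (intro power_mono) (simp_all add: distrib_left)
    then have "C / (1 + \<bar>a * x\<bar>) ^ m \<le> C * \<kappa> ^ m / (1 + \<bar>x\<bar>) ^ m"
      using C_bound(1) mult_left_mono[of "(1 + \<bar>x\<bar>) ^ m" "\<kappa> ^ m * (1 + \<bar>a * x\<bar>) ^ m" C]
      by (simp add: power_mult_distrib frac_le_eq divide_simps mult_ac add_pos_nonneg)
    with C_bound(2)[of "a * x"] show ?thesis by linarith
  qed
  then show "\<exists>C. \<forall>x. norm (f (a * x)) \<le> C / (1 + \<bar>x\<bar>) ^ m" by blast
qed

lemma one_plus_abs_power_le: "(1 + \<bar>x\<bar>) ^ m \<le> 2 ^ m * (1 + \<bar>x\<bar> ^ m)" for x :: real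
proof -
  have "(1 + \<bar>x\<bar>) ^ m \<le> (2 * max 1 \<bar>x\<bar>) ^ m" by (intro power_mono) auto
  also have "\<dots> \<le> 2 ^ m * (1 + \<bar>x\<bar> ^ m)"
    unfolding power_mult_distrib by (intro mult_left_mono) (auto simp: max_def)
  finally show ?thesis .
qed

lemma norm_le_of_weighted_bounds:
  fixes z :: complex
  assumes "norm z \<le> A" "norm (x ^ m *\<^sub>R z) \<le> B"
  shows "norm z \<le> 2 ^ m * (A + B) / (1 + \<bar>x\<bar>) ^ m"
proof -
  have "norm z * (1 + \<bar>x\<bar>) ^ m \<le> norm z * (2 ^ m * (1 + \<bar>x\<bar> ^ m))"
    by (intro mult_left_mono one_plus_abs_power_le) auto
  also have "\<dots> = 2 ^ m * (norm z + norm (x ^ m *\<^sub>R z))" by (simp add: algebra_simps power_abs)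
  also have "\<dots> \<le> 2 ^ m * (A + B)" using assms by (intro mult_left_mono add_mono) auto
  finally show ?thesis by (simp add: pos_le_divide_eq)
qed

lemma rapid_decay_iff_bounded:
  "rapid_decay f \<longleftrightarrow> (\<forall>m. bounded (range (\<lambda>x. x ^ m *\<^sub>R f x)))"
proof (intro iffI allI)
  fix m
  assume "rapid_decay f"
  then obtain C where C_bound: "\<And>x. norm (f x) \<le> C / (1 + \<bar>x\<bar>) ^ m" using rapid_decayE by blast
  have "norm (x ^ m *\<^sub>R f x) \<le> C" for x
  proof -
    have "norm (x ^ m *\<^sub>R f x) \<le> (1 + \<bar>x\<bar>) ^ m * norm (f x)"
      by (auto simp: power_abs intro!: mult_right_mono power_mono)
    also have "\<dots> \<le> C" using C_bound[of x] by (simp add: pos_le_divide_eq mult.commute)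
    finally show ?thesis .
  qed
  then show "bounded (range (\<lambda>x. x ^ m *\<^sub>R f x))" unfolding bounded_iff by blast
next
  assume bounded: "\<forall>m. bounded (range (\<lambda>x. x ^ m *\<^sub>R f x))"
  show "rapid_decay f" unfolding rapid_decay_def
  proof
    fix m
    obtain A where "\<And>x. norm (x ^ 0 *\<^sub>R f x) \<le> A"
      using bounded unfolding bounded_iff by (metis rangeI)
    moreover obtain B where "\<And>x. norm (x ^ m *\<^sub>R f x) \<le> B"
      using bounded unfolding bounded_iff by (metis rangeI)
    ultimately have "norm (f x) \<le> 2 ^ m * (A + B) / (1 + \<bar>x\<bar>) ^ m" for x
      by (intro norm_le_of_weighted_bounds) auto
    then show "\<exists>C. \<forall>x. norm (f x) \<le> C / (1 + \<bar>x\<bar>) ^ m" by blast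
  qed
qed

lemma rapid_decay_tendsto_0:
  assumes "rapid_decay f" shows "(f \<longlongrightarrow> 0) at_infinity"
proof -
  obtain C where C_bound: "C \<ge> 0" "\<And>x. norm (f x) \<le> C / (1 + \<bar>x\<bar>) ^ 1"
    using rapid_decayE[OF assms] by blast
  have "filterlim (\<lambda>x::real. 1 + norm x) at_infinity at_infinity"
    by (intro filterlim_at_top_imp_at_infinity filterlim_tendsto_add_at_top[OF tendsto_const]
        filterlim_norm_at_top)
  then have "((\<lambda>x::real. C / (1 + norm x)) \<longlongrightarrow> 0) at_infinity"
    by (rule tendsto_divide_0[OF tendsto_const])
  then show ?thesis
    by (rule Lim_null_comparison[rotated]) (use C_bound in auto)
qed

lemma rapid_decay_tendsto_at_top: "rapid_decay f \<Longrightarrow> (f \<longlongrightarrow> 0) at_top"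
  by (meson at_top_le_at_infinity rapid_decay_tendsto_0 tendsto_mono)

lemma rapid_decay_tendsto_at_bot: "rapid_decay f \<Longrightarrow> (f \<longlongrightarrow> 0) at_bot"
  by (meson at_bot_le_at_infinity rapid_decay_tendsto_0 tendsto_mono)

lemma schwartz_iff_smooth_class: "schwartz f \<longleftrightarrow> smooth_class rapid_decay f"
  unfolding schwartz_def smooth_def smooth_class_def rapid_decay_iff_bounded by blast

lemma schwartz_smooth: "schwartz f \<Longrightarrow> smooth f"
  by (simp add: schwartz_def)

lemma schwartz_rapid_decay: "schwartz f \<Longrightarrow> rapid_decay f"
  by (simp add: schwartz_iff_smooth_class smooth_class_mem[of rapid_decay])

lemma schwartz_vderiv: "schwartz f \<Longrightarrow> schwartz (vderiv f)"
  by (simp add: schwartz_iff_smooth_class smooth_class_vderiv)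

lemma schwartz_funpow_vderiv: "schwartz f \<Longrightarrow> schwartz ((vderiv ^^ n) f)"
  by (induction n) (auto intro: schwartz_vderiv)

lemma schwartz_has_vderiv: "schwartz f \<Longrightarrow> (f has_vector_derivative vderiv f x) (at x)"
  by (simp add: schwartz_iff_smooth_class smooth_class_has_vderiv)

lemma continuous_on_has_vector_derivative:
  "(\<And>x. (f has_vector_derivative f' x) (at x)) \<Longrightarrow> continuous_on S f"
  by (meson continuous_at_imp_continuous_on has_vector_derivative_continuous)

lemma schwartz_continuous_on: "schwartz f \<Longrightarrow> continuous_on S f"
  by (rule continuous_on_has_vector_derivative) (rule schwartz_has_vderiv)

lemma schwartz_add: "schwartz f \<Longrightarrow> schwartz g \<Longrightarrow> schwartz (\<lambda>x. f x + g x)"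
  unfolding schwartz_iff_smooth_class by (intro smooth_class_add rapid_decay_add)

lemma multiplier_add: "multiplier f \<Longrightarrow> multiplier g \<Longrightarrow> multiplier (\<lambda>x. f x + g x)"
  unfolding multiplier_def by (intro smooth_class_add poly_bounded_add)

lemma multiplier_mult: "multiplier f \<Longrightarrow> multiplier g \<Longrightarrow> multiplier (\<lambda>x. f x * g x)"
  unfolding multiplier_def by (intro smooth_class_mult poly_bounded_mult poly_bounded_add)

lemma multiplier_vderiv: "multiplier f \<Longrightarrow> multiplier (vderiv f)"
  unfolding multiplier_def by (rule smooth_class_vderiv)

lemma multiplier_has_vderiv: "multiplier f \<Longrightarrow> (f has_vector_derivative vderiv f x) (at x)"
  unfolding multiplier_def by (rule smooth_class_has_vderiv)

lemma schwartz_multiplier_mult: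
  assumes "multiplier u" "schwartz f" shows "schwartz (\<lambda>x. u x * f x)"
proof (unfold schwartz_iff_smooth_class, rule smooth_class_mult)
  show "rapid_decay (\<lambda>x. g x * h x)" if "poly_bounded g" "rapid_decay h" for g h
    using rapid_decay_mult[OF that(2,1)] by (simp add: mult.commute)
qed (use assms in \<open>auto simp: multiplier_def schwartz_iff_smooth_class intro: rapid_decay_add\<close>)

lemma multiplier_exp:
  fixes a :: real shows "multiplier (\<lambda>t. exp (\<i> * a * t))"
proof -
  define P where "P h \<longleftrightarrow> (\<exists>c. h = (\<lambda>t::real. c * exp (\<i> * a * t)))" for h
  have "P (\<lambda>t. exp (\<i> * a * t))" unfolding P_def by (rule exI[of _ 1]) simp
  then have "smooth_class poly_bounded (\<lambda>t. exp (\<i> * a * t))"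
  proof (cases rule: smooth_class_coinduct)
    case (mem h)
    then obtain c where "h = (\<lambda>t. c * exp (\<i> * a * t))" by (auto simp: P_def)
    then show "poly_bounded h" by (simp add: norm_mult bounded_imp_poly_bounded[of _ "norm c"])
  next
    case (deriv h)
    then obtain c where h_eq: "h = (\<lambda>t. c * exp (\<i> * a * t))" by (auto simp: P_def)
    have "(h has_vector_derivative (c * \<i> * a) * exp (\<i> * a * t)) (at t)" for t
      unfolding h_eq
      by (auto intro!: derivative_eq_intros has_vector_derivative_real_field simp: algebra_simps)
    then show "\<exists>h'. P h' \<and> (\<forall>x. (h has_vector_derivative h' x) (at x))" by (auto simp: P_def)
  qed
  then show ?thesis by (simp add: multiplier_def)
qed

lemma multiplier_const: "multiplier (\<lambda>_. c)"
proof -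
  have "poly_bounded (\<lambda>_. c)" for c by (rule bounded_imp_poly_bounded[of _ "norm c"]) simp
  then have "smooth_class poly_bounded (\<lambda>_. c)"
    by (intro smooth_class_coinduct[of "\<lambda>f. \<exists>c. f = (\<lambda>_. c)"]) (auto intro!: exI[of _ "\<lambda>_. 0"])
  then show ?thesis by (simp add: multiplier_def)
qed

lemma mult_inverse_power_has_vderiv:
  assumes "multiplier u" "multiplier D" "D x \<noteq> 0"
  shows "((\<lambda>x. u x * inverse (D x) ^ n) has_vector_derivative
    (vderiv u x * D x + (- of_nat n * vderiv D x) * u x) * inverse (D x) ^ Suc n) (at x)"
proof -
  have "((\<lambda>z. inverse z ^ n) has_field_derivative - of_nat n * inverse (D x) ^ Suc n) (at (D x))"
    using DERIV_power[OF DERIV_inverse[OF assms(3)], of n] by (cases n) (simp_all add: algebra_simps)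
  from field_vector_diff_chain_at[OF multiplier_has_vderiv[OF assms(2)] this]
  have "((\<lambda>x. inverse (D x) ^ n) has_vector_derivative
      vderiv D x * (- of_nat n * inverse (D x) ^ Suc n)) (at x)" by (simp add: o_def)
  from has_vector_derivative_mult[OF multiplier_has_vderiv[OF assms(1)] this] show ?thesis
    using assms(3) by (simp add: field_simps)
qed

lemma multiplier_inverse:
  assumes multiplier_D: "multiplier D" and "c > 0" and lower_bound: "\<And>x. c \<le> norm (D x) * (1 + \<bar>x\<bar>) ^ N"
  shows "multiplier (\<lambda>x. inverse (D x))"
proof -
  have D_nonzero: "D x \<noteq> 0" for x using lower_bound[of x] \<open>c > 0\<close> by auto
  have poly_bounded_inverse: "poly_bounded (\<lambda>x. inverse (D x))"
    using lower_bound D_nonzero \<open>c > 0\<close>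
    by (intro poly_boundedI[of _ "1 / c" N]) (simp add: norm_divide divide_simps mult_ac)
  define P where
    "P h \<longleftrightarrow> (\<exists>u n. multiplier u \<and> h = (\<lambda>x. u x * inverse (D x) ^ n))" for h
  have "P (\<lambda>x. inverse (D x))"
    unfolding P_def by (intro exI[of _ "\<lambda>_. 1"] exI[of _ 1]) (simp add: multiplier_const)
  then have "smooth_class poly_bounded (\<lambda>x. inverse (D x))"
  proof (cases rule: smooth_class_coinduct)
    case (mem h)
    have "poly_bounded (\<lambda>x. inverse (D x) ^ n)" for n
      by (induction n) (simp_all add: poly_bounded_mult poly_bounded_inverse
          bounded_imp_poly_bounded[of "\<lambda>_. 1" 1])
    moreover obtain u n where "smooth_class poly_bounded u" "h = (\<lambda>x. u x * inverse (D x) ^ n)"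
      using mem by (auto simp: P_def multiplier_def)
    ultimately show "poly_bounded h" by (simp add: poly_bounded_mult smooth_class_mem[of poly_bounded])
  next
    case (deriv h)
    then obtain u n where multiplier_u: "multiplier u" and h_eq: "h = (\<lambda>x. u x * inverse (D x) ^ n)"
      by (auto simp: P_def)
    have "multiplier (\<lambda>x. vderiv u x * D x + (- of_nat n * vderiv D x) * u x)"
      by (intro multiplier_add multiplier_mult multiplier_const multiplier_vderiv multiplier_u multiplier_D)
    then show "\<exists>h'. P h' \<and> (\<forall>x. (h has_vector_derivative h' x) (at x))"
      unfolding P_def h_eq
      using mult_inverse_power_has_vderiv[OF multiplier_u multiplier_D D_nonzero] by blast
  qed
  then show ?thesis by (simp add: multiplier_def)
qed

lemma schwartz_cmult: "schwartz f \<Longrightarrow> schwartz (\<lambda>x. c * f x)"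
  by (rule schwartz_multiplier_mult[OF multiplier_const])

lemma schwartz_scale:
  assumes "schwartz f" "a \<noteq> 0" shows "schwartz (\<lambda>x. f (a * x))"
proof -
  have "rapid_decay (\<lambda>x. c * f (a * x + 0))" if "rapid_decay f" for f c
    using rapid_decay_mult[OF rapid_decay_scale[OF that assms(2)], of "\<lambda>_. c"]
    by (simp add: mult.commute bounded_imp_poly_bounded[of "\<lambda>_. c" "norm c"])
  then show ?thesis
    using smooth_class_affine[of rapid_decay a 0 f] assms(1) by (simp add: schwartz_iff_smooth_class)
qed

lemma schwartz_reflect: "schwartz f \<Longrightarrow> schwartz (\<lambda>x. f (- x))"
  using schwartz_scale[of f "-1"] by simp

subsection \<open>The Fourier transform\<close>

lemma integrable_of_quadratic_decay:
  fixes f :: "real \<Rightarrow> complex"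
  assumes "continuous_on UNIV f" and bound: "\<And>x. norm (f x) \<le> C / (1 + \<bar>x\<bar>) ^ 2"
  shows "integrable lborel f"
proof (rule Bochner_Integration.integrable_bound)
  have "set_integrable lborel (einterval (-\<infinity>) \<infinity>) (\<lambda>x::real. inverse (1 + x^2))"
    by (rule integrable_inverse_1_plus_square)
  then show "integrable lborel (\<lambda>x::real. C * inverse (1 + x^2))" by (simp add: set_integrable_def)
  show "f \<in> borel_measurable lborel"
    using borel_measurable_continuous_onI[OF assms(1)] by simp
  have "norm (f x) \<le> norm (C * inverse (1 + x^2))" for x
  proof -
    have "C \<ge> 0" using order_trans[OF norm_ge_zero bound[of 0]] by simp
    then have "C / (1 + \<bar>x\<bar>) ^ 2 \<le> C / (1 + x^2)"
      by (intro divide_left_mono mult_pos_pos add_pos_nonneg zero_less_power) (auto simp: power2_sum)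
    with bound[of x] \<open>C \<ge> 0\<close> show ?thesis by (simp add: divide_inverse abs_mult)
  qed
  then show "AE x in lborel. norm (f x) \<le> norm (C * inverse (1 + x^2))" by simp
qed

lemma integrable_of_rapid_decay: "continuous_on UNIV f \<Longrightarrow> rapid_decay f \<Longrightarrow> integrable lborel f"
  by (metis integrable_of_quadratic_decay rapid_decayE)

lemma schwartz_integrable: "schwartz f \<Longrightarrow> integrable lborel f"
  by (intro integrable_of_rapid_decay schwartz_continuous_on schwartz_rapid_decay)

lemma fourier_integrable:
  fixes t :: real
  assumes "integrable lborel f"
  shows "integrable lborel (\<lambda>x::real. exp (- 2 * pi * \<i> * t * x) * f x)"
  by (rule Bochner_Integration.integrable_bound[OF assms])
     (use assms in \<open>auto simp: norm_mult\<close>)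

lemma norm_fourier_le:
  "norm (fourier f t) \<le> (LINT x|lborel. norm (f x))"
proof -
  have "norm (fourier f t) \<le> (LINT x|lborel. norm (exp (- 2 * pi * \<i> * t * x) * f x))"
    unfolding fourier_def by (rule integral_norm_bound)
  then show ?thesis by (simp add: norm_mult)
qed

lemma continuous_on_fourier:
  assumes integrable_f: "integrable lborel f" shows "continuous_on S (fourier f)"
proof -
  have "isCont (fourier f) t" for t
    unfolding continuous_at_sequentially
  proof (intro allI impI)
    fix X :: "nat \<Rightarrow> real" assume X_tendsto: "X \<longlonglongrightarrow> t"
    show "(fourier f \<circ> X) \<longlonglongrightarrow> fourier f t"
      unfolding fourier_def o_def
    proof (rule integral_dominated_convergence[where w = "\<lambda>x. norm (f x)"])
      show "AE x in lborel. (\<lambda>n. exp (- 2 * pi * \<i> * X n * x) * f x) \<longlonglongrightarrow> exp (- 2 * pi * \<i> * t * x) * f x"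
        using X_tendsto by (auto intro!: tendsto_intros)
    qed (use integrable_f in \<open>auto simp: norm_mult intro!: borel_measurable_integrable\<close>)
  qed
  then show ?thesis by (simp add: continuous_at_imp_continuous_on)
qed

lemma fourier_add:
  "integrable lborel f \<Longrightarrow> integrable lborel g \<Longrightarrow> fourier (\<lambda>x. f x + g x) t = fourier f t + fourier g t"
  unfolding fourier_def distrib_left by (intro Bochner_Integration.integral_add fourier_integrable)

lemma fourier_cmult: "fourier (\<lambda>x. c * f x) t = c * fourier f t"
  unfolding fourier_def by (subst integral_mult_right_zero[symmetric]) (simp add: mult_ac)

lemma fourier_modulate: "fourier (\<lambda>x. exp (2 * pi * \<i> * c * x) * f x) t = fourier f (t - c)"
proof -
  have "exp (- 2 * pi * \<i> * t * x) * exp (2 * pi * \<i> * c * x) = exp (- 2 * pi * \<i> * (t - c) * x)"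
      for x :: real
    by (simp add: exp_add[symmetric] algebra_simps)
  then show ?thesis unfolding fourier_def of_real_diff
    by (intro Bochner_Integration.integral_cong refl) (simp only: mult.assoc[symmetric])
qed

lemma fourier_scale:
  assumes "a \<noteq> 0" shows "fourier (\<lambda>x. f (a * x)) t = fourier f (t / a) / \<bar>a\<bar>"
proof -
  have "fourier f (t / a)
      = \<bar>a\<bar> *\<^sub>R (LINT x|lborel. exp (- 2 * pi * \<i> * (t / a) * (0 + a * x)) * f (0 + a * x))"
    unfolding fourier_def by (subst lborel_integral_real_affine[OF assms, of _ 0]) simp
  also have "(LINT x|lborel. exp (- 2 * pi * \<i> * (t / a) * (0 + a * x)) * f (0 + a * x))
     = fourier (\<lambda>x. f (a * x)) t"
    unfolding fourier_def using assms
    by (intro Bochner_Integration.integral_cong refl) (simp add: mult_ac)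
  finally show ?thesis using assms by (simp add: scaleR_conv_of_real)
qed

lemma fourier_reflect: "fourier (\<lambda>x. f (- x)) t = fourier f (- t)"
  using fourier_scale[of "-1" f t] by simp

lemma lborel_integral_FTC_eq_0:
  fixes F :: "real \<Rightarrow> complex"
  assumes "\<And>x. (F has_vector_derivative f x) (at x)" "continuous_on UNIV f" "integrable lborel f"
    and "rapid_decay F"
  shows "(LINT x|lborel. f x) = 0"
proof -
  have "(LBINT x=-\<infinity>..\<infinity>. f x) = 0 - 0"
    using assms(1-3) rapid_decay_tendsto_at_top[OF assms(4)] rapid_decay_tendsto_at_bot[OF assms(4)]
    by (intro interval_integral_FTC_integrable[where F = F])
       (auto simp: ereal_tendsto_simps continuous_on_eq_continuous_at set_integrable_def)
  then show ?thesis by (simp add: interval_lebesgue_integral_def set_lebesgue_integral_def)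
qed

lemma fourier_vderiv:
  assumes schwartz_f: "schwartz f" shows "fourier (vderiv f) t = 2 * pi * \<i> * t * fourier f t"
proof -
  define e where "e = (\<lambda>x::real. exp (\<i> * (- 2 * pi * t) * x))"
  have fourier_eq: "fourier g t = (LINT x|lborel. e x * g x)" for g
    by (simp add: fourier_def e_def mult_ac)
  have "multiplier e" using multiplier_exp[of "- 2 * pi * t"] by (simp add: e_def)
  then have schwartz_modulated: "schwartz (\<lambda>x. e x * f x)" "schwartz (\<lambda>x. e x * vderiv f x)"
    by (rule schwartz_multiplier_mult, intro schwartz_f schwartz_vderiv)+
  have "(e has_vector_derivative (- 2 * pi * \<i> * t) * e x) (at x)" for x
    unfolding e_def by (auto intro!: derivative_eq_intros has_vector_derivative_real_field)
  from has_vector_derivative_mult[OF this schwartz_has_vderiv[OF schwartz_f]]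
  have deriv: "((\<lambda>x. e x * f x) has_vector_derivative
      e x * vderiv f x + (- 2 * pi * \<i> * t) * (e x * f x)) (at x)" for x
    by (simp add: mult_ac)
  have "schwartz (\<lambda>x. e x * vderiv f x + (- 2 * pi * \<i> * t) * (e x * f x))"
    by (intro schwartz_add schwartz_cmult schwartz_modulated)
  then have "(LINT x|lborel. e x * vderiv f x + (- 2 * pi * \<i> * t) * (e x * f x)) = 0"
    by (intro lborel_integral_FTC_eq_0[OF deriv] schwartz_continuous_on schwartz_integrable
        schwartz_rapid_decay schwartz_modulated)
  then show ?thesis
    using schwartz_integrable[OF schwartz_modulated(1)] schwartz_integrable[OF schwartz_modulated(2)]
    by (simp add: fourier_eq)
qed

lemma fourier_funpow_vderiv:
  "schwartz f \<Longrightarrow> fourier ((vderiv ^^ n) f) t = (2 * pi * \<i> * t) ^ n * fourier f t"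
  by (induction n) (simp_all add: fourier_vderiv schwartz_funpow_vderiv)

lemma rapid_decay_fourier:
  assumes schwartz_f: "schwartz f" shows "rapid_decay (fourier f)"
  unfolding rapid_decay_iff_bounded
proof
  fix m
  define C where "C = (LINT x|lborel. norm ((vderiv ^^ m) f x))"
  have "norm (t ^ m *\<^sub>R fourier f t) \<le> C" for t
  proof -
    have "1 * norm (t ^ m *\<^sub>R fourier f t) \<le> (2 * pi) ^ m * norm (t ^ m *\<^sub>R fourier f t)"
      using pi_gt3 by (intro mult_right_mono one_le_power) auto
    also have "\<dots> = norm (fourier ((vderiv ^^ m) f) t)"
      by (simp add: fourier_funpow_vderiv[OF schwartz_f] norm_mult norm_power power_mult_distrib mult_ac
          abs_mult power_abs)
    also have "\<dots> \<le> C" unfolding C_def by (rule norm_fourier_le)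
    finally show ?thesis by simp
  qed
  then show "bounded (range (\<lambda>t. t ^ m *\<^sub>R fourier f t))" unfolding bounded_iff by blast
qed

lemma schwartz_continuous_on_fourier: "schwartz f \<Longrightarrow> continuous_on S (fourier f)"
  by (intro continuous_on_fourier schwartz_integrable)

lemma schwartz_fourier_integrable: "schwartz f \<Longrightarrow> integrable lborel (fourier f)"
  by (intro integrable_of_rapid_decay schwartz_continuous_on_fourier rapid_decay_fourier)

lemma fourier_fourier_mult:
  assumes integrable_p: "integrable lborel p" and integrable_h: "integrable lborel h"
  shows "fourier (\<lambda>t. fourier p t * h t) x = (LINT u|lborel. p u * fourier h (u + x))"
proof -
  have [measurable]: "p \<in> borel_measurable borel" "h \<in> borel_measurable borel"
    using integrable_p integrable_h by (simp_all add: borel_measurable_integrable)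
  define g where "g t u = exp (- 2 * pi * \<i> * (u + x) * t) * p u * h t" for t u :: real
  have norm_g: "norm (g t u) = norm (p u) * norm (h t)" for t u by (simp add: g_def norm_mult)
  have "integrable (lborel \<Otimes>\<^sub>M lborel) (\<lambda>(t, u). g t u)"
  proof (rule lborel_pair.Fubini_integrable)
    show "(\<lambda>(t, u). g t u) \<in> borel_measurable (lborel \<Otimes>\<^sub>M lborel)" unfolding g_def by measurable
    show "integrable lborel (\<lambda>t. LINT u|lborel. norm (case (t, u) of (t, u) \<Rightarrow> g t u))"
      using integrable_h by (simp add: norm_g)
    have "integrable lborel (g t)" for t
    proof (rule Bochner_Integration.integrable_bound)
      show "integrable lborel (\<lambda>u. norm (p u) * norm (h t))"
        using integrable_p by (intro integrable_mult_left) auto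
      show "g t \<in> borel_measurable lborel" unfolding g_def by measurable
    qed (simp add: norm_g)
    then show "AE t in lborel. integrable lborel (\<lambda>u. case (t, u) of (t, u) \<Rightarrow> g t u)" by simp
  qed
  then have "(LINT u|lborel. LINT t|lborel. g t u) = (LINT t|lborel. LINT u|lborel. g t u)"
    using lborel_pair.Fubini_integral by force
  moreover have "(LINT u|lborel. g t u) = exp (- 2 * pi * \<i> * x * t) * (fourier p t * h t)" for t
  proof -
    have "g t u = exp (- 2 * pi * \<i> * x * t) * h t * (exp (- 2 * pi * \<i> * t * u) * p u)" for u
      unfolding g_def by (simp add: algebra_simps flip: exp_add)
    then have "(LINT u|lborel. g t u) = exp (- 2 * pi * \<i> * x * t) * h t * fourier p t"
      by (simp only: fourier_def integral_mult_right_zero)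
    then show ?thesis by (simp only: mult_ac)
  qed
  moreover have "(LINT t|lborel. g t u) = p u * fourier h (u + x)" for u
  proof -
    have "g t u = p u * (exp (- 2 * pi * \<i> * (u + x) * t) * h t)" for t by (simp add: g_def mult_ac)
    then show ?thesis unfolding fourier_def by simp
  qed
  ultimately show ?thesis by (simp add: fourier_def)
qed

subsection \<open>Sines and difference operators\<close>

definition sin_wave :: "real \<Rightarrow> real \<Rightarrow> complex" where
  "sin_wave w t = of_real (sin (pi * w * t))"

definition sinc_wave :: "real \<Rightarrow> real \<Rightarrow> complex" where
  "sinc_wave w t = of_real (sinc (pi * w * t))"

lemma sin_wave_eq_sinc_wave: "sin_wave w t = pi * w * t * sinc_wave w t"
  by (simp add: sin_wave_def sinc_wave_def)

lemma sinc_wave_0: "sinc_wave w 0 = 1"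
  by (simp add: sinc_wave_def)

lemma sinc_wave_reflect: "sinc_wave w (- t) = sinc_wave w t"
  by (simp add: sinc_wave_def)

lemma sin_wave_reflect: "sin_wave w (- t) = - sin_wave w t"
  by (simp add: sin_wave_def)

lemma sin_wave_int_ratio: "w > 0 \<Longrightarrow> sin_wave w (of_int k / w) = 0"
  by (simp add: sin_wave_def sin_int_times_real mult.commute)

lemma sinc_wave_int_ratio: "w > 0 \<Longrightarrow> k \<noteq> 0 \<Longrightarrow> sinc_wave w (of_int k / w) = 0"
  using sin_wave_int_ratio[of w k] by (simp add: sin_wave_eq_sinc_wave)

lemma sin_wave_eq_exp:
  "sin_wave w t = (1 / (2 * \<i>)) * exp (\<i> * (pi * w) * t) + (- 1 / (2 * \<i>)) * exp (\<i> * (- pi * w) * t)"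
proof -
  have "sin_wave w t = (exp (\<i> * (pi * w) * t) - exp (\<i> * (- pi * w) * t)) / (2 * \<i>)"
    by (simp add: sin_wave_def sin_of_real[symmetric] sin_exp_eq mult_ac)
  then show ?thesis by (simp add: field_simps)
qed

lemma multiplier_sin_wave: "multiplier (sin_wave w)"
proof -
  have "multiplier (\<lambda>t. (1 / (2 * \<i>)) * exp (\<i> * (pi * w) * t)
      + (- 1 / (2 * \<i>)) * exp (\<i> * (- pi * w) * t))"
    using multiplier_exp[of "pi * w"] multiplier_exp[of "- pi * w"]
    by (intro multiplier_add multiplier_mult multiplier_const) simp_all
  then show ?thesis unfolding sin_wave_eq_exp[abs_def] .
qed

definition window :: "real \<Rightarrow> real \<Rightarrow> (real \<Rightarrow> complex) \<Rightarrow> real \<Rightarrow> complex" where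
  "window a b p u = indicator {a..b} u *\<^sub>R p u"

lemma fourier_window:
  assumes "continuous_on {a..b} p"
  shows "fourier (window a b p) t
      = integral {a..b} (\<lambda>u. exp (- 2 * pi * \<i> * t * u) * p u)"
proof -
  have "set_integrable lborel {a..b} (\<lambda>u. exp (- 2 * pi * \<i> * t * u) * p u)"
    by (intro borel_integrable_atLeastAtMost' continuous_intros assms)
  from set_borel_integral_eq_integral(2)[OF this] show ?thesis
    unfolding fourier_def window_def set_lebesgue_integral_def by simp
qed

lemma fourier_window_has_vector_derivative:
  assumes "continuous_on {a..b} p"
  shows "(fourier (window a b p) has_vector_derivative
     fourier (window a b (\<lambda>u. - 2 * pi * \<i> * u * p u)) t) (at t)"
proof -
  have "((\<lambda>t. integral (cbox a b) (\<lambda>u. exp (- 2 * pi * \<i> * t * u) * p u)) has_vector_derivative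
     integral (cbox a b) (\<lambda>u. exp (- 2 * pi * \<i> * t * u) * (- 2 * pi * \<i> * u * p u))) (at t within UNIV)"
  proof (rule leibniz_rule_vector_derivative)
    show "((\<lambda>t. exp (- 2 * pi * \<i> * t * u) * p u) has_vector_derivative
        exp (- 2 * pi * \<i> * t * u) * (- 2 * pi * \<i> * u * p u)) (at t within UNIV)" for t u :: real
      by (auto intro!: derivative_eq_intros has_vector_derivative_real_field simp: algebra_simps)
    show "(\<lambda>u. exp (- 2 * pi * \<i> * t * u) * p u) integrable_on cbox a b" for t :: real
      using assms by (intro integrable_continuous continuous_intros) auto
    show "continuous_on (UNIV \<times> cbox a b) (\<lambda>(t::real, u). exp (- 2 * pi * \<i> * t * u)
        * (- 2 * pi * \<i> * u * p u))"
      unfolding split_beta using assms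
      by (intro continuous_intros continuous_on_compose2[OF assms]) auto
  qed auto
  moreover have "continuous_on {a..b} (\<lambda>u. - 2 * pi * \<i> * u * p u)"
    by (intro continuous_intros assms)
  moreover have "fourier (window a b p)
      = (\<lambda>t. integral {a..b} (\<lambda>u. exp (- 2 * pi * \<i> * t * u) * p u))"
    by (intro ext fourier_window assms)
  ultimately show ?thesis by (simp only: fourier_window cbox_interval)
qed

lemma multiplier_fourier_window:
  assumes "continuous_on {a..b} p"
  shows "multiplier (fourier (window a b p))"
proof -
  define P where
    "P h \<longleftrightarrow> (\<exists>p. continuous_on {a..b} p \<and> h = fourier (window a b p))" for h
  have "P (fourier (window a b p))" using assms by (auto simp: P_def)
  then have "smooth_class poly_bounded (fourier (window a b p))"
  proof (cases rule: smooth_class_coinduct)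
    case (mem h)
    then show "poly_bounded h"
      by (auto simp: P_def intro!: bounded_imp_poly_bounded[OF norm_fourier_le])
  next
    case (deriv h)
    then obtain p where cont_p: "continuous_on {a..b} p"
      and h_eq: "h = fourier (window a b p)"
      by (auto simp: P_def)
    have "continuous_on {a..b} (\<lambda>u. - 2 * pi * \<i> * u * p u)" by (intro continuous_intros cont_p)
    with fourier_window_has_vector_derivative[OF cont_p]
    show "\<exists>h'. P h' \<and> (\<forall>x. (h has_vector_derivative h' x) (at x))"
      unfolding P_def h_eq by blast
  qed
  then show ?thesis by (simp add: multiplier_def)
qed

lemma sinc_wave_eq_fourier:
  assumes w_pos: "w > 0"
  shows "sinc_wave w = fourier (window (- w / 2) (w / 2) (\<lambda>_. complex_of_real (1 / w)))"
proof
  fix t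
  have "sinc_wave w t = integral {- w / 2..w / 2} (\<lambda>u. exp (- 2 * pi * \<i> * t * u)
      * complex_of_real (1 / w))"
  proof (cases "t = 0")
    case True
    then show ?thesis using w_pos by (simp add: sinc_wave_0 scaleR_conv_of_real)
  next
    case False
    define F where "F u = exp (\<i> * (- 2 * pi * t) * u) / (- 2 * pi * \<i> * t * w)" for u :: real
    have "((\<lambda>u. exp (- 2 * pi * \<i> * t * u) * complex_of_real (1 / w))
        has_integral F (w / 2) - F (- w / 2)) {- w / 2..w / 2}"
      unfolding F_def using w_pos False by (intro fundamental_theorem_of_calculus)
        (auto intro!: derivative_eq_intros has_vector_derivative_real_field simp: mult_ac)
    moreover have "F (w / 2) - F (- w / 2) = sinc_wave w t"
    proof -
      have "F (w / 2) - F (- w / 2) = sin_wave w t / (pi * w * t)"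
        unfolding F_def sin_wave_eq_exp using w_pos False by (simp add: field_simps)
      then show ?thesis using w_pos False by (simp add: sin_wave_eq_sinc_wave)
    qed
    ultimately show ?thesis by (metis integral_unique)
  qed
  then show "sinc_wave w t = fourier (window (- w / 2) (w / 2) (\<lambda>_. complex_of_real (1 / w))) t"
    by (subst fourier_window) auto
qed

lemma multiplier_sinc_wave: "w > 0 \<Longrightarrow> multiplier (sinc_wave w)"
  unfolding sinc_wave_eq_fourier by (intro multiplier_fourier_window continuous_on_const)

lemma vderiv_sinc_wave_0:
  assumes w_pos: "w > 0"
  shows "vderiv (sinc_wave w) 0 = 0" and "vderiv (vderiv (sinc_wave w)) 0 = - (pi * w)\<^sup>2 / 3"
proof -
  let ?d = "\<lambda>u::real. - 2 * pi * \<i> * u"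
  have cont: "continuous_on {- w / 2..w / 2} (\<lambda>u. ?d u * complex_of_real (1 / w))"
    "continuous_on {- w / 2..w / 2} (\<lambda>u. ?d u * (?d u * complex_of_real (1 / w)))"
    by (intro continuous_intros)+
  have deriv: "vderiv (sinc_wave w)
      = fourier (window (- w / 2) (w / 2) (\<lambda>u. ?d u * complex_of_real (1 / w)))"
    unfolding sinc_wave_eq_fourier[OF w_pos]
    by (intro vderiv_eqI fourier_window_has_vector_derivative continuous_on_const)
  have deriv2: "vderiv (vderiv (sinc_wave w))
      = fourier (window (- w / 2) (w / 2) (\<lambda>u. ?d u * (?d u * complex_of_real (1 / w))))"
    unfolding deriv by (intro vderiv_eqI fourier_window_has_vector_derivative cont)
  define F where "F u = - pi * \<i> * u ^ 2 / w" for u :: real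
  define G where "G u = - 4 * complex_of_real pi ^ 2 * u ^ 3 / (3 * w)" for u :: real
  have "vderiv (sinc_wave w) 0 = integral {- w / 2..w / 2} (\<lambda>u. ?d u * complex_of_real (1 / w))"
    unfolding deriv fourier_window[OF cont(1)] by simp
  also have "\<dots> = F (w / 2) - F (- w / 2)"
    unfolding F_def using w_pos by (intro integral_unique fundamental_theorem_of_calculus)
      (auto intro!: derivative_eq_intros has_vector_derivative_real_field simp: field_simps)
  finally show "vderiv (sinc_wave w) 0 = 0" by (simp add: F_def)
  have "vderiv (vderiv (sinc_wave w)) 0
      = integral {- w / 2..w / 2} (\<lambda>u. ?d u * (?d u * complex_of_real (1 / w)))"
    unfolding deriv2 fourier_window[OF cont(2)] by simp
  also have "\<dots> = G (w / 2) - G (- w / 2)"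
    unfolding G_def using w_pos by (intro integral_unique fundamental_theorem_of_calculus)
      (auto intro!: derivative_eq_intros has_vector_derivative_real_field simp: field_simps
          power2_eq_square)
  finally show "vderiv (vderiv (sinc_wave w)) 0 = - (pi * w)\<^sup>2 / 3"
    using w_pos by (simp add: G_def field_simps power2_eq_square power3_eq_cube)
qed

lemma vderiv_sin_wave_0: "vderiv (sin_wave w) 0 = pi * w"
proof -
  have "((\<lambda>t. sin (pi * w * t)) has_real_derivative pi * w) (at 0)"
    by (auto intro!: derivative_eq_intros)
  from has_vector_derivative_of_real[OF this] show ?thesis
    unfolding vderiv_def sin_wave_def[abs_def] by (intro vector_derivative_at) simp
qed

lemma vderiv_mult:
  assumes "multiplier u" "schwartz v"
  shows "vderiv (\<lambda>x. u x * v x) = (\<lambda>x. u x * vderiv v x + vderiv u x * v x)"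
  using assms by (intro vderiv_eqI has_vector_derivative_mult schwartz_has_vderiv multiplier_has_vderiv)

lemma vderiv_add: "schwartz f \<Longrightarrow> schwartz g \<Longrightarrow> vderiv (\<lambda>x. f x + g x) = (\<lambda>x. vderiv f x + vderiv g x)"
  by (intro vderiv_eqI has_vector_derivative_add schwartz_has_vderiv)

lemma vderiv2_mult:
  assumes multiplier_u: "multiplier u" and schwartz_v: "schwartz v"
  shows "vderiv (vderiv (\<lambda>x. u x * v x)) x
    = u x * vderiv (vderiv v) x + 2 * vderiv u x * vderiv v x + vderiv (vderiv u) x * v x"
  using multiplier_u schwartz_v
  by (simp add: vderiv_mult vderiv_add schwartz_vderiv multiplier_vderiv schwartz_multiplier_mult)

definition central_diff :: "real \<Rightarrow> (real \<Rightarrow> complex) \<Rightarrow> real \<Rightarrow> complex" where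
  "central_diff w F x = F (x - w / 2) - F (x + w / 2)"

lemma central_diff_cmult: "central_diff w (\<lambda>x. c * F x) = (\<lambda>x. c * central_diff w F x)"
  by (simp add: central_diff_def fun_eq_iff right_diff_distrib)

lemma central_diff_tendsto_0:
  assumes "(F \<longlongrightarrow> 0) at_top" shows "(central_diff w F \<longlongrightarrow> 0) at_top"
proof -
  have "filterlim (\<lambda>x. c + x) at_top at_top" for c :: real
    by (intro filterlim_tendsto_add_at_top[OF tendsto_const] filterlim_ident)
  then have "((\<lambda>x. F (c + x)) \<longlongrightarrow> 0) at_top" for c
    using filterlim_compose[OF assms] by blast
  from tendsto_diff[OF this[of "- w / 2"] this[of "w / 2"]] show ?thesis
    by (simp add: central_diff_def[abs_def] add.commute[of "w / 2"])
qed

lemma central_diff_has_vector_derivative: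
  assumes "\<And>x. (F has_vector_derivative F' x) (at x)"
  shows "(central_diff w F has_vector_derivative central_diff w F' x) (at x)"
  unfolding central_diff_def[abs_def]
  using has_vector_derivative_affine[OF assms, of 1 "- w / 2"]
    has_vector_derivative_affine[OF assms, of 1 "w / 2"]
  by (intro has_vector_derivative_diff) auto

lemma fourier_sin_wave_mult:
  assumes integrable_g: "integrable lborel g"
  shows "fourier (\<lambda>t. sin_wave w t * g t) = (\<lambda>x. (1 / (2 * \<i>)) * central_diff w (fourier g) x)"
proof
  fix x
  define E where "E c t = exp (2 * pi * \<i> * c * t) * g t" for c t :: real
  have "integrable lborel (E c)" for c
    unfolding E_def[abs_def] using fourier_integrable[OF integrable_g, of "- c"] by simp
  moreover have "fourier (E c) x = fourier g (x - c)" for c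
    unfolding E_def[abs_def] by (rule fourier_modulate)
  moreover have "sin_wave w t * g t = (1 / (2 * \<i>)) * E (w / 2) t + (- 1 / (2 * \<i>)) * E (- w / 2) t" for t
    by (simp add: sin_wave_eq_exp E_def algebra_simps)
  ultimately show "fourier (\<lambda>t. sin_wave w t * g t) x = (1 / (2 * \<i>)) * central_diff w (fourier g) x"
    by (simp only: fourier_add fourier_cmult integrable_mult_right)
      (simp add: central_diff_def algebra_simps)
qed

lemma fourier_sinc_wave_mult:
  assumes w_pos: "w > 0" and integrable_h: "integrable lborel h"
    and F_deriv: "\<And>x. (F has_vector_derivative - (fourier h x / w)) (at x)"
  shows "fourier (\<lambda>t. sinc_wave w t * h t) = central_diff w F"
proof
  fix x
  have integrable_window: "integrable lborel (window (- w / 2) (w / 2) (\<lambda>_. complex_of_real (1 / w)))"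
    using borel_integrable_atLeastAtMost'[of "- w / 2" "w / 2" "\<lambda>_. complex_of_real (1 / w)"]
    by (simp add: set_integrable_def window_def[abs_def])
  have "fourier (\<lambda>t. sinc_wave w t * h t) x = (LINT u:{- w / 2..w / 2}|lborel. fourier h (u + x) / w)"
    unfolding sinc_wave_eq_fourier[OF w_pos] set_lebesgue_integral_def fourier_fourier_mult[OF integrable_window
        integrable_h]
    by (intro Bochner_Integration.integral_cong) (auto simp: window_def indicator_def)
  also have "\<dots> = integral {- w / 2..w / 2} (\<lambda>u. fourier h (u + x) / w)"
    using w_pos
    by (intro set_borel_integral_eq_integral borel_integrable_atLeastAtMost' continuous_intros
        continuous_on_compose2[OF continuous_on_fourier[OF integrable_h, of UNIV]]) auto
  also have "\<dots> = - F (w / 2 + x) - - F (- w / 2 + x)"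
  proof (rule integral_unique, rule fundamental_theorem_of_calculus)
    show "((\<lambda>u. - F (u + x)) has_vector_derivative fourier h (u + x) / w)
        (at u within {- w / 2..w / 2})" for u
      using has_vector_derivative_minus[OF has_vector_derivative_affine[OF F_deriv, of 1 x u]]
      by - (rule has_vector_derivative_at_within, simp)
  qed (use w_pos in simp)
  finally show "fourier (\<lambda>t. sinc_wave w t * h t) x = central_diff w F x"
    by (simp add: central_diff_def add.commute[of "w / 2"])
qed

lemma has_integral_norm_le:
  fixes f :: "real \<Rightarrow> complex"
  assumes "(f has_integral i) S" "(g has_integral j) S" "\<And>x. x \<in> S \<Longrightarrow> norm (f x) \<le> g x"
  shows "norm i \<le> j"
  using has_integral_norm_bound_integral_component[OF assms(1,2), of 1] assms(3) by simp

subsection \<open>Sums over the integers\<close>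

lemma has_sum_int_halves:
  fixes f :: "int \<Rightarrow> 'a::{topological_comm_monoid_add, t2_space}"
  assumes "((\<lambda>n::nat. f (int n)) has_sum a) UNIV" "((\<lambda>n::nat. f (- int n - 1)) has_sum b) UNIV"
  shows "(f has_sum a + b) UNIV"
proof -
  have "n \<in> range int \<union> range (\<lambda>n. - int n - 1)" for n
  proof (cases "n \<ge> 0")
    case True
    then have "n = int (nat n)" by simp
    then show ?thesis by blast
  next
    case False
    then have "n = - int (nat (- n - 1)) - 1" by simp
    then show ?thesis by blast
  qed
  then have "range int \<union> range (\<lambda>n. - int n - 1) = UNIV" by blast
  moreover have "(f has_sum a) (range int)"
    using assms(1) by (simp add: has_sum_reindex o_def)
  moreover have "(f has_sum b) (range (\<lambda>n. - int n - 1))"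
    using assms(2) by (subst has_sum_reindex) (auto simp: inj_on_def o_def)
  moreover have "range int \<inter> range (\<lambda>n. - int n - 1) = {}" by auto
  ultimately show ?thesis using has_sum_Un_disjoint by metis
qed

lemma summable_on_int_halves:
  fixes f :: "int \<Rightarrow> 'a::{topological_comm_monoid_add, t2_space}"
  assumes "(\<lambda>n::nat. f (int n)) summable_on UNIV" "(\<lambda>n::nat. f (- int n - 1)) summable_on UNIV"
  shows "f summable_on UNIV"
  using has_sum_int_halves[OF has_sum_infsum[OF assms(1)] has_sum_infsum[OF assms(2)]]
  by (rule has_sum_imp_summable)

lemma summable_on_nat_inverse_square:
  fixes C w :: real
  assumes "w > 0" shows "(\<lambda>n::nat. C / (1 + real n * w) ^ 2) summable_on UNIV"
proof -
  have "summable (\<lambda>n. inverse (real (Suc n) ^ 2))"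
    by (subst summable_Suc_iff) (rule inverse_power_summable, simp)
  then have "(\<lambda>n::nat. inverse (real (Suc n) ^ 2)) summable_on UNIV"
    by (subst summable_on_UNIV_nonneg_real_iff) auto
  then have "(\<lambda>n::nat. \<bar>C\<bar> / (min 1 w)\<^sup>2 * inverse (real (Suc n) ^ 2)) summable_on UNIV"
    by (rule summable_on_cmult_right)
  then have "(\<lambda>n::nat. norm (C / (1 + real n * w) ^ 2)) summable_on UNIV"
  proof (rule Infinite_Sum.abs_summable_on_comparison_test')
    fix n :: nat
    have "min 1 w * real (Suc n) = min 1 w + real n * min 1 w" by (simp add: algebra_simps)
    also have "\<dots> \<le> 1 + real n * w" by (intro add_mono mult_left_mono) auto
    finally have "(min 1 w * real (Suc n)) ^ 2 \<le> (1 + real n * w) ^ 2"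
      using assms by (intro power_mono) auto
    then have "\<bar>C\<bar> / (1 + real n * w) ^ 2 \<le> \<bar>C\<bar> / (min 1 w * real (Suc n)) ^ 2"
      using assms by (intro divide_left_mono mult_pos_pos zero_less_power add_pos_nonneg) auto
    then show "norm (C / (1 + real n * w) ^ 2) \<le> \<bar>C\<bar> / (min 1 w)\<^sup>2 * inverse (real (Suc n) ^ 2)"
      by (simp add: power_mult_distrib divide_inverse abs_mult)
  qed
  then show ?thesis by (rule abs_summable_summable)
qed

lemma summable_on_int_inverse_square:
  fixes C w :: real
  assumes "w > 0" shows "(\<lambda>k::int. C / (1 + \<bar>of_int k\<bar> * w) ^ 2) summable_on UNIV"
proof (rule summable_on_int_halves)
  have majorant_summable: "(\<lambda>n::nat. C / (1 + real n * w) ^ 2) summable_on UNIV"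
    by (rule summable_on_nat_inverse_square[OF assms])
  then show "(\<lambda>n::nat. C / (1 + \<bar>of_int (int n)\<bar> * w) ^ 2) summable_on UNIV" by simp
  have "(\<lambda>n::nat. C / (1 + real n * w) ^ 2) summable_on range Suc"
    by (rule summable_on_subset_banach[OF majorant_summable]) auto
  then have "(\<lambda>n::nat. C / (1 + real (Suc n) * w) ^ 2) summable_on UNIV"
    by (subst (asm) summable_on_reindex) (auto simp: o_def)
  then show "(\<lambda>n::nat. C / (1 + \<bar>of_int (- int n - 1)\<bar> * w) ^ 2) summable_on UNIV"
    by (simp add: abs_if add.commute)
qed

lemma rapid_decay_abs_summable_int:
  assumes "w > 0" "rapid_decay f" shows "(\<lambda>k::int. norm (f (of_int k / w))) summable_on UNIV"
proof -
  obtain C where C_bound: "\<And>x. norm (f x) \<le> C / (1 + \<bar>x\<bar>) ^ 2" using rapid_decayE[OF assms(2)] by blast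
  have "(\<lambda>k::int. C / (1 + \<bar>of_int k\<bar> * (1 / w)) ^ 2) summable_on UNIV"
    using assms(1) by (intro summable_on_int_inverse_square) simp
  then show ?thesis
  proof (rule Infinite_Sum.abs_summable_on_comparison_test')
    show "norm (f (of_int k / w)) \<le> C / (1 + \<bar>of_int k\<bar> * (1 / w)) ^ 2" for k :: int
      using C_bound[of "of_int k / w"] assms(1) by simp
  qed
qed

subsection \<open>Fourier series at the origin\<close>

text \<open>Abel summation is used because the Poisson kernel is positive and has an elementary closed form.\<close>

definition poisson_kernel :: "real \<Rightarrow> real \<Rightarrow> real" where
  "poisson_kernel r t = (1 - r\<^sup>2) / ((1 - r)\<^sup>2 + 4 * r * (sin (pi * t))\<^sup>2)"

lemma poisson_kernel_denominator_pos:
  assumes "0 \<le> r" "r < 1" shows "(1 - r)\<^sup>2 + 4 * r * (sin (pi * t))\<^sup>2 > 0"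
  using assms by (intro add_pos_nonneg) auto

lemma poisson_kernel_nonneg:
  assumes "0 \<le> r" "r < 1" shows "poisson_kernel r t \<ge> 0"
  using poisson_kernel_denominator_pos[OF assms, of t] assms
  by (simp add: poisson_kernel_def power_le_one)

lemma continuous_on_poisson_kernel:
  assumes "0 \<le> r" "r < 1" shows "continuous_on S (poisson_kernel r)"
  unfolding poisson_kernel_def[abs_def]
  using poisson_kernel_denominator_pos[OF assms] by (intro continuous_intros) (metis less_irrefl)

lemma poisson_kernel_sin_le:
  assumes "0 < r" "r < 1"
  shows "(sin (pi * t))\<^sup>2 * poisson_kernel r t \<le> (1 - r\<^sup>2) / (4 * r)"
proof -
  define s where "s = (sin (pi * t))\<^sup>2"
  have "s * (1 - r\<^sup>2) * (4 * r) \<le> (1 - r\<^sup>2) * ((1 - r)\<^sup>2 + 4 * r * s)"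
    using assms by (simp add: algebra_simps power_le_one mult_left_le_one_le)
  then show ?thesis
    using poisson_kernel_denominator_pos[of r t] assms
    unfolding poisson_kernel_def s_def[symmetric] by (simp add: divide_simps mult_ac)
qed

lemma norm_one_minus_polar_sq:
  "(norm (1 - of_real r * exp (\<i> * of_real (- 2 * pi * t))))\<^sup>2 = (1 - r)\<^sup>2 + 4 * r * (sin (pi * t))\<^sup>2"
proof -
  define \<theta> where "\<theta> = 2 * (pi * t)"
  have "(norm (1 - of_real r * exp (\<i> * of_real (- 2 * pi * t))))\<^sup>2 = (1 - r * cos \<theta>)\<^sup>2 + (r * sin \<theta>)\<^sup>2"
    unfolding cmod_power2 \<theta>_def by (simp add: Re_exp Im_exp mult_ac)
  also have "\<dots> = 1 - 2 * r * cos \<theta> + r\<^sup>2 * ((sin \<theta>)\<^sup>2 + (cos \<theta>)\<^sup>2)" by algebra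
  also have "\<dots> = 1 - 2 * r * (1 - 2 * (sin (pi * t))\<^sup>2) + r\<^sup>2"
    unfolding sin_cos_squared_add by (simp add: \<theta>_def cos_double_sin)
  also have "\<dots> = (1 - r)\<^sup>2 + 4 * r * (sin (pi * t))\<^sup>2" by algebra
  finally show ?thesis .
qed

lemma poisson_kernel_eq_geometric:
  assumes "0 \<le> r" "r < 1" and z_def: "z = of_real r * exp (\<i> * of_real (- 2 * pi * t))"
  shows "1 / (1 - z) + cnj z * (1 / (1 - cnj z)) = of_real (poisson_kernel r t)"
proof -
  have norm_z: "norm z = r" using assms(1) by (simp add: z_def norm_mult)
  then have "z \<noteq> 1" using assms(2) by auto
  then have "1 - z \<noteq> 0" "1 - cnj z \<noteq> 0" by (auto simp: complex_eq_iff)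
  then have "1 / (1 - z) + cnj z * (1 / (1 - cnj z)) = (1 - z * cnj z) / ((1 - z) * (1 - cnj z))"
    by (simp add: divide_simps) (simp add: algebra_simps)
  moreover have "z * cnj z = of_real (r\<^sup>2)" using norm_z by (metis complex_norm_square)
  moreover have "(1 - z) * (1 - cnj z) = of_real ((1 - r)\<^sup>2 + 4 * r * (sin (pi * t))\<^sup>2)"
    using norm_one_minus_polar_sq[of r t] unfolding z_def[symmetric]
    by (metis complex_cnj_diff complex_cnj_one complex_norm_square of_real_power)
  ultimately show ?thesis by (simp add: poisson_kernel_def)
qed

lemma has_sum_poisson_kernel:
  assumes r_range: "0 \<le> r" "r < 1"
  shows "((\<lambda>n::int. of_real r ^ nat \<bar>n\<bar> * exp (- 2 * pi * \<i> * of_int n * t))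
      has_sum of_real (poisson_kernel r t)) UNIV"
    (is "(?f has_sum _) UNIV")
proof -
  define z where "z = of_real r * exp (\<i> * of_real (- 2 * pi * t))"
  have norm_z: "norm z = r" using r_range by (simp add: z_def norm_mult)
  have geometric: "((\<lambda>n. u ^ n) has_sum 1 / (1 - u)) UNIV" if "norm u < 1" for u :: complex
    using that
    by (intro norm_summable_imp_has_sum geometric_sums) (auto simp: norm_power summable_geometric)
  have pos: "?f (int n) = z ^ n" for n
    by (simp add: z_def power_mult_distrib mult_ac flip: exp_of_nat_mult)
  have neg: "?f (- int n - 1) = cnj z * cnj z ^ n" for n
  proof -
    have "?f (- int n - 1) = of_real r ^ Suc n * exp (of_nat (Suc n) * cnj (\<i> * of_real (- 2 * pi * t)))"
      by (simp add: nat_add_distrib algebra_simps)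
    also have "\<dots> = cnj z ^ Suc n"
      unfolding z_def exp_of_nat_mult by (simp add: power_mult_distrib exp_cnj del: power_Suc)
    finally show ?thesis by simp
  qed
  have "((\<lambda>n. ?f (int n)) has_sum 1 / (1 - z)) UNIV"
    unfolding pos using geometric[of z] norm_z r_range by simp
  moreover have "((\<lambda>n. ?f (- int n - 1)) has_sum cnj z * (1 / (1 - cnj z))) UNIV"
    unfolding neg using geometric[of "cnj z"] norm_z r_range by (intro has_sum_cmult_right) simp
  ultimately have "(?f has_sum 1 / (1 - z) + cnj z * (1 / (1 - cnj z))) UNIV"
    by (rule has_sum_int_halves)
  then show ?thesis by (simp only: poisson_kernel_eq_geometric[OF r_range z_def])
qed

lemma has_sum_integral:
  fixes f :: "'a \<Rightarrow> real \<Rightarrow> complex"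
  assumes cont: "\<And>k. continuous_on {a..b} (f k)" and M_summable: "M summable_on UNIV"
    and bound: "\<And>k t. t \<in> {a..b} \<Longrightarrow> norm (f k t) \<le> M k"
  shows "((\<lambda>k. integral {a..b} (f k)) has_sum integral {a..b} (\<lambda>t. \<Sum>\<^sub>\<infinity>k. f k t)) UNIV"
proof -
  have "uniform_limit {a..b} (\<lambda>X t. \<Sum>k\<in>X. f k t) (\<lambda>t. \<Sum>\<^sub>\<infinity>k. f k t) (finite_subsets_at_top UNIV)"
    by (rule Weierstrass_m_test_general) (use M_summable bound in auto)
  then obtain I J where partial_integral: "\<And>X. ((\<lambda>t. \<Sum>k\<in>X. f k t) has_integral I X) {a..b}"
    and limit_integral: "((\<lambda>t. \<Sum>\<^sub>\<infinity>k. f k t) has_integral J) {a..b}" "(I \<longlongrightarrow> J) (finite_subsets_at_top UNIV)"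
    by (rule uniform_limit_integral) (use cont in \<open>auto intro!: continuous_on_sum\<close>)
  have "eventually (\<lambda>X. I X = (\<Sum>k\<in>X. integral {a..b} (f k))) (finite_subsets_at_top UNIV)"
  proof (rule eventually_finite_subsets_at_top_weakI)
    fix X :: "'a set" assume "finite X"
    then have "((\<lambda>t. \<Sum>k\<in>X. f k t) has_integral (\<Sum>k\<in>X. integral {a..b} (f k))) {a..b}"
      using cont by (intro has_integral_sum integrable_integral integrable_continuous_real)
    with partial_integral show "I X = (\<Sum>k\<in>X. integral {a..b} (f k))" using has_integral_unique by blast
  qed
  then have "((\<lambda>X. \<Sum>k\<in>X. integral {a..b} (f k)) \<longlongrightarrow> J) (finite_subsets_at_top UNIV)"
    by (rule Lim_transform_eventually[OF limit_integral(2)])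
  then show ?thesis using integral_unique[OF limit_integral(1)] by (simp add: has_sum_def)
qed

lemma continuous_on_infsum:
  fixes f :: "'a \<Rightarrow> real \<Rightarrow> complex"
  assumes "\<And>k. continuous_on S (f k)" "M summable_on UNIV" "\<And>k t. t \<in> S \<Longrightarrow> norm (f k t) \<le> M k"
  shows "continuous_on S (\<lambda>t. \<Sum>\<^sub>\<infinity>k. f k t)"
proof (rule uniform_limit_theorem)
  show "uniform_limit S (\<lambda>X t. \<Sum>k\<in>X. f k t) (\<lambda>t. \<Sum>\<^sub>\<infinity>k. f k t) (finite_subsets_at_top UNIV)"
    by (rule Weierstrass_m_test_general) (use assms in auto)
qed (use assms(1) in \<open>auto intro!: always_eventually continuous_on_sum\<close>)

lemma integral_exp_int:
  "integral {-1/2..1/2} (\<lambda>t::real. exp (- 2 * pi * \<i> * of_int n * t)) = (if n = 0 then 1 else 0)"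
proof -
  have "fourier (window (- 1 / 2) (1 / 2) (\<lambda>_. complex_of_real (1 / 1))) (of_int n)
      = sinc_wave 1 (of_int n)"
    by (subst sinc_wave_eq_fourier) auto
  then have "integral {-1/2..1/2} (\<lambda>t::real. exp (- 2 * pi * \<i> * of_int n * t)) = sinc_wave 1 (of_int n)"
    by (subst (asm) fourier_window) auto
  then show ?thesis using sinc_wave_int_ratio[of 1 n] by (simp add: sinc_wave_0)
qed

lemma two_abs_le_abs_sin_pi:
  assumes "\<bar>t\<bar> \<le> 1/2" shows "2 * \<bar>t\<bar> \<le> \<bar>sin (pi * t)\<bar>"
proof -
  have "concave_on {0..pi/2} sin"
    by (rule f''_le0_imp_concave[where f' = cos and f'' = "\<lambda>x. - sin x"])
       (auto intro!: derivative_eq_intros sin_ge_zero)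
  from concave_onD_Icc[OF this, of "2 * \<bar>t\<bar>"] assms
  have "2 * \<bar>t\<bar> \<le> sin (pi * \<bar>t\<bar>)" by (simp add: mult_ac)
  also have "\<dots> \<le> \<bar>sin (pi * \<bar>t\<bar>)\<bar>" by simp
  also have "\<dots> = \<bar>sin (pi * t)\<bar>" by (cases "t \<ge> 0") auto
  finally show ?thesis .
qed

lemma abel_sum_eq_integral:
  fixes G :: "real \<Rightarrow> complex"
  assumes cont_G: "continuous_on {-1/2..1/2} G" and r_range: "0 \<le> r" "r < 1"
  shows "((\<lambda>n::int. of_real r ^ nat \<bar>n\<bar>
      * integral {-1/2..1/2} (\<lambda>t. exp (- 2 * pi * \<i> * of_int n * t) * G t))
    has_sum integral {-1/2..1/2} (\<lambda>t. poisson_kernel r t * G t)) UNIV"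
proof -
  let ?e = "\<lambda>(n::int) (t::real). exp (- 2 * pi * \<i> * of_int n * t)"
  obtain B where B_bound: "B \<ge> 0" "\<And>t. t \<in> {-1/2..1/2} \<Longrightarrow> norm (G t) \<le> B"
    using continuous_on_compact_bound[OF compact_Icc cont_G] by metis
  have summable: "(\<lambda>n::int. r ^ nat \<bar>n\<bar> * B) summable_on UNIV"
  proof -
    have "(\<lambda>n. r ^ n) summable_on UNIV"
      using r_range by (subst summable_on_UNIV_nonneg_real_iff) (auto intro: summable_geometric)
    then have "(\<lambda>n::int. r ^ nat \<bar>n\<bar>) summable_on UNIV"
      using summable_on_cmult_right[of "\<lambda>n. r ^ n" UNIV r]
      by (intro summable_on_int_halves) (simp_all add: nat_add_distrib)
    then show ?thesis by (rule summable_on_cmult_left)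
  qed
  have "((\<lambda>n. integral {-1/2..1/2} (\<lambda>t. of_real r ^ nat \<bar>n\<bar> * (?e n t * G t)))
      has_sum integral {-1/2..1/2} (\<lambda>t. \<Sum>\<^sub>\<infinity>n. of_real r ^ nat \<bar>n\<bar> * (?e n t * G t))) UNIV"
  proof (rule has_sum_integral[OF _ summable])
    show "norm (of_real r ^ nat \<bar>n\<bar> * (?e n t * G t)) \<le> r ^ nat \<bar>n\<bar> * B" if "t \<in> {-1/2..1/2}" for n t
      using B_bound(2)[OF that] r_range by (auto simp: norm_mult norm_power intro!: mult_left_mono)
    show "continuous_on {-1/2..1/2} (\<lambda>t. of_real r ^ nat \<bar>n\<bar> * (?e n t * G t))" for n
      by (intro continuous_intros cont_G)
  qed
  moreover have "(\<Sum>\<^sub>\<infinity>n. of_real r ^ nat \<bar>n\<bar> * (?e n t * G t)) = poisson_kernel r t * G t" for t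
    using infsumI[OF has_sum_cmult_left[OF has_sum_poisson_kernel[OF r_range, of t], of "G t"]]
    by (simp only: mult.assoc)
  ultimately show ?thesis by simp
qed

lemma poisson_kernel_has_integral:
  assumes "0 \<le> r" "r < 1" shows "(poisson_kernel r has_integral 1) {-1/2..1/2}"
proof -
  have "((\<lambda>n::int. of_real r ^ nat \<bar>n\<bar>
      * integral {-1/2..1/2} (\<lambda>t::real. exp (- 2 * pi * \<i> * of_int n * t) * 1))
      has_sum integral {-1/2..1/2} (\<lambda>t. complex_of_real (poisson_kernel r t) * 1)) UNIV"
    by (intro abel_sum_eq_integral assms continuous_intros)
  moreover have "of_real r ^ nat \<bar>n\<bar>
      * integral {-1/2..1/2} (\<lambda>t::real. exp (- 2 * pi * \<i> * of_int n * t) * 1)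
      = (if n = 0 then 1 else 0)" for n
    by (simp only: mult_1_right integral_exp_int) simp
  ultimately have "((\<lambda>n::int. if n = 0 then 1 else 0)
      has_sum integral {-1/2..1/2} (\<lambda>t. complex_of_real (poisson_kernel r t))) UNIV"
    by simp
  moreover have "((\<lambda>n::int. if n = 0 then 1 else 0) has_sum complex_of_real 1) UNIV"
    using has_sum_finite_neutralI[of "{0::int}" UNIV "\<lambda>n. if n = 0 then 1 else (0::complex)"] by simp
  ultimately have "integral {-1/2..1/2} (\<lambda>t. complex_of_real (poisson_kernel r t)) = complex_of_real 1"
    using has_sum_unique by blast
  moreover have integrable_kernel: "poisson_kernel r integrable_on {-1/2..1/2}"
    by (intro integrable_continuous_real continuous_on_poisson_kernel assms)
  then have "integral {-1/2..1/2} (\<lambda>t. complex_of_real (poisson_kernel r t))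
      = complex_of_real (integral {-1/2..1/2} (poisson_kernel r))"
    using has_integral_linear[OF integrable_integral[OF integrable_kernel] bounded_linear_of_real]
    by (intro integral_unique) (simp add: o_def)
  ultimately show ?thesis using integrable_kernel by (simp add: has_integral_integrable_integral)
qed

lemma norm_diff_le_sin_sq:
  fixes G :: "real \<Rightarrow> complex"
  assumes cont_G: "continuous_on {-1/2..1/2} G" and "\<epsilon> > 0"
  obtains M where "M \<ge> 0" "\<And>t. t \<in> {-1/2..1/2} \<Longrightarrow> norm (G t - G 0) \<le> \<epsilon> + M * (sin (pi * t))\<^sup>2"
proof -
  obtain B where B_bound: "B \<ge> 0" "\<And>t. t \<in> {-1/2..1/2} \<Longrightarrow> norm (G t) \<le> B"
    using continuous_on_compact_bound[OF compact_Icc cont_G] by metis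
  obtain \<delta> where \<delta>_close: "\<delta> > 0" "\<And>t. t \<in> {-1/2..1/2} \<Longrightarrow> \<bar>t\<bar> < \<delta> \<Longrightarrow> norm (G t - G 0) < \<epsilon>"
    using cont_G[unfolded continuous_on_iff, rule_format, of 0 \<epsilon>] \<open>\<epsilon> > 0\<close> by (auto simp: dist_norm)
  show thesis
  proof (rule that)
    show "2 * B / (2 * \<delta>)\<^sup>2 \<ge> 0" using B_bound(1) by simp
    fix t :: real assume t_range: "t \<in> {-1/2..1/2}"
    show "norm (G t - G 0) \<le> \<epsilon> + 2 * B / (2 * \<delta>)\<^sup>2 * (sin (pi * t))\<^sup>2"
    proof (cases "\<bar>t\<bar> < \<delta>")
      case True
      then have "norm (G t - G 0) \<le> \<epsilon>" using \<delta>_close(2)[OF t_range] by simp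
      also have "\<dots> \<le> \<epsilon> + 2 * B / (2 * \<delta>)\<^sup>2 * (sin (pi * t))\<^sup>2" using B_bound(1) by simp
      finally show ?thesis .
    next
      case False
      moreover have "\<bar>t\<bar> \<le> 1/2" using t_range by (intro abs_leI) auto
      ultimately have "2 * \<delta> \<le> \<bar>sin (pi * t)\<bar>" using two_abs_le_abs_sin_pi[of t] by linarith
      then have "(2 * \<delta>)\<^sup>2 \<le> (sin (pi * t))\<^sup>2"
        using \<delta>_close(1) by (metis abs_le_square_iff abs_of_pos mult_pos_pos zero_less_numeral)
      then have "2 * B / (2 * \<delta>)\<^sup>2 * (2 * \<delta>)\<^sup>2 \<le> 2 * B / (2 * \<delta>)\<^sup>2 * (sin (pi * t))\<^sup>2"
        using B_bound(1) by (intro mult_left_mono) auto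
      moreover have "norm (G t - G 0) \<le> 2 * B"
        using norm_triangle_ineq4[of "G t" "G 0"] B_bound(2)[OF t_range] B_bound(2)[of 0] by simp
      ultimately show ?thesis using \<delta>_close(1) \<open>\<epsilon> > 0\<close> by simp
    qed
  qed
qed

lemma norm_poisson_integral_diff_le:
  fixes G :: "real \<Rightarrow> complex"
  assumes cont_G: "continuous_on {-1/2..1/2} G" and r_range: "0 < r" "r < 1" and "M \<ge> 0"
    and bound: "\<And>t. t \<in> {-1/2..1/2} \<Longrightarrow> norm (G t - G 0) \<le> \<epsilon> + M * (sin (pi * t))\<^sup>2"
  shows "norm (integral {-1/2..1/2} (\<lambda>t. poisson_kernel r t * G t) - G 0) \<le> \<epsilon> + M * ((1 - r\<^sup>2) / (4 * r))"
proof -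
  have kernel_integral: "(poisson_kernel r has_integral 1) {-1/2..1/2}" and "\<And>t. poisson_kernel r t \<ge> 0"
    using r_range by (intro poisson_kernel_has_integral poisson_kernel_nonneg; simp)+
  have "((\<lambda>t. complex_of_real (poisson_kernel r t)) has_integral complex_of_real 1) {-1/2..1/2}"
    using has_integral_linear[OF kernel_integral bounded_linear_of_real] by (simp add: o_def)
  then have "((\<lambda>t. complex_of_real (poisson_kernel r t) * G t - complex_of_real (poisson_kernel r t) * G 0)
      has_integral
      integral {-1/2..1/2} (\<lambda>t. poisson_kernel r t * G t) - complex_of_real 1 * G 0) {-1/2..1/2}"
    using r_range
    by (intro has_integral_diff has_integral_mult_left integrable_integral integrable_continuous_real
        continuous_intros cont_G continuous_on_poisson_kernel) auto
  moreover have "((\<lambda>t. \<epsilon> * poisson_kernel r t + M * ((1 - r\<^sup>2) / (4 * r)))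
      has_integral \<epsilon> * 1 + M * ((1 - r\<^sup>2) / (4 * r))) {-1/2..1/2}"
    using has_integral_const_real[of "(1 - r\<^sup>2) / (4 * r)" "-1/2" "1/2"]
    by (intro has_integral_add has_integral_mult_right kernel_integral) auto
  ultimately have "norm (integral {-1/2..1/2} (\<lambda>t. poisson_kernel r t * G t) - complex_of_real 1 * G 0)
      \<le> \<epsilon> * 1 + M * ((1 - r\<^sup>2) / (4 * r))"
  proof (rule has_integral_norm_le)
    fix t :: real assume t_range: "t \<in> {-1/2..1/2}"
    have "norm (complex_of_real (poisson_kernel r t) * G t - complex_of_real (poisson_kernel r t) * G 0)
        = poisson_kernel r t * norm (G t - G 0)"
      using \<open>poisson_kernel r t \<ge> 0\<close> by (simp add: norm_mult flip: right_diff_distrib)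
    also have "\<dots> \<le> poisson_kernel r t * (\<epsilon> + M * (sin (pi * t))\<^sup>2)"
      using bound[OF t_range] \<open>poisson_kernel r t \<ge> 0\<close> by (rule mult_left_mono)
    also have "\<dots> = \<epsilon> * poisson_kernel r t + M * ((sin (pi * t))\<^sup>2 * poisson_kernel r t)"
      by (simp add: algebra_simps)
    also have "\<dots> \<le> \<epsilon> * poisson_kernel r t + M * ((1 - r\<^sup>2) / (4 * r))"
      using \<open>M \<ge> 0\<close> r_range by (intro add_left_mono mult_left_mono poisson_kernel_sin_le)
    finally show "norm (complex_of_real (poisson_kernel r t) * G t
        - complex_of_real (poisson_kernel r t) * G 0)
      \<le> \<epsilon> * poisson_kernel r t + M * ((1 - r\<^sup>2) / (4 * r))" .
  qed
  then show ?thesis by simp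
qed

lemma poisson_integral_tendsto:
  fixes G :: "real \<Rightarrow> complex"
  assumes cont_G: "continuous_on {-1/2..1/2} G"
  shows "((\<lambda>r. integral {-1/2..1/2} (\<lambda>t. poisson_kernel r t * G t)) \<longlongrightarrow> G 0) (at_left 1)"
proof (rule tendstoI)
  fix e :: real assume "e > 0"
  then obtain M where M_bound: "M \<ge> 0"
      "\<And>t. t \<in> {-1/2..1/2} \<Longrightarrow> norm (G t - G 0) \<le> e / 2 + M * (sin (pi * t))\<^sup>2"
    using norm_diff_le_sin_sq[OF cont_G, of "e / 2"] by auto
  have "((\<lambda>r. e / 2 + M * ((1 - r\<^sup>2) / (4 * r))) \<longlongrightarrow> e / 2 + M * ((1 - 1\<^sup>2) / (4 * 1))) (at_left 1)"
    by (intro tendsto_intros) auto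
  then have "\<forall>\<^sub>F r in at_left 1. e / 2 + M * ((1 - r\<^sup>2) / (4 * r)) < e"
    by (rule order_tendstoD(2)) (use \<open>e > 0\<close> in simp)
  moreover have "\<forall>\<^sub>F r :: real in at_left 1. r \<in> {0<..<1}" by (rule eventually_at_left_real) simp
  ultimately show "\<forall>\<^sub>F r in at_left 1. dist (integral {-1/2..1/2} (\<lambda>t. poisson_kernel r t * G t)) (G 0) < e"
  proof eventually_elim
    case (elim r)
    then show ?case
      using norm_poisson_integral_diff_le[OF cont_G _ _ M_bound]
      by (auto simp: dist_norm intro: le_less_trans)
  qed
qed

theorem fourier_series_at_0:
  fixes G :: "real \<Rightarrow> complex"
  assumes cont_G: "continuous_on {-1/2..1/2} G"
    and c_eq: "\<And>n. c n = integral {-1/2..1/2} (\<lambda>t. exp (- 2 * pi * \<i> * of_int n * t) * G t)"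
    and summable: "(\<lambda>n. norm (c n)) summable_on UNIV"
  shows "(\<Sum>\<^sub>\<infinity>n. c n) = G 0"
proof -
  have "continuous_on {0..1} (\<lambda>r::real. \<Sum>\<^sub>\<infinity>n. of_real r ^ nat \<bar>n\<bar> * c n)"
  proof (rule continuous_on_infsum[OF _ summable])
    show "norm (of_real r ^ nat \<bar>n\<bar> * c n) \<le> norm (c n)" if "r \<in> {0..1}" for r :: real and n
      using that by (simp add: norm_mult norm_power mult_left_le_one_le power_le_one)
  qed (intro continuous_intros)
  then have "\<forall>s\<in>{0..1}. ((\<lambda>r::real. \<Sum>\<^sub>\<infinity>n. of_real r ^ nat \<bar>n\<bar> * c n)
      \<longlongrightarrow> (\<Sum>\<^sub>\<infinity>n. of_real s ^ nat \<bar>n\<bar> * c n)) (at s within {0..1})"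
    unfolding continuous_on_def .
  from bspec[OF this, of 1]
  have "((\<lambda>r::real. \<Sum>\<^sub>\<infinity>n. of_real r ^ nat \<bar>n\<bar> * c n) \<longlongrightarrow> (\<Sum>\<^sub>\<infinity>n. c n)) (at_left 1)"
    by (simp add: at_within_Icc_at_left)
  moreover have "\<forall>\<^sub>F r::real in at_left 1.
      (\<Sum>\<^sub>\<infinity>n. of_real r ^ nat \<bar>n\<bar> * c n) = integral {-1/2..1/2} (\<lambda>t. poisson_kernel r t * G t)"
  proof -
    have "\<forall>\<^sub>F r::real in at_left 1. r \<in> {0<..<1}" by (rule eventually_at_left_real) simp
    then show ?thesis
    proof eventually_elim
      case (elim r)
      then show ?case unfolding c_eq by (intro infsumI abel_sum_eq_integral cont_G) auto
    qed
  qed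
  ultimately have "((\<lambda>r. integral {-1/2..1/2} (\<lambda>t. poisson_kernel r t * G t)) \<longlongrightarrow> (\<Sum>\<^sub>\<infinity>n. c n)) (at_left 1)"
    by (simp add: tendsto_cong)
  then show ?thesis
    using poisson_integral_tendsto[OF cont_G] by (rule tendsto_unique[rotated]) simp
qed

subsection \<open>Poisson summation and Fourier inversion\<close>

lemma quadratic_decay_shift:
  fixes f :: "real \<Rightarrow> complex"
  assumes C_bound: "\<And>x. norm (f x) \<le> C / (1 + \<bar>x\<bar>) ^ 2" and t_range: "\<bar>t\<bar> \<le> 1"
  shows "norm (f (t + y)) \<le> 4 * C / (1 + \<bar>y\<bar> * 1) ^ 2"
proof -
  have "C \<ge> 0" using order_trans[OF norm_ge_zero C_bound[of 0]] by simp
  have "\<bar>y\<bar> \<le> \<bar>t + y\<bar> + \<bar>t\<bar>" using abs_triangle_ineq4[of "t + y" t] by simp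
  then have "1 + \<bar>y\<bar> \<le> 2 * (1 + \<bar>t + y\<bar>)" using t_range abs_ge_zero[of "t + y"] by argo
  then have "(1 + \<bar>y\<bar>) ^ 2 \<le> (2 * (1 + \<bar>t + y\<bar>)) ^ 2" by (intro power_mono) auto
  then have "(1 + \<bar>y\<bar>) ^ 2 \<le> 4 * (1 + \<bar>t + y\<bar>) ^ 2" unfolding power_mult_distrib by simp
  then have "4 * C / (4 * (1 + \<bar>t + y\<bar>) ^ 2) \<le> 4 * C / (1 + \<bar>y\<bar>) ^ 2"
    using \<open>C \<ge> 0\<close> by (intro divide_left_mono mult_pos_pos) (auto simp: add_pos_nonneg)
  with C_bound[of "t + y"] show ?thesis by simp
qed

definition unit_interval :: "int \<Rightarrow> real set" where
  "unit_interval k = {of_int k - 1/2..<of_int k + 1/2}"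

lemma integral_over_unit_interval:
  fixes f :: "real \<Rightarrow> complex"
  assumes cont_f: "continuous_on UNIV f"
  shows "(LINT t:unit_interval k|lborel. f t) = integral {-1/2..1/2} (\<lambda>t. f (t + of_int k))"
proof -
  have "set_integrable lborel (unit_interval k) f"
    unfolding unit_interval_def by (rule set_integrable_subset[OF borel_integrable_atLeastAtMost',
          of "of_int k - 1/2" "of_int k + 1/2" f]) (auto intro: continuous_on_subset[OF cont_f])
  then have "(LINT t:unit_interval k|lborel. f t) = integral (unit_interval k) f"
    by (rule set_borel_integral_eq_integral)
  also have "\<dots> = integral {of_int k - 1/2..of_int k + 1/2} f"
    by (rule integral_spike_set)
      (auto simp: unit_interval_def intro: negligible_subset[OF negligible_sing[of "of_int k + 1/2"]])
  also have "\<dots> = integral {-1/2..1/2} (\<lambda>t. f (t + of_int k))"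
    using integral_shift_real_ivl[of "of_int k - 1/2" "of_int k" "of_int k + 1/2" f] by simp
  finally show ?thesis .
qed

lemma lborel_integral_eq_suminf_unit_intervals:
  fixes f :: "real \<Rightarrow> complex"
  assumes "integrable lborel f"
  shows "(LINT t|lborel. f t) = (\<Sum>n. LINT t:unit_interval (int_decode n)|lborel. f t)"
proof -
  have cover: "(\<Union>n. unit_interval (int_decode n)) = UNIV"
  proof -
    have "x \<in> unit_interval (int_decode (int_encode \<lfloor>x + 1/2\<rfloor>))" for x
      unfolding unit_interval_def int_encode_inverse by (simp, linarith)
    then show ?thesis by blast
  qed
  have "(LINT t:(\<Union>n. unit_interval (int_decode n))|lborel. f t)
      = (\<Sum>n. LINT t:unit_interval (int_decode n)|lborel. f t)"
  proof (rule lebesgue_integral_countable_add)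
    show "unit_interval (int_decode m) \<inter> unit_interval (int_decode n) = {}" if "m \<noteq> n" for m n
    proof -
      have "int_decode m \<noteq> int_decode n" using that by (simp add: int_decode_eq)
      then show ?thesis by (auto simp: unit_interval_def)
    qed
    show "set_integrable lborel (\<Union>n. unit_interval (int_decode n)) f"
      using assms by (simp add: cover set_integrable_def)
  qed (simp add: unit_interval_def)
  then show ?thesis by (simp add: cover set_lebesgue_integral_def)
qed

lemma has_sum_integral_unit_intervals:
  fixes f :: "real \<Rightarrow> complex"
  assumes cont_f: "continuous_on UNIV f" and C_bound: "\<And>x. norm (f x) \<le> C / (1 + \<bar>x\<bar>) ^ 2"
  shows "((\<lambda>k::int. integral {-1/2..1/2} (\<lambda>t. f (t + of_int k))) has_sum (LINT t|lborel. f t)) UNIV"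
proof -
  define I where "I k = integral {-1/2..1/2} (\<lambda>t. f (t + of_int k))" for k :: int
  have "(\<lambda>k::int. norm (I k)) summable_on UNIV"
  proof (rule Infinite_Sum.abs_summable_on_comparison_test')
    show "(\<lambda>k::int. 4 * C / (1 + \<bar>of_int k\<bar> * 1) ^ 2) summable_on UNIV"
      by (rule summable_on_int_inverse_square) simp
    fix k :: int
    have "norm (I k) \<le> integral {-1/2..1/2::real} (\<lambda>_. 4 * C / (1 + \<bar>of_int k\<bar> * 1) ^ 2)"
      unfolding I_def using C_bound
      by (intro integral_norm_bound_integral integrable_continuous_real quadratic_decay_shift
          continuous_on_compose2[OF cont_f] continuous_intros) auto
    then show "norm (I k) \<le> 4 * C / (1 + \<bar>of_int k\<bar> * 1) ^ 2" by simp
  qed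
  then obtain S where I_has_sum: "(I has_sum S) UNIV"
    using abs_summable_summable summable_on_def by blast
  then have "((\<lambda>n. I (int_decode n)) has_sum S) UNIV"
    by (rule has_sum_reindex_bij_betw[OF bij_int_decode, THEN iffD2])
  then have "(\<lambda>n. I (int_decode n)) sums S" by (rule has_sum_imp_sums)
  moreover have "(LINT t|lborel. f t) = (\<Sum>n. I (int_decode n))"
    using lborel_integral_eq_suminf_unit_intervals[OF integrable_of_quadratic_decay[OF assms]]
    by (simp add: I_def integral_over_unit_interval[OF cont_f])
  ultimately have "S = (LINT t|lborel. f t)" by (simp add: sums_iff)
  with I_has_sum show ?thesis by (simp add: I_def[abs_def])
qed

theorem poisson_summation:
  assumes cont_g: "continuous_on UNIV g" and C_bound: "\<And>x. norm (g x) \<le> C / (1 + \<bar>x\<bar>) ^ 2"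
    and summable: "(\<lambda>n::int. norm (fourier g (of_int n))) summable_on UNIV"
  shows "(\<Sum>\<^sub>\<infinity>n::int. fourier g (of_int n)) = (\<Sum>\<^sub>\<infinity>k::int. g (of_int k))"
proof -
  let ?e = "\<lambda>(n::int) (t::real). exp (- 2 * pi * \<i> * of_int n * t)"
  define G where "G t = (\<Sum>\<^sub>\<infinity>k::int. g (t + of_int k))" for t
  define M where "M k = 4 * C / (1 + \<bar>of_int k\<bar> * 1) ^ 2" for k :: int
  have M_summable: "M summable_on UNIV"
    unfolding M_def[abs_def] by (rule summable_on_int_inverse_square) simp
  have M_bound: "norm (g (t + of_int k)) \<le> M k" if "t \<in> {-1/2..1/2}" for t :: real and k
    unfolding M_def using that by (intro quadratic_decay_shift C_bound) auto
  have g_shift: "continuous_on S (\<lambda>t. g (t + c))" for S c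
    by (intro continuous_on_compose2[OF cont_g] continuous_intros) auto
  have cont_G: "continuous_on {-1/2..1/2} G"
    unfolding G_def[abs_def] by (rule continuous_on_infsum[OF g_shift M_summable M_bound])
  have coeff: "fourier g (of_int n) = integral {-1/2..1/2} (\<lambda>t. ?e n t * G t)" for n
  proof -
    have periodic: "?e n (t + of_int k) = ?e n t" for t k
    proof -
      have "?e n (t + of_int k) = ?e n t * exp (\<i> * of_int (- n * k) * (of_real pi * 2))"
        by (simp add: algebra_simps flip: exp_add)
      then show ?thesis using exp_plus_2pin[of 0 "- n * k"] by (simp add: mult_ac)
    qed
    have "((\<lambda>k. integral {-1/2..1/2} (\<lambda>t. ?e n (t + of_int k) * g (t + of_int k)))
        has_sum fourier g (of_int n)) UNIV"
      unfolding fourier_def of_real_of_int_eq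
      by (rule has_sum_integral_unit_intervals)
        (use C_bound in \<open>auto intro!: continuous_intros cont_g simp: norm_mult\<close>)
    moreover have "((\<lambda>k. integral {-1/2..1/2} (\<lambda>t. ?e n t * g (t + of_int k)))
        has_sum integral {-1/2..1/2} (\<lambda>t. \<Sum>\<^sub>\<infinity>k. ?e n t * g (t + of_int k))) UNIV"
      by (rule has_sum_integral[OF _ M_summable])
        (use M_bound in \<open>auto intro!: continuous_intros g_shift simp: norm_mult\<close>)
    ultimately show ?thesis
      unfolding periodic using has_sum_unique by (fastforce simp: G_def infsum_cmult_right')
  qed
  show ?thesis
    using fourier_series_at_0[OF cont_G coeff summable] by (simp add: G_def)
qed

theorem poisson_summation_lattice:
  assumes schwartz_g: "schwartz g" and w_pos: "w > 0"
  shows "(\<Sum>\<^sub>\<infinity>n::int. fourier g ((of_int n + x) * w))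
    = (1 / w) * (\<Sum>\<^sub>\<infinity>k::int. exp (- 2 * pi * \<i> * of_int k * x) * g (of_int k / w))"
proof -
  define h where "h t = exp (2 * pi * \<i> * (- x) * t) * g ((1 / w) * t)" for t :: real
  have "multiplier (\<lambda>t. exp (\<i> * (- 2 * pi * x) * t))" using multiplier_exp[of "- 2 * pi * x"] by simp
  then have "schwartz (\<lambda>t. exp (\<i> * (- 2 * pi * x) * t) * g ((1 / w) * t))"
    by (rule schwartz_multiplier_mult)
      (use w_pos in \<open>auto intro: schwartz_scale[OF schwartz_g, of "1 / w", simplified]\<close>)
  then have schwartz_h: "schwartz h" by (simp add: h_def[abs_def] mult_ac)
  have fourier_h: "fourier h (of_int n) = w * fourier g ((of_int n + x) * w)" for n :: int
    unfolding h_def[abs_def] fourier_modulate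
    using w_pos by (subst fourier_scale) (simp_all add: mult.commute)
  obtain C where C_bound: "\<And>x. norm (h x) \<le> C / (1 + \<bar>x\<bar>) ^ 2"
    using rapid_decayE[OF schwartz_rapid_decay[OF schwartz_h]] by blast
  have "(\<lambda>n::int. norm (fourier h (of_int n))) summable_on UNIV"
    using rapid_decay_abs_summable_int[OF _ rapid_decay_fourier[OF schwartz_h], of 1] by simp
  from poisson_summation[OF schwartz_continuous_on[OF schwartz_h] C_bound this]
  have "w * (\<Sum>\<^sub>\<infinity>n::int. fourier g ((of_int n + x) * w)) = (\<Sum>\<^sub>\<infinity>k::int. h (of_int k))"
    unfolding fourier_h by (simp add: infsum_cmult_right')
  moreover have "h (of_int k) = exp (- 2 * pi * \<i> * of_int k * x) * g (of_int k / w)" for k :: int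
    by (simp add: h_def mult_ac)
  ultimately show ?thesis using w_pos by (simp add: field_simps)
qed

text \<open>Integrating Poisson's formula over one period of the translates leaves only the term \<open>k = 0\<close>.\<close>

theorem fourier_inversion_at_0:
  assumes schwartz_h: "schwartz h" shows "(LINT u|lborel. fourier h u) = h 0"
proof -
  let ?e = "\<lambda>(k::int) (x::real). exp (- 2 * pi * \<i> * of_int k * x)"
  obtain C where C_bound: "\<And>x. norm (fourier h x) \<le> C / (1 + \<bar>x\<bar>) ^ 2"
    using rapid_decayE[OF rapid_decay_fourier[OF schwartz_h]] by blast
  have "((\<lambda>n::int. integral {-1/2..1/2} (\<lambda>x. fourier h (x + of_int n)))
      has_sum (LINT u|lborel. fourier h u)) UNIV"
    by (rule has_sum_integral_unit_intervals[OF schwartz_continuous_on_fourier[OF schwartz_h] C_bound])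
  moreover have "((\<lambda>n::int. integral {-1/2..1/2} (\<lambda>x. fourier h (x + of_int n))) has_sum
     integral {-1/2..1/2} (\<lambda>x. \<Sum>\<^sub>\<infinity>n::int. fourier h (x + of_int n))) UNIV"
  proof (rule has_sum_integral)
    show "(\<lambda>n::int. 4 * C / (1 + \<bar>of_int n\<bar> * 1) ^ 2) summable_on UNIV"
      by (rule summable_on_int_inverse_square) simp
    show "norm (fourier h (x + of_int n)) \<le> 4 * C / (1 + \<bar>of_int n\<bar> * 1) ^ 2"
      if "x \<in> {-1/2..1/2}" for n :: int and x :: real
      using that by (intro quadratic_decay_shift C_bound) auto
  qed (intro continuous_on_compose2[OF schwartz_continuous_on_fourier[OF schwartz_h, of UNIV]]
      continuous_intros; simp)
  ultimately have "(LINT u|lborel. fourier h u)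
      = integral {-1/2..1/2} (\<lambda>x. \<Sum>\<^sub>\<infinity>n::int. fourier h (x + of_int n))"
    by (rule has_sum_unique)
  also have "\<dots> = integral {-1/2..1/2} (\<lambda>x. \<Sum>\<^sub>\<infinity>k::int. ?e k x * h (of_int k))"
    using poisson_summation_lattice[OF schwartz_h, of 1] by (simp add: add.commute)
  also have "\<dots> = (\<Sum>\<^sub>\<infinity>k::int. integral {-1/2..1/2} (\<lambda>x. ?e k x * h (of_int k)))"
  proof (rule infsumI[symmetric], rule has_sum_integral)
    show "(\<lambda>k::int. norm (h (of_int k))) summable_on UNIV"
      using rapid_decay_abs_summable_int[OF _ schwartz_rapid_decay[OF schwartz_h], of 1] by simp
  qed (auto intro!: continuous_intros simp: norm_mult)
  also have "\<dots> = (\<Sum>\<^sub>\<infinity>k\<in>{0}. h (of_int k))"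
    by (rule infsum_cong_neutral) (simp_all only: integral_mult_left integral_exp_int, simp_all)
  finally show ?thesis by simp
qed

subsection \<open>Sums over the lattice cone\<close>

lemma has_sum_central_diff:
  assumes w_pos: "w > 0" and H_tendsto: "(H \<longlongrightarrow> 0) at_top"
    and summable: "(\<lambda>n::nat. central_diff w H (x + (real n + 1/2) * w)) summable_on UNIV"
  shows "((\<lambda>n::nat. central_diff w H (x + (real n + 1/2) * w)) has_sum H x) UNIV"
proof -
  have "filterlim (\<lambda>n::nat. x + real n * w) at_top sequentially"
    by (intro filterlim_tendsto_add_at_top[OF tendsto_const]
        filterlim_at_top_mult_tendsto_pos[OF tendsto_const w_pos] filterlim_real_sequentially)
  then have "(\<lambda>n::nat. H (x + real n * w)) \<longlonglongrightarrow> 0" by (rule filterlim_compose[OF H_tendsto])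
  from telescope_sums'[OF this]
  have "(\<lambda>n::nat. central_diff w H (x + (real n + 1/2) * w)) sums H x"
    by (simp add: central_diff_def algebra_simps)
  moreover have "(\<lambda>n::nat. central_diff w H (x + (real n + 1/2) * w)) sums
      (\<Sum>\<^sub>\<infinity>n::nat. central_diff w H (x + (real n + 1/2) * w))"
    by (intro has_sum_imp_sums has_sum_infsum summable)
  ultimately show ?thesis using has_sum_infsum[OF summable] sums_unique2 by fastforce
qed

lemma infsum_central_diff:
  fixes y :: "'a \<Rightarrow> real"
  assumes w_pos: "w > 0" and H_tendsto: "(H \<longlongrightarrow> 0) at_top"
    and summable: "(\<lambda>(p, n::nat). central_diff w H (y p + (real n + 1/2) * w)) summable_on UNIV"
  shows "(\<lambda>p. H (y p)) summable_on UNIV"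
    and "(\<Sum>\<^sub>\<infinity>(p, n::nat). central_diff w H (y p + (real n + 1/2) * w)) = (\<Sum>\<^sub>\<infinity>p. H (y p))"
proof -
  have summable': "(\<lambda>(p, n::nat). central_diff w H (y p + (real n + 1/2) * w)) summable_on UNIV \<times> UNIV"
    using summable by simp
  have inner: "(\<Sum>\<^sub>\<infinity>n::nat. central_diff w H (y p + (real n + 1/2) * w)) = H (y p)" for p
    by (intro infsumI has_sum_central_diff w_pos H_tendsto summable_on_SigmaD1[OF summable']) simp
  show "(\<lambda>p. H (y p)) summable_on UNIV"
    using summable_on_Sigma_banach[OF summable'] by (simp only: inner)
  show "(\<Sum>\<^sub>\<infinity>(p, n::nat). central_diff w H (y p + (real n + 1/2) * w)) = (\<Sum>\<^sub>\<infinity>p. H (y p))"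
    using infsum_Sigma'_banach[OF summable'] by (simp add: inner)
qed

definition lattice_point :: "real \<Rightarrow> real \<Rightarrow> real \<Rightarrow> (nat \<times> nat) \<times> nat \<Rightarrow> real" where
  "lattice_point w\<^sub>1 w\<^sub>2 w\<^sub>3 =
    (\<lambda>((i, j), k). (real i + 1/2) * w\<^sub>1 + (real j + 1/2) * w\<^sub>2 + (real k + 1/2) * w\<^sub>3)"

definition lattice_sum :: "real \<Rightarrow> real \<Rightarrow> real \<Rightarrow> (real \<Rightarrow> complex) \<Rightarrow> complex" where
  "lattice_sum w\<^sub>1 w\<^sub>2 w\<^sub>3 F = (\<Sum>\<^sub>\<infinity>p. F (lattice_point w\<^sub>1 w\<^sub>2 w\<^sub>3 p))"

definition lattice_pairing :: "real \<Rightarrow> real \<Rightarrow> real \<Rightarrow> (real \<Rightarrow> complex) \<Rightarrow> complex" where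
  "lattice_pairing w\<^sub>1 w\<^sub>2 w\<^sub>3 F = lattice_sum w\<^sub>1 w\<^sub>2 w\<^sub>3 F + lattice_sum w\<^sub>1 w\<^sub>2 w\<^sub>3 (\<lambda>x. F (- x))"

lemma lattice_point_pos: "w\<^sub>1 > 0 \<Longrightarrow> w\<^sub>2 > 0 \<Longrightarrow> w\<^sub>3 > 0 \<Longrightarrow> lattice_point w\<^sub>1 w\<^sub>2 w\<^sub>3 p > 0"
  by (auto simp: lattice_point_def case_prod_unfold intro!: add_pos_pos)

lemma summable_on_product_nonneg:
  fixes f :: "'a \<Rightarrow> real" and g :: "'b \<Rightarrow> real"
  assumes "f summable_on UNIV" "g summable_on UNIV" "\<And>x. f x \<ge> 0" "\<And>y. g y \<ge> 0"
  shows "(\<lambda>(x, y). f x * g y) summable_on UNIV"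
proof -
  have "(\<lambda>(x, y). f x * g y) summable_on UNIV \<times> UNIV"
  proof (rule summable_on_SigmaI)
    show "((\<lambda>y. case (x, y) of (x, y) \<Rightarrow> f x * g y) has_sum f x * infsum g UNIV) UNIV" for x
      using has_sum_cmult_right[OF has_sum_infsum[OF assms(2)], of "f x"] by simp
    show "(\<lambda>x. f x * infsum g UNIV) summable_on UNIV" by (intro summable_on_cmult_left assms)
  qed (use assms in auto)
  then show ?thesis by simp
qed

lemma summable_on_lattice:
  assumes w_pos: "w\<^sub>1 > 0" "w\<^sub>2 > 0" "w\<^sub>3 > 0"
  shows "(\<lambda>p. 1 / (1 + lattice_point w\<^sub>1 w\<^sub>2 w\<^sub>3 p) ^ 6) summable_on UNIV"
proof (rule summable_on_comparison_test)
  let ?q = "\<lambda>w n. 1 / (1 + real n * w) ^ 2"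
  show "(\<lambda>((i, j), k). ?q w\<^sub>1 i * ?q w\<^sub>2 j * ?q w\<^sub>3 k) summable_on UNIV"
    using summable_on_product_nonneg[OF summable_on_product_nonneg[OF
        summable_on_nat_inverse_square[OF w_pos(1), of 1] summable_on_nat_inverse_square[OF w_pos(2), of 1]]
        summable_on_nat_inverse_square[OF w_pos(3), of 1]]
    by (simp add: case_prod_unfold)
  fix p :: "(nat \<times> nat) \<times> nat"
  obtain i j k where p_eq: "p = ((i, j), k)" by (metis surj_pair)
  define s where "s = 1 + lattice_point w\<^sub>1 w\<^sub>2 w\<^sub>3 p"
  have "0 \<le> real i * w\<^sub>1" "0 \<le> real j * w\<^sub>2" "0 \<le> real k * w\<^sub>3" using w_pos by auto
  then have "1 + real i * w\<^sub>1 \<le> s" "1 + real j * w\<^sub>2 \<le> s" "1 + real k * w\<^sub>3 \<le> s"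
    using w_pos unfolding s_def lattice_point_def p_eq by (auto simp: distrib_right)
  then have "(1 + real i * w\<^sub>1) ^ 2 * (1 + real j * w\<^sub>2) ^ 2 * (1 + real k * w\<^sub>3) ^ 2
      \<le> s ^ 2 * s ^ 2 * s ^ 2"
    using w_pos by (intro mult_mono power_mono) auto
  also have "\<dots> = s ^ 6" by (simp flip: power_add)
  finally have "1 / s ^ 6 \<le> 1 / ((1 + real i * w\<^sub>1) ^ 2 * (1 + real j * w\<^sub>2) ^ 2 * (1 + real k * w\<^sub>3) ^ 2)"
    using w_pos lattice_point_pos[OF w_pos, of p]
    by (intro divide_left_mono mult_pos_pos zero_less_power) (auto simp: s_def intro!: add_pos_nonneg)
  then show "1 / (1 + lattice_point w\<^sub>1 w\<^sub>2 w\<^sub>3 p) ^ 6 \<le> (\<lambda>((i, j), k). ?q w\<^sub>1 i * ?q w\<^sub>2 j * ?q w\<^sub>3 k) p"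
    by (simp add: s_def p_eq)
  show "0 \<le> 1 / (1 + lattice_point w\<^sub>1 w\<^sub>2 w\<^sub>3 p) ^ 6"
    using lattice_point_pos[OF w_pos, of p] by simp
qed

lemma rapid_decay_summable_lattice:
  assumes w_pos: "w\<^sub>1 > 0" "w\<^sub>2 > 0" "w\<^sub>3 > 0" and decay_F: "rapid_decay F"
  shows "(\<lambda>p. F (lattice_point w\<^sub>1 w\<^sub>2 w\<^sub>3 p)) summable_on UNIV"
proof -
  obtain C where C_bound: "\<And>x. norm (F x) \<le> C / (1 + \<bar>x\<bar>) ^ 6" using rapid_decayE[OF decay_F] by blast
  have "(\<lambda>p. norm (F (lattice_point w\<^sub>1 w\<^sub>2 w\<^sub>3 p))) summable_on UNIV"
  proof (rule Infinite_Sum.abs_summable_on_comparison_test')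
    show "(\<lambda>p. C * (1 / (1 + lattice_point w\<^sub>1 w\<^sub>2 w\<^sub>3 p) ^ 6)) summable_on UNIV"
      by (intro summable_on_cmult_right summable_on_lattice w_pos)
    show "norm (F (lattice_point w\<^sub>1 w\<^sub>2 w\<^sub>3 p)) \<le> C * (1 / (1 + lattice_point w\<^sub>1 w\<^sub>2 w\<^sub>3 p) ^ 6)" for p
      using C_bound[of "lattice_point w\<^sub>1 w\<^sub>2 w\<^sub>3 p"] lattice_point_pos[OF w_pos, of p] by simp
  qed
  then show ?thesis by (rule abs_summable_summable)
qed

lemma lattice_sum_swap12: "lattice_sum w\<^sub>1 w\<^sub>2 w\<^sub>3 F = lattice_sum w\<^sub>2 w\<^sub>1 w\<^sub>3 F"
  unfolding lattice_sum_def
  by (rule infsum_reindex_bij_witness[where i = "\<lambda>((i, j), k). ((j, i), k)"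
      and j = "\<lambda>((i, j), k). ((j, i), k)"])
    (auto simp: lattice_point_def add_ac)

lemma lattice_sum_swap13: "lattice_sum w\<^sub>1 w\<^sub>2 w\<^sub>3 F = lattice_sum w\<^sub>3 w\<^sub>2 w\<^sub>1 F"
  unfolding lattice_sum_def
  by (rule infsum_reindex_bij_witness[where i = "\<lambda>((i, j), k). ((k, j), i)"
      and j = "\<lambda>((i, j), k). ((k, j), i)"])
    (auto simp: lattice_point_def add_ac)

lemma lattice_sum_add:
  assumes "w\<^sub>1 > 0" "w\<^sub>2 > 0" "w\<^sub>3 > 0" "rapid_decay F" "rapid_decay G"
  shows "lattice_sum w\<^sub>1 w\<^sub>2 w\<^sub>3 (\<lambda>x. F x + G x) = lattice_sum w\<^sub>1 w\<^sub>2 w\<^sub>3 F + lattice_sum w\<^sub>1 w\<^sub>2 w\<^sub>3 G"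
  unfolding lattice_sum_def using assms by (intro infsum_add rapid_decay_summable_lattice)

lemma lattice_sum_central_diff:
  assumes w_pos: "w\<^sub>1 > 0" "w\<^sub>2 > 0" "w\<^sub>3 > 0" and H_tendsto: "(H \<longlongrightarrow> 0) at_top"
    and decay: "rapid_decay (central_diff w\<^sub>3 (central_diff w\<^sub>2 H))"
  shows "(\<lambda>n::nat. H ((real n + 1/2) * w\<^sub>1)) summable_on UNIV"
    and "lattice_sum w\<^sub>1 w\<^sub>2 w\<^sub>3 (central_diff w\<^sub>3 (central_diff w\<^sub>2 H))
        = (\<Sum>\<^sub>\<infinity>n::nat. H ((real n + 1/2) * w\<^sub>1))"
proof -
  define y where "y = (\<lambda>(i, j). (real i + 1/2) * w\<^sub>1 + (real j + 1/2) * w\<^sub>2)"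
  have lattice_sum_eq: "lattice_sum w\<^sub>1 w\<^sub>2 w\<^sub>3 F = (\<Sum>\<^sub>\<infinity>(p, n). F (y p + (real n + 1/2) * w\<^sub>3))" for F
    unfolding lattice_sum_def lattice_point_def y_def by (simp add: case_prod_unfold)
  have "(\<lambda>(p, n). central_diff w\<^sub>3 (central_diff w\<^sub>2 H) (y p + (real n + 1/2) * w\<^sub>3)) summable_on UNIV"
    using rapid_decay_summable_lattice[OF w_pos decay] by (simp add: lattice_point_def y_def case_prod_unfold)
  note inner = infsum_central_diff[OF w_pos(3) central_diff_tendsto_0[OF H_tendsto] this]
  have "(\<lambda>(i, j). central_diff w\<^sub>2 H ((real i + 1/2) * w\<^sub>1 + (real j + 1/2) * w\<^sub>2)) summable_on UNIV"
    using inner(1) by (simp add: y_def case_prod_unfold)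
  note middle = infsum_central_diff[OF w_pos(2) H_tendsto this]
  show "(\<lambda>n::nat. H ((real n + 1/2) * w\<^sub>1)) summable_on UNIV" by (rule middle(1))
  show "lattice_sum w\<^sub>1 w\<^sub>2 w\<^sub>3 (central_diff w\<^sub>3 (central_diff w\<^sub>2 H))
      = (\<Sum>\<^sub>\<infinity>n::nat. H ((real n + 1/2) * w\<^sub>1))"
    unfolding lattice_sum_eq inner(2) using middle(2) by (simp add: y_def case_prod_unfold)
qed

subsection \<open>Test functions divisible by two sines\<close>

definition two_sines :: "real \<Rightarrow> real \<Rightarrow> (real \<Rightarrow> complex) \<Rightarrow> real \<Rightarrow> complex" where
  "two_sines w\<^sub>2 w\<^sub>3 g t = sin_wave w\<^sub>3 t * (sin_wave w\<^sub>2 t * g t)"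

lemma schwartz_two_sines: "schwartz g \<Longrightarrow> schwartz (two_sines w\<^sub>2 w\<^sub>3 g)"
  unfolding two_sines_def[abs_def] by (intro schwartz_multiplier_mult multiplier_sin_wave)

lemma fourier_two_sines:
  assumes schwartz_g: "schwartz g"
  shows "fourier (two_sines w\<^sub>2 w\<^sub>3 g) = central_diff w\<^sub>3 (central_diff w\<^sub>2 (\<lambda>x. - (1/4) * fourier g x))"
proof -
  have sine_mult: "schwartz (\<lambda>t. sin_wave w\<^sub>2 t * g t)"
    by (intro schwartz_multiplier_mult multiplier_sin_wave schwartz_g)
  show ?thesis
    unfolding two_sines_def[abs_def] fourier_sin_wave_mult[OF schwartz_integrable[OF sine_mult]]
      fourier_sin_wave_mult[OF schwartz_integrable[OF schwartz_g]] central_diff_cmult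
    by (simp add: fun_eq_iff flip: mult.assoc)
qed

lemma lattice_sum_two_sines:
  assumes w_pos: "w\<^sub>1 > 0" "w\<^sub>2 > 0" "w\<^sub>3 > 0" and schwartz_g: "schwartz g"
  shows "(\<lambda>n::nat. fourier g ((real n + 1/2) * w\<^sub>1)) summable_on UNIV"
    and "lattice_sum w\<^sub>1 w\<^sub>2 w\<^sub>3 (fourier (two_sines w\<^sub>2 w\<^sub>3 g))
      = - (1/4) * (\<Sum>\<^sub>\<infinity>n::nat. fourier g ((real n + 1/2) * w\<^sub>1))"
proof -
  note fourier_eq = fourier_two_sines[OF schwartz_g, of w\<^sub>2 w\<^sub>3]
  have "((\<lambda>x. - (1/4) * fourier g x) \<longlongrightarrow> 0) at_top"
    by (intro tendsto_mult_right_zero rapid_decay_tendsto_at_top rapid_decay_fourier schwartz_g)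
  note telescoped = lattice_sum_central_diff[OF w_pos this
      rapid_decay_fourier[OF schwartz_two_sines[OF schwartz_g], of w\<^sub>2 w\<^sub>3, unfolded fourier_eq]]
  show "(\<lambda>n::nat. fourier g ((real n + 1/2) * w\<^sub>1)) summable_on UNIV"
    using telescoped(1) by (subst (asm) summable_on_cmult_right') auto
  show "lattice_sum w\<^sub>1 w\<^sub>2 w\<^sub>3 (fourier (two_sines w\<^sub>2 w\<^sub>3 g))
      = - (1/4) * (\<Sum>\<^sub>\<infinity>n::nat. fourier g ((real n + 1/2) * w\<^sub>1))"
    unfolding fourier_eq telescoped(2) by (rule infsum_cmult_right')
qed

lemma lattice_pairing_two_sines:
  assumes w_pos: "w\<^sub>1 > 0" "w\<^sub>2 > 0" "w\<^sub>3 > 0" and schwartz_g: "schwartz g"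
  shows "lattice_pairing w\<^sub>1 w\<^sub>2 w\<^sub>3 (fourier (two_sines w\<^sub>2 w\<^sub>3 g))
    = - (1 / (4 * w\<^sub>1)) * (\<Sum>\<^sub>\<infinity>k::int. (- 1) powi k * g (of_int k / w\<^sub>1))"
proof -
  have exp_half: "exp (- 2 * pi * \<i> * of_int k * of_real (1/2)) = (- 1) powi k" for k :: int
  proof -
    have "exp (- 2 * pi * \<i> * of_int k * of_real (1/2)) = exp (of_int (- k) * (\<i> * pi))"
      by (simp add: mult_ac)
    also have "\<dots> = exp (\<i> * pi) powi (- k)" by (simp only: exp_power_int mult.commute)
    also have "\<dots> = (- 1) powi k" by (simp only: exp_pi_i' power_int_minus_one_minus)
    finally show ?thesis .
  qed
  note plus = lattice_sum_two_sines[OF w_pos schwartz_g]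
    and minus = lattice_sum_two_sines[OF w_pos schwartz_reflect[OF schwartz_g]]
  have "((\<lambda>n::nat. fourier g ((of_int (- int n - 1) + 1/2) * w\<^sub>1))
      has_sum (\<Sum>\<^sub>\<infinity>n::nat. fourier (\<lambda>x. g (- x)) ((real n + 1/2) * w\<^sub>1))) UNIV"
    using has_sum_infsum[OF minus(1)] by (simp add: fourier_reflect algebra_simps)
  moreover have "((\<lambda>n::nat. fourier g ((of_int (int n) + 1/2) * w\<^sub>1))
      has_sum (\<Sum>\<^sub>\<infinity>n::nat. fourier g ((real n + 1/2) * w\<^sub>1))) UNIV"
    using has_sum_infsum[OF plus(1)] by simp
  ultimately have halves: "(\<Sum>\<^sub>\<infinity>n::int. fourier g ((of_int n + 1/2) * w\<^sub>1))
      = (\<Sum>\<^sub>\<infinity>n::nat. fourier g ((real n + 1/2) * w\<^sub>1))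
        + (\<Sum>\<^sub>\<infinity>n::nat. fourier (\<lambda>x. g (- x)) ((real n + 1/2) * w\<^sub>1))"
    by (intro infsumI has_sum_int_halves)
  have "fourier (two_sines w\<^sub>2 w\<^sub>3 g) (- x) = fourier (two_sines w\<^sub>2 w\<^sub>3 (\<lambda>t. g (- t))) x" for x
    unfolding fourier_reflect[symmetric] by (simp add: two_sines_def[abs_def] sin_wave_reflect)
  then have "lattice_pairing w\<^sub>1 w\<^sub>2 w\<^sub>3 (fourier (two_sines w\<^sub>2 w\<^sub>3 g))
      = - (1/4) * (\<Sum>\<^sub>\<infinity>n::int. fourier g ((of_int n + 1/2) * w\<^sub>1))"
    unfolding lattice_pairing_def halves by (simp add: plus(2) minus(2) distrib_left)
  also have "(\<Sum>\<^sub>\<infinity>n::int. fourier g ((of_int n + 1/2) * w\<^sub>1))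
      = (1 / w\<^sub>1) * (\<Sum>\<^sub>\<infinity>k::int. (- 1) powi k * g (of_int k / w\<^sub>1))"
    unfolding poisson_summation_lattice[OF schwartz_g w_pos(1)] exp_half by simp
  finally show ?thesis by simp
qed

subsection \<open>Test functions divisible by three cardinal sines\<close>

definition rapid_decay_at_top :: "(real \<Rightarrow> complex) \<Rightarrow> bool" where
  "rapid_decay_at_top F \<longleftrightarrow> (\<forall>m. ((\<lambda>x. of_real (x ^ m) * F x) \<longlongrightarrow> 0) at_top)"

lemma rapid_decay_at_top_tendsto: "rapid_decay_at_top F \<Longrightarrow> (F \<longlongrightarrow> 0) at_top"
  unfolding rapid_decay_at_top_def by (auto dest: spec[of _ 0])

lemma rapid_decay_imp_at_top:
  assumes "rapid_decay F" shows "rapid_decay_at_top F"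
  unfolding rapid_decay_at_top_def
  using rapid_decay_tendsto_at_top[OF rapid_decay_mult[OF assms poly_bounded_power]]
  by (simp add: mult.commute)

lemma norm_diff_le_of_derivative_decay:
  fixes P :: "real \<Rightarrow> complex"
  assumes P_deriv: "\<And>u. (P has_vector_derivative F u) (at u)"
    and F_small: "\<And>u. u \<ge> x \<Longrightarrow> norm (F u) \<le> 1 / u ^ (m + 2)"
    and x_range: "0 < x" "x \<le> y"
  shows "norm (P y - P x) \<le> 1 / x ^ (m + 1)"
proof (cases "x = y")
  case False
  define \<phi> where "\<phi> u = - (inverse u ^ (m + 1))" for u :: real
  have \<phi>_deriv: "(\<phi> has_vector_derivative real (m + 1) / u ^ (m + 2)) (at u)" if "u > 0" for u
    unfolding \<phi>_def has_real_derivative_iff_has_vector_derivative[symmetric]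
    using DERIV_minus[OF DERIV_power[OF DERIV_inverse[of u], of "m + 1"]] that
    by (simp add: divide_inverse power_inverse mult_ac)
  have "norm (P y - P x) \<le> \<phi> y - \<phi> x"
  proof (rule differentiable_bound_general)
    show "x < y" using False x_range by simp
    show "continuous_on {x..y} P" by (rule continuous_on_has_vector_derivative[OF P_deriv])
    show "continuous_on {x..y} \<phi>"
      using x_range
      by (intro continuous_at_imp_continuous_on ballI has_vector_derivative_continuous[OF \<phi>_deriv]) auto
    show "norm (F u) \<le> real (m + 1) / u ^ (m + 2)" if "x < u" for u
    proof -
      have "norm (F u) \<le> 1 / u ^ (m + 2)" using F_small that by simp
      also have "\<dots> \<le> real (m + 1) / u ^ (m + 2)" using x_range that by (intro divide_right_mono) auto
      finally show ?thesis .
    qed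
  qed (use P_deriv \<phi>_deriv x_range in auto)
  also have "\<dots> \<le> 1 / x ^ (m + 1)"
    using x_range by (simp add: \<phi>_def power_inverse divide_inverse del: power_Suc)
  finally show ?thesis .
qed (use x_range in simp)

lemma rapid_decay_at_top_bound:
  assumes "rapid_decay_at_top F"
  obtains x where "x \<ge> 1" "\<And>u. u \<ge> x \<Longrightarrow> norm (F u) \<le> 1 / u ^ m"
proof -
  have "((\<lambda>x. of_real (x ^ m) * F x) \<longlongrightarrow> 0) at_top" using assms by (simp add: rapid_decay_at_top_def)
  from tendstoD[OF this zero_less_one]
  obtain x where F_small: "\<And>u. u \<ge> x \<Longrightarrow> norm (of_real (u ^ m) * F u) < 1"
    by (auto simp: eventually_at_top_linorder)
  show thesis
  proof (rule that[of "max 1 x"])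
    show "norm (F u) \<le> 1 / u ^ m" if "u \<ge> max 1 x" for u
      using F_small[of u] that by (simp add: norm_mult norm_power pos_le_divide_eq mult.commute)
  qed simp
qed

lemma tail_bound_tendsto:
  fixes P :: "real \<Rightarrow> complex"
  assumes "x\<^sub>0 \<ge> 1" "\<And>y z. y \<ge> x\<^sub>0 \<Longrightarrow> z \<ge> y \<Longrightarrow> norm (P z - P y) \<le> 1 / y"
  obtains L where "(\<lambda>n::nat. P (real n)) \<longlonglongrightarrow> L"
proof -
  have "Cauchy (\<lambda>n::nat. P (real n))"
  proof (rule CauchyI')
    fix e :: real assume "e > 0"
    obtain M :: nat where M_large: "max x\<^sub>0 (1 / e) < real M" using reals_Archimedean2 by blast
    have "dist (P (real m)) (P (real n)) < e" if "m \<ge> M" "m < n" for m n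
    proof -
      have "max x\<^sub>0 (1 / e) < real m" using M_large that by simp
      then have "norm (P (real n) - P (real m)) \<le> 1 / real m" "1 / real m < e"
        using that \<open>e > 0\<close> assms by (auto simp: field_simps)
      then show ?thesis by (simp add: dist_norm norm_minus_commute)
    qed
    then show "\<exists>M. \<forall>m\<ge>M. \<forall>n>m. dist (P (real m)) (P (real n)) < e" by blast
  qed
  then show thesis using that Cauchy_convergent_iff convergent_def by blast
qed

lemma norm_limit_diff_le:
  fixes P :: "real \<Rightarrow> complex"
  assumes "(\<lambda>n::nat. P (real n)) \<longlonglongrightarrow> L" "\<And>z. z \<ge> y \<Longrightarrow> norm (P z - P y) \<le> B"
  shows "norm (L - P y) \<le> B"
proof (rule tendsto_upperbound)
  show "(\<lambda>n::nat. norm (P (real n) - P y)) \<longlonglongrightarrow> norm (L - P y)" by (intro tendsto_intros assms(1))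
  show "\<forall>\<^sub>F n in sequentially. norm (P (real n) - P y) \<le> B"
    using eventually_ge_at_top[of "nat \<lceil>y\<rceil>"]
    by eventually_elim (use assms(2) in \<open>simp add: nat_ceiling_le_eq\<close>)
qed simp

lemma rapid_decay_at_top_antiderivative:
  assumes cont: "continuous_on UNIV F" and decay: "rapid_decay_at_top F"
  obtains K where "\<And>x. (K has_vector_derivative - F x) (at x)" "rapid_decay_at_top K"
proof -
  obtain P where P_deriv: "\<And>x. (P has_vector_derivative F x) (at x)"
    using einterval_antiderivative[of "-\<infinity>" "\<infinity>" F] cont by (auto simp: continuous_on_eq_continuous_at)
  have tail: "\<exists>x\<ge>1. \<forall>y\<ge>x. \<forall>z\<ge>y. norm (P z - P y) \<le> 1 / y ^ (m + 1)" for m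
  proof -
    obtain x where "x \<ge> 1" "\<And>u. u \<ge> x \<Longrightarrow> norm (F u) \<le> 1 / u ^ (m + 2)"
      using rapid_decay_at_top_bound[OF decay] by blast
    then show ?thesis
      by (intro exI[of _ x] conjI allI impI norm_diff_le_of_derivative_decay[OF P_deriv]) auto
  qed
  obtain x\<^sub>0 where "x\<^sub>0 \<ge> 1" "\<And>y z. y \<ge> x\<^sub>0 \<Longrightarrow> z \<ge> y \<Longrightarrow> norm (P z - P y) \<le> 1 / y"
    using tail[of 0] by auto
  then obtain L where P_tendsto: "(\<lambda>n::nat. P (real n)) \<longlonglongrightarrow> L" by (rule tail_bound_tendsto)
  define K where "K x = L - P x" for x
  have "((\<lambda>x. of_real (x ^ m) * K x) \<longlongrightarrow> 0) at_top" for m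
  proof -
    obtain x where tail_le: "x \<ge> 1" "\<And>y z. y \<ge> x \<Longrightarrow> z \<ge> y \<Longrightarrow> norm (P z - P y) \<le> 1 / y ^ (m + 1)"
      using tail[of m] by blast
    have "norm (of_real (y ^ m) * K y) \<le> inverse y" if "y \<ge> x" for y
    proof -
      have "norm (K y) \<le> 1 / y ^ (m + 1)"
        unfolding K_def using that tail_le(2) by (intro norm_limit_diff_le[OF P_tendsto]) auto
      then have "y ^ m * norm (K y) \<le> y ^ m * (1 / y ^ (m + 1))"
        using tail_le that by (intro mult_left_mono) auto
      also have "\<dots> = inverse y" using tail_le that by (simp add: divide_inverse)
      finally show ?thesis using tail_le that by (simp add: norm_mult norm_power)
    qed
    then show ?thesis
      by (intro Lim_null_comparison[OF _ tendsto_inverse_0_at_top[OF filterlim_ident]]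
          eventually_at_top_linorderI[of x])
  qed
  moreover have "(K has_vector_derivative - F x) (at x)" for x
    unfolding K_def[abs_def] using P_deriv[of x] by (auto intro!: derivative_eq_intros)
  ultimately show thesis using that unfolding rapid_decay_at_top_def by blast
qed

definition three_sincs :: "real \<Rightarrow> real \<Rightarrow> real \<Rightarrow> (real \<Rightarrow> complex) \<Rightarrow> real \<Rightarrow> complex" where
  "three_sincs w\<^sub>1 w\<^sub>2 w\<^sub>3 g t = sinc_wave w\<^sub>3 t * (sinc_wave w\<^sub>2 t * (sinc_wave w\<^sub>1 t * g t))"

lemma schwartz_three_sincs:
  "w\<^sub>1 > 0 \<Longrightarrow> w\<^sub>2 > 0 \<Longrightarrow> w\<^sub>3 > 0 \<Longrightarrow> schwartz g \<Longrightarrow> schwartz (three_sincs w\<^sub>1 w\<^sub>2 w\<^sub>3 g)"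
  unfolding three_sincs_def[abs_def] by (intro schwartz_multiplier_mult multiplier_sinc_wave)

lemma fourier_three_sincs:
  assumes w_pos: "w\<^sub>1 > 0" "w\<^sub>2 > 0" "w\<^sub>3 > 0" and schwartz_g: "schwartz g"
    and K\<^sub>1_deriv: "\<And>x. (K\<^sub>1 has_vector_derivative - fourier g x) (at x)"
    and K\<^sub>2_deriv: "\<And>x. (K\<^sub>2 has_vector_derivative - K\<^sub>1 x) (at x)"
    and K\<^sub>3_deriv: "\<And>x. (K\<^sub>3 has_vector_derivative - K\<^sub>2 x) (at x)"
  shows "fourier (three_sincs w\<^sub>1 w\<^sub>2 w\<^sub>3 g)
    = central_diff w\<^sub>3 (central_diff w\<^sub>2 (central_diff w\<^sub>1 (\<lambda>x. K\<^sub>3 x / (w\<^sub>1 * w\<^sub>2 * w\<^sub>3))))"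
proof -
  have scale: "((\<lambda>x. K x / c) has_vector_derivative - (K' x / c)) (at x)"
    if "\<And>x. (K has_vector_derivative - K' x) (at x)" for K K' :: "real \<Rightarrow> complex" and c x
    using has_vector_derivative_mult_right[OF that, of "1 / c" x] by simp
  have schwartz_h: "schwartz (\<lambda>t. sinc_wave w\<^sub>1 t * g t)"
      "schwartz (\<lambda>t. sinc_wave w\<^sub>2 t * (sinc_wave w\<^sub>1 t * g t))"
    using w_pos by (intro schwartz_multiplier_mult multiplier_sinc_wave schwartz_g; simp)+
  have fourier1: "fourier (\<lambda>t. sinc_wave w\<^sub>1 t * g t) = central_diff w\<^sub>1 (\<lambda>x. K\<^sub>1 x / w\<^sub>1)"
    by (intro fourier_sinc_wave_mult w_pos schwartz_integrable schwartz_g scale K\<^sub>1_deriv)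
  have fourier2: "fourier (\<lambda>t. sinc_wave w\<^sub>2 t * (sinc_wave w\<^sub>1 t * g t))
      = central_diff w\<^sub>2 (central_diff w\<^sub>1 (\<lambda>x. K\<^sub>2 x / (w\<^sub>1 * w\<^sub>2)))"
  proof (rule fourier_sinc_wave_mult[OF w_pos(2) schwartz_integrable[OF schwartz_h(1)]])
    show "(central_diff w\<^sub>1 (\<lambda>x. K\<^sub>2 x / (w\<^sub>1 * w\<^sub>2)) has_vector_derivative
        - (fourier (\<lambda>t. sinc_wave w\<^sub>1 t * g t) x / w\<^sub>2)) (at x)" for x
      by (rule has_vector_derivative_eq_rhs[OF
            central_diff_has_vector_derivative[OF scale[OF K\<^sub>2_deriv, of "w\<^sub>1 * w\<^sub>2"]]])
        (simp add: fourier1 central_diff_def diff_divide_distrib)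
  qed
  show ?thesis
    unfolding three_sincs_def[abs_def]
  proof (rule fourier_sinc_wave_mult[OF w_pos(3) schwartz_integrable[OF schwartz_h(2)]])
    show "(central_diff w\<^sub>2 (central_diff w\<^sub>1 (\<lambda>x. K\<^sub>3 x / (w\<^sub>1 * w\<^sub>2 * w\<^sub>3))) has_vector_derivative
        - (fourier (\<lambda>t. sinc_wave w\<^sub>2 t * (sinc_wave w\<^sub>1 t * g t)) x / w\<^sub>3)) (at x)" for x
      by (rule has_vector_derivative_eq_rhs[OF central_diff_has_vector_derivative[OF
            central_diff_has_vector_derivative[OF scale[OF K\<^sub>3_deriv, of "w\<^sub>1 * w\<^sub>2 * w\<^sub>3"]]]])
        (simp add: fourier2 central_diff_def diff_divide_distrib)
  qed
qed

lemma half_line_integral_FTC: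
  fixes W :: "real \<Rightarrow> complex"
  assumes "\<And>x. (W has_vector_derivative f x) (at x)" "continuous_on UNIV f" "integrable lborel f"
    and "(W \<longlongrightarrow> 0) at_top"
  shows "(LBINT u=0..\<infinity>. f u) = - W 0"
proof -
  have "isCont W 0" using assms(1) by (rule has_vector_derivative_continuous)
  then have "(W \<longlongrightarrow> W 0) (at_right 0)"
    by (simp add: continuous_at tendsto_within_subset filterlim_at_split)
  moreover have "set_integrable lborel {0<..} f"
    using assms(3) by (simp add: set_integrable_def integrable_mult_indicator)
  ultimately have "(LBINT u=ereal 0..\<infinity>. f u) = 0 - W 0"
    using assms(1,2,4)
    by (intro interval_integral_FTC_integrable[where F = W])
       (auto simp: ereal_tendsto_simps continuous_on_eq_continuous_at)
  then show ?thesis by (simp add: zero_ereal_def)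
qed

lemma third_antiderivative_at_0:
  assumes cont_decay_F: "continuous_on UNIV F" "rapid_decay F"
    and K\<^sub>1_deriv: "\<And>x. (K\<^sub>1 has_vector_derivative - F x) (at x)" "rapid_decay_at_top K\<^sub>1"
    and K\<^sub>2_deriv: "\<And>x. (K\<^sub>2 has_vector_derivative - K\<^sub>1 x) (at x)" "rapid_decay_at_top K\<^sub>2"
    and K\<^sub>3_deriv: "\<And>x. (K\<^sub>3 has_vector_derivative - K\<^sub>2 x) (at x)" "rapid_decay_at_top K\<^sub>3"
  shows "K\<^sub>3 0 = (LBINT u=0..\<infinity>. of_real (u\<^sup>2 / 2) * F u)"
proof -
  define W where "W x = - (1/2) * (of_real (x ^ 2) * K\<^sub>1 x) - of_real (x ^ 1) * K\<^sub>2 x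
      - of_real (x ^ 0) * K\<^sub>3 x" for x
  have "(W \<longlongrightarrow> - (1/2) * 0 - 0 - 0) at_top"
    unfolding W_def using K\<^sub>1_deriv(2) K\<^sub>2_deriv(2) K\<^sub>3_deriv(2) unfolding rapid_decay_at_top_def
    by (intro tendsto_diff tendsto_mult tendsto_const) blast+
  moreover have "(W has_vector_derivative of_real (x\<^sup>2 / 2) * F x) (at x)" for x
  proof -
    have power: "((\<lambda>x. complex_of_real (x ^ n))
        has_vector_derivative of_real (real n * x ^ (n - 1))) (at x)" for n
      by (intro has_vector_derivative_of_real) (auto intro!: derivative_eq_intros)
    have "(W has_vector_derivative
          - (1/2) * (of_real (x ^ 2) * - F x + of_real (real 2 * x ^ (2 - 1)) * K\<^sub>1 x)
        - (of_real (x ^ 1) * - K\<^sub>1 x + of_real (real 1 * x ^ (1 - 1)) * K\<^sub>2 x)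
        - (of_real (x ^ 0) * - K\<^sub>2 x + of_real (real 0 * x ^ (0 - 1)) * K\<^sub>3 x)) (at x)"
      unfolding W_def[abs_def]
      by (intro has_vector_derivative_diff has_vector_derivative_mult_right has_vector_derivative_mult
          power K\<^sub>1_deriv K\<^sub>2_deriv K\<^sub>3_deriv)
    then show ?thesis by (simp add: algebra_simps)
  qed
  moreover have "continuous_on UNIV (\<lambda>u. of_real (u\<^sup>2 / 2) * F u)"
    by (intro continuous_intros cont_decay_F) auto
  moreover have "rapid_decay (\<lambda>u. of_real (u\<^sup>2 / 2) * F u)"
    using rapid_decay_mult[OF rapid_decay_mult[OF cont_decay_F(2) poly_bounded_power[of 2]], of "\<lambda>_. 1/2"]
    by (simp add: mult_ac bounded_imp_poly_bounded[of "\<lambda>_. 1/2" "1/2"])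
  ultimately have "(LBINT u=0..\<infinity>. of_real (u\<^sup>2 / 2) * F u) = - W 0"
    by (intro half_line_integral_FTC integrable_of_rapid_decay) simp_all
  then show ?thesis by (simp add: W_def)
qed

lemma lattice_sum_three_sincs:
  assumes w_pos: "w\<^sub>1 > 0" "w\<^sub>2 > 0" "w\<^sub>3 > 0" and schwartz_g: "schwartz g"
  shows "lattice_sum w\<^sub>1 w\<^sub>2 w\<^sub>3 (fourier (three_sincs w\<^sub>1 w\<^sub>2 w\<^sub>3 g))
    = (LBINT u=0..\<infinity>. of_real (u\<^sup>2 / 2) * fourier g u) / (w\<^sub>1 * w\<^sub>2 * w\<^sub>3)"
proof -
  have cont_decay_F: "continuous_on UNIV (fourier g)" "rapid_decay (fourier g)"
    by (intro schwartz_continuous_on_fourier rapid_decay_fourier schwartz_g)+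
  obtain K\<^sub>1 where K\<^sub>1_deriv: "\<And>x. (K\<^sub>1 has_vector_derivative - fourier g x) (at x)"
      "rapid_decay_at_top K\<^sub>1"
    using rapid_decay_at_top_antiderivative[OF cont_decay_F(1) rapid_decay_imp_at_top[OF cont_decay_F(2)]]
    by blast
  obtain K\<^sub>2 where K\<^sub>2_deriv: "\<And>x. (K\<^sub>2 has_vector_derivative - K\<^sub>1 x) (at x)" "rapid_decay_at_top K\<^sub>2"
    using rapid_decay_at_top_antiderivative[OF continuous_on_has_vector_derivative[OF K\<^sub>1_deriv(1)]
        K\<^sub>1_deriv(2)] by blast
  obtain K\<^sub>3 where K\<^sub>3_deriv: "\<And>x. (K\<^sub>3 has_vector_derivative - K\<^sub>2 x) (at x)" "rapid_decay_at_top K\<^sub>3"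
    using rapid_decay_at_top_antiderivative[OF continuous_on_has_vector_derivative[OF K\<^sub>2_deriv(1)]
        K\<^sub>2_deriv(2)] by blast
  define H where "H x = K\<^sub>3 x / (w\<^sub>1 * w\<^sub>2 * w\<^sub>3)" for x
  have H_tendsto: "(H \<longlongrightarrow> 0) at_top"
    using tendsto_divide_zero[OF rapid_decay_at_top_tendsto[OF K\<^sub>3_deriv(2)]]
    by (simp add: H_def[abs_def])
  note fourier_eq = fourier_three_sincs[OF w_pos schwartz_g K\<^sub>1_deriv(1) K\<^sub>2_deriv(1) K\<^sub>3_deriv(1),
      folded H_def]
  note telescoped = lattice_sum_central_diff[OF w_pos central_diff_tendsto_0[OF H_tendsto]
      rapid_decay_fourier[OF schwartz_three_sincs[OF w_pos schwartz_g], unfolded fourier_eq]]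
  have "lattice_sum w\<^sub>1 w\<^sub>2 w\<^sub>3 (fourier (three_sincs w\<^sub>1 w\<^sub>2 w\<^sub>3 g)) = H 0"
    unfolding fourier_eq telescoped(2)
    using has_sum_central_diff[OF w_pos(1) H_tendsto, of 0] telescoped(1) by (simp add: infsumI)
  then show ?thesis
    by (simp add: H_def third_antiderivative_at_0[OF cont_decay_F K\<^sub>1_deriv K\<^sub>2_deriv K\<^sub>3_deriv])
qed

lemma lattice_pairing_three_sincs:
  assumes w_pos: "w\<^sub>1 > 0" "w\<^sub>2 > 0" "w\<^sub>3 > 0" and schwartz_g: "schwartz g"
  shows "lattice_pairing w\<^sub>1 w\<^sub>2 w\<^sub>3 (fourier (three_sincs w\<^sub>1 w\<^sub>2 w\<^sub>3 g))
    = - (1 / (8 * pi\<^sup>2 * (w\<^sub>1 * w\<^sub>2 * w\<^sub>3))) * vderiv (vderiv g) 0"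
proof -
  define q where "q u = of_real (u\<^sup>2 / 2) * fourier g u" for u
  have schwartz_g'': "schwartz (vderiv (vderiv g))" by (intro schwartz_vderiv schwartz_g)
  have q_eq: "q = (\<lambda>u. - (1 / (8 * pi\<^sup>2)) * fourier (vderiv (vderiv g)) u)"
    using schwartz_g
    by (simp add: q_def fun_eq_iff fourier_vderiv schwartz_vderiv field_simps power2_eq_square)
  have "fourier (three_sincs w\<^sub>1 w\<^sub>2 w\<^sub>3 g) (- x) = fourier (three_sincs w\<^sub>1 w\<^sub>2 w\<^sub>3 (\<lambda>t. g (- t))) x" for x
    unfolding fourier_reflect[symmetric] by (simp add: three_sincs_def[abs_def] sinc_wave_reflect)
  moreover have "of_real (u\<^sup>2 / 2) * fourier (\<lambda>t. g (- t)) u = q (- u)" for u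
    by (simp add: q_def fourier_reflect)
  ultimately have "lattice_pairing w\<^sub>1 w\<^sub>2 w\<^sub>3 (fourier (three_sincs w\<^sub>1 w\<^sub>2 w\<^sub>3 g))
      = ((LBINT u=0..\<infinity>. q u) + (LBINT u=0..\<infinity>. q (- u))) / (w\<^sub>1 * w\<^sub>2 * w\<^sub>3)"
    unfolding lattice_pairing_def add_divide_distrib
    by (simp only: lattice_sum_three_sincs[OF w_pos schwartz_g]
        lattice_sum_three_sincs[OF w_pos schwartz_reflect[OF schwartz_g]] q_def[abs_def])
  also have "(LBINT u=0..\<infinity>. q u) + (LBINT u=0..\<infinity>. q (- u)) = (LBINT u=-\<infinity>..\<infinity>. q u)"
  proof -
    have "integrable lborel q" using schwartz_fourier_integrable[OF schwartz_g''] by (simp add: q_eq)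
    then have "(LBINT u=-\<infinity>..0. q u) + (LBINT u=0..\<infinity>. q u) = (LBINT u=-\<infinity>..\<infinity>. q u)"
      by (intro interval_integral_sum) (simp add: interval_lebesgue_integrable_def set_integrable_def)
    then show ?thesis using interval_integral_reflect[of "-\<infinity>" 0 q] by (simp add: add.commute)
  qed
  also have "\<dots> = - (1 / (8 * pi\<^sup>2)) * vderiv (vderiv g) 0"
    using fourier_inversion_at_0[OF schwartz_g'']
    by (simp add: interval_lebesgue_integral_def set_lebesgue_integral_def q_eq)
  finally show ?thesis by simp
qed

subsection \<open>Badly approximable numbers and small denominators\<close>

definition badly_approximable :: "real \<Rightarrow> bool" where
  "badly_approximable \<alpha> \<longleftrightarrow> (\<exists>c>0. \<forall>p q. q \<noteq> 0 \<longrightarrow> c / of_int \<bar>q\<bar> \<le> \<bar>of_int q * \<alpha> - of_int p\<bar>)"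

lemma badly_approximableE:
  assumes "badly_approximable \<alpha>"
  obtains c where "c > 0" "\<And>p q. q \<noteq> 0 \<Longrightarrow> c / of_int \<bar>q\<bar> \<le> \<bar>of_int q * \<alpha> - of_int p\<bar>"
  using assms unfolding badly_approximable_def by blast

lemma badly_approximableI:
  assumes "c > 0" "\<And>p q. q \<noteq> 0 \<Longrightarrow> \<bar>of_int q * \<alpha> - of_int p\<bar> < 1 \<Longrightarrow> c / of_int \<bar>q\<bar> \<le> \<bar>of_int q * \<alpha> - of_int p\<bar>"
  shows "badly_approximable \<alpha>"
proof -
  have "min c 1 / of_int \<bar>q\<bar> \<le> \<bar>of_int q * \<alpha> - of_int p\<bar>" if q_nonzero: "q \<noteq> 0" for p q
  proof (cases "\<bar>of_int q * \<alpha> - of_int p\<bar> < 1")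
    case True
    have "min c 1 / of_int \<bar>q\<bar> \<le> c / of_int \<bar>q\<bar>" by (intro divide_right_mono) auto
    with assms(2)[OF q_nonzero True] show ?thesis by linarith
  next
    case False
    have "min c 1 / of_int \<bar>q\<bar> \<le> 1" using q_nonzero by (simp add: divide_le_eq)
    with False show ?thesis by linarith
  qed
  moreover have "min c 1 > 0" using assms(1) by simp
  ultimately show ?thesis unfolding badly_approximable_def by blast
qed

lemma one_le_abs_quadratic_form:
  fixes \<alpha> :: real and a b p q :: int
  assumes "\<alpha> \<notin> \<rat>" "b \<noteq> 0" "\<alpha>\<^sup>2 = of_int a / of_int b" "q \<noteq> 0"
  shows "1 \<le> \<bar>of_int b * ((of_int q * \<alpha> - of_int p) * (of_int q * \<alpha> + of_int p))\<bar>"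
proof -
  have a_eq: "real_of_int a = of_int b * \<alpha>\<^sup>2" using assms(2,3) by simp
  have "a * q\<^sup>2 - b * p\<^sup>2 \<noteq> 0"
  proof
    assume "a * q\<^sup>2 - b * p\<^sup>2 = 0"
    then have "real_of_int (a * q\<^sup>2) = real_of_int (b * p\<^sup>2)"
      by (intro arg_cong[of _ _ real_of_int]) simp
    then have "\<alpha>\<^sup>2 = (of_int p / of_int q)\<^sup>2"
      using assms(2,4) by (simp add: a_eq power_divide field_simps)
    then have "\<alpha> = of_int p / of_int q \<or> \<alpha> = - (of_int p / of_int q)" by (simp only: power2_eq_iff)
    with assms(1) show False by auto
  qed
  then have "1 \<le> real_of_int \<bar>a * q\<^sup>2 - b * p\<^sup>2\<bar>" by linarith
  also have "real_of_int \<bar>a * q\<^sup>2 - b * p\<^sup>2\<bar>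
      = \<bar>of_int b * ((of_int q * \<alpha> - of_int p) * (of_int q * \<alpha> + of_int p))\<bar>"
    by (simp add: a_eq power2_eq_square algebra_simps)
  finally show ?thesis .
qed

lemma badly_approximable_quadratic:
  assumes "\<alpha> \<notin> \<rat>" "\<alpha>\<^sup>2 \<in> \<rat>" shows "badly_approximable \<alpha>"
proof -
  obtain a b :: int where fraction: "b > 0" "\<alpha>\<^sup>2 = of_int a / of_int b"
    using assms(2) by (metis Rats_cases')
  define M where "M = 2 * \<bar>\<alpha>\<bar> + 1"
  have "M > 0" by (simp add: M_def)
  show ?thesis
  proof (rule badly_approximableI)
    show "1 / (of_int b * M) > 0" using fraction(1) \<open>M > 0\<close> by simp
    fix p q :: int assume q_nonzero: "q \<noteq> 0" and close: "\<bar>of_int q * \<alpha> - of_int p\<bar> < 1"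
    have "\<bar>q * \<alpha> + p\<bar> \<le> 2 * \<bar>q * \<alpha>\<bar> + \<bar>q * \<alpha> - p\<bar>" by linarith
    also have "\<dots> \<le> 2 * \<bar>q * \<alpha>\<bar> + \<bar>q\<bar>" using close q_nonzero by linarith
    also have "\<dots> = M * \<bar>q\<bar>" by (simp add: M_def abs_mult algebra_simps)
    finally have conjugate_le: "\<bar>q * \<alpha> + p\<bar> \<le> M * \<bar>q\<bar>" .
    have "1 \<le> \<bar>of_int b * ((of_int q * \<alpha> - of_int p) * (of_int q * \<alpha> + of_int p))\<bar>"
      using fraction q_nonzero by (intro one_le_abs_quadratic_form[OF assms(1)]) auto
    also have "\<dots> \<le> of_int b * (\<bar>q * \<alpha> - p\<bar> * (M * \<bar>q\<bar>))"
      using fraction(1) conjugate_le by (simp add: abs_mult mult_left_mono)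
    finally show "1 / (of_int b * M) / of_int \<bar>q\<bar> \<le> \<bar>of_int q * \<alpha> - of_int p\<bar>"
      using fraction(1) q_nonzero \<open>M > 0\<close> by (simp add: pos_divide_le_eq mult_ac)
  qed
qed

lemma abs_inverse_linear_form:
  fixes \<alpha> u v :: real
  assumes "\<alpha> \<noteq> 0" shows "\<bar>v * inverse \<alpha> - u\<bar> = \<bar>u * \<alpha> - v\<bar> / \<bar>\<alpha>\<bar>"
proof -
  have "v * inverse \<alpha> - u = (v - u * \<alpha>) / \<alpha>" using assms by (simp add: divide_inverse left_diff_distrib)
  then show ?thesis by (simp add: abs_minus_commute)
qed

lemma badly_approximable_inverse:
  assumes "badly_approximable \<alpha>" shows "badly_approximable (inverse \<alpha>)"
proof -
  obtain c where c_bound: "c > 0" "\<And>p q. q \<noteq> 0 \<Longrightarrow> c / of_int \<bar>q\<bar> \<le> \<bar>of_int q * \<alpha> - of_int p\<bar>"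
    using assms by (rule badly_approximableE) (rule that)
  have "\<alpha> \<noteq> 0" using c_bound(2)[of 1 0] c_bound(1) by auto
  note form_eq = abs_inverse_linear_form[OF \<open>\<alpha> \<noteq> 0\<close>]
  define C where "C = min (1 / \<bar>\<alpha>\<bar>) (c / (1 + \<bar>\<alpha>\<bar>))"
  show ?thesis
  proof (rule badly_approximableI)
    show "C > 0" using c_bound(1) \<open>\<alpha> \<noteq> 0\<close> by (simp add: C_def add_pos_nonneg)
    fix p q :: int assume q_nonzero: "q \<noteq> 0" and close: "\<bar>of_int q * inverse \<alpha> - of_int p\<bar> < 1"
    have one_le_q: "1 \<le> \<bar>real_of_int q\<bar>" using q_nonzero by (simp flip: of_int_abs)
    show "C / of_int \<bar>q\<bar> \<le> \<bar>of_int q * inverse \<alpha> - of_int p\<bar>"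
    proof (cases "p = 0")
      case True
      have "C / \<bar>q\<bar> \<le> 1 / \<bar>\<alpha>\<bar> / 1" using one_le_q by (intro frac_le) (auto simp: C_def)
      also have "\<dots> \<le> \<bar>real_of_int q\<bar> / \<bar>\<alpha>\<bar>" using one_le_q by (simp add: divide_right_mono)
      finally show ?thesis using True by (simp add: abs_mult divide_inverse)
    next
      case False
      have "\<bar>p * \<alpha> - q\<bar> < \<bar>\<alpha>\<bar>" using close \<open>\<alpha> \<noteq> 0\<close> by (simp add: form_eq divide_less_eq)
      also have "\<dots> \<le> \<bar>\<alpha>\<bar> * \<bar>q\<bar>" using one_le_q by (simp add: mult_le_cancel_left1)
      finally have "\<bar>p * \<alpha>\<bar> \<le> \<bar>q\<bar> + \<bar>\<alpha>\<bar> * \<bar>q\<bar>" by linarith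
      then have "\<bar>\<alpha>\<bar> * \<bar>p\<bar> \<le> (1 + \<bar>\<alpha>\<bar>) * \<bar>q\<bar>" by (simp add: abs_mult algebra_simps)
      then have "c / ((1 + \<bar>\<alpha>\<bar>) * \<bar>q\<bar>) \<le> c / (\<bar>\<alpha>\<bar> * \<bar>p\<bar>)"
        using c_bound(1) False q_nonzero \<open>\<alpha> \<noteq> 0\<close>
        by (intro divide_left_mono) (auto intro!: mult_pos_pos add_pos_nonneg)
      also have "\<dots> = c / \<bar>p\<bar> / \<bar>\<alpha>\<bar>" by (simp add: mult.commute)
      also have "\<dots> \<le> \<bar>q * inverse \<alpha> - p\<bar>"
        unfolding form_eq using c_bound(2) False by (intro divide_right_mono) auto
      finally have "c / (1 + \<bar>\<alpha>\<bar>) / \<bar>q\<bar> \<le> \<bar>q * inverse \<alpha> - p\<bar>" by simp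
      moreover have "C / \<bar>q\<bar> \<le> c / (1 + \<bar>\<alpha>\<bar>) / \<bar>q\<bar>" by (intro divide_right_mono) (auto simp: C_def)
      ultimately show ?thesis by linarith
    qed
  qed
qed

lemma abs_sin_pi_ge: "2 * \<bar>x - of_int (round x)\<bar> \<le> \<bar>sin (pi * x)\<bar>"
proof -
  define m where "m = round x"
  have "\<bar>x - of_int m\<bar> \<le> 1/2"
    unfolding m_def using of_int_round_abs_le[of x] by (simp add: abs_minus_commute)
  then have "2 * \<bar>x - of_int m\<bar> \<le> \<bar>sin (pi * (x - of_int m))\<bar>" by (rule two_abs_le_abs_sin_pi)
  also have "sin (pi * (x - of_int m)) = sin (pi * x) * cos (pi * of_int m)"
    by (simp add: right_diff_distrib sin_diff sin_times_pi_eq_0 mult.commute[of pi])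
  also have "\<bar>sin (pi * x) * cos (pi * of_int m)\<bar> \<le> \<bar>sin (pi * x)\<bar>"
    unfolding abs_mult by (rule mult_left_le) auto
  finally show ?thesis by (simp add: m_def)
qed

lemma badly_approximable_sin_ge:
  assumes "badly_approximable \<alpha>"
  obtains c where "c > 0" "\<And>k. k \<noteq> 0 \<Longrightarrow> c / of_int \<bar>k\<bar> \<le> \<bar>sin (pi * of_int k * \<alpha>)\<bar>"
proof -
  obtain c where c_bound: "c > 0" "\<And>p q. q \<noteq> 0 \<Longrightarrow> c / of_int \<bar>q\<bar> \<le> \<bar>of_int q * \<alpha> - of_int p\<bar>"
    using assms by (rule badly_approximableE) (rule that)
  have "c / of_int \<bar>k\<bar> \<le> \<bar>sin (pi * of_int k * \<alpha>)\<bar>" if "k \<noteq> 0" for k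
  proof -
    have "c / of_int \<bar>k\<bar> \<le> \<bar>of_int k * \<alpha> - of_int (round (of_int k * \<alpha>))\<bar>" by (rule c_bound(2)[OF that])
    also have "\<dots> \<le> 2 * \<dots>" by simp
    also have "\<dots> \<le> \<bar>sin (pi * (of_int k * \<alpha>))\<bar>" by (rule abs_sin_pi_ge)
    finally show ?thesis by (simp only: mult.assoc)
  qed
  with c_bound(1) show thesis using that by blast
qed

lemma abs_linear_form_le:
  fixes \<alpha> x y u v :: real
  assumes "\<alpha> > 0" shows "\<bar>u * \<alpha> - v\<bar> \<le> (1 + \<alpha>) * (\<bar>x - u\<bar> + \<bar>\<alpha> * x - v\<bar>)"
proof -
  have "\<bar>u * \<alpha> - v\<bar> = \<bar>(\<alpha> * x - v) - \<alpha> * (x - u)\<bar>" by (simp add: algebra_simps)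
  also have "\<dots> \<le> \<bar>\<alpha> * x - v\<bar> + \<bar>\<alpha> * (x - u)\<bar>" by (rule abs_triangle_ineq4)
  also have "\<dots> = \<bar>\<alpha> * x - v\<bar> + \<alpha> * \<bar>x - u\<bar>" using assms by (simp add: abs_mult)
  also have "\<dots> \<le> (1 + \<alpha>) * (\<bar>x - u\<bar> + \<bar>\<alpha> * x - v\<bar>)" using assms by (simp add: distrib_left distrib_right)
  finally show ?thesis .
qed

lemma badly_approximable_sum_distances_ge:
  assumes v_pos: "v > 0" and w_pos: "w > 0" and "badly_approximable (w / v)"
  obtains c where "c > 0"
    "\<And>t. c * min \<bar>t\<bar> (1 / (1 + \<bar>t\<bar>)) \<le> \<bar>v * t - of_int (round (v * t))\<bar> + \<bar>w * t - of_int (round (w * t))\<bar>"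
proof -
  define \<alpha> where "\<alpha> = w / v"
  have \<alpha>_pos: "\<alpha> > 0" using v_pos w_pos by (simp add: \<alpha>_def)
  have "badly_approximable \<alpha>" using assms(3) by (simp add: \<alpha>_def)
  then obtain c where c_bound: "c > 0" "\<And>p q. q \<noteq> 0 \<Longrightarrow> c / of_int \<bar>q\<bar> \<le> \<bar>of_int q * \<alpha> - of_int p\<bar>"
    by (rule badly_approximableE) (rule that)
  define C where "C = c / ((1 + \<alpha>) * (1 + v))"
  have C_pos: "C > 0" "min v C > 0" using c_bound(1) v_pos \<alpha>_pos by (simp_all add: C_def)
  have "min v C * min \<bar>t\<bar> (1 / (1 + \<bar>t\<bar>))
      \<le> \<bar>v * t - of_int (round (v * t))\<bar> + \<bar>w * t - of_int (round (w * t))\<bar>" for t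
  proof -
    define m n where "m = round (v * t)" and "n = round (w * t)"
    have "min v C * min \<bar>t\<bar> (1 / (1 + \<bar>t\<bar>)) \<le> \<bar>v * t - m\<bar> + \<bar>w * t - n\<bar>"
    proof (cases "m = 0")
      case True
      have "min v C * min \<bar>t\<bar> (1 / (1 + \<bar>t\<bar>)) \<le> v * \<bar>t\<bar>" using C_pos v_pos by (intro mult_mono) auto
      also have "\<dots> \<le> \<bar>v * t - m\<bar> + \<bar>w * t - n\<bar>" using True v_pos by (simp add: abs_mult)
      finally show ?thesis .
    next
      case False
      have "\<bar>real_of_int m\<bar> \<le> \<bar>v * t\<bar> + 1"
        using of_int_round_abs_le[of "v * t"] unfolding m_def by linarith
      also have "\<dots> \<le> (1 + v) * (1 + \<bar>t\<bar>)" using v_pos by (simp add: abs_mult algebra_simps)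
      finally have "c / ((1 + v) * (1 + \<bar>t\<bar>)) \<le> c / \<bar>m\<bar>"
        using c_bound(1) False v_pos
        by (intro divide_left_mono) (auto intro!: mult_pos_pos add_pos_nonneg)
      also have "\<dots> \<le> \<bar>m * \<alpha> - n\<bar>" using c_bound(2) False by simp
      also have "\<dots> \<le> (1 + \<alpha>) * (\<bar>v * t - m\<bar> + \<bar>w * t - n\<bar>)"
        using abs_linear_form_le[OF \<alpha>_pos, of m n "v * t"] v_pos by (simp add: \<alpha>_def)
      finally have "C * (1 / (1 + \<bar>t\<bar>)) \<le> \<bar>v * t - m\<bar> + \<bar>w * t - n\<bar>"
        using v_pos \<alpha>_pos by (simp add: C_def field_simps add_pos_nonneg)
      moreover have "min v C * min \<bar>t\<bar> (1 / (1 + \<bar>t\<bar>)) \<le> C * (1 / (1 + \<bar>t\<bar>))"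
        using C_pos by (intro mult_mono) auto
      ultimately show ?thesis by linarith
    qed
    then show ?thesis by (simp only: m_def n_def)
  qed
  with C_pos(2) show thesis using that by blast
qed

lemma badly_approximable_sum_sines_ge:
  assumes "v > 0" "w > 0" "badly_approximable (w / v)"
  obtains c where "c > 0" "\<And>t. c * min \<bar>t\<bar> (1 / (1 + \<bar>t\<bar>)) \<le> \<bar>sin (pi * v * t)\<bar> + \<bar>sin (pi * w * t)\<bar>"
proof -
  obtain c where c_bound: "c > 0"
      "\<And>t. c * min \<bar>t\<bar> (1 / (1 + \<bar>t\<bar>))
          \<le> \<bar>v * t - of_int (round (v * t))\<bar> + \<bar>w * t - of_int (round (w * t))\<bar>"
    using badly_approximable_sum_distances_ge[OF assms] by blast
  have "c * min \<bar>t\<bar> (1 / (1 + \<bar>t\<bar>)) \<le> \<bar>sin (pi * v * t)\<bar> + \<bar>sin (pi * w * t)\<bar>" for t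
  proof -
    have "c * min \<bar>t\<bar> (1 / (1 + \<bar>t\<bar>))
        \<le> 2 * \<bar>v * t - of_int (round (v * t))\<bar> + 2 * \<bar>w * t - of_int (round (w * t))\<bar>"
      using c_bound(2)[of t] by (rule order_trans) (intro add_mono; simp)
    also have "\<dots> \<le> \<bar>sin (pi * v * t)\<bar> + \<bar>sin (pi * w * t)\<bar>"
      using add_mono[OF abs_sin_pi_ge[of "v * t"] abs_sin_pi_ge[of "w * t"]] by (simp only: mult.assoc)
    finally show ?thesis .
  qed
  with c_bound(1) show thesis by (rule that)
qed

locale incommensurable_triple =
  fixes w\<^sub>1 w\<^sub>2 w\<^sub>3 :: real
  assumes pos: "w\<^sub>1 > 0" "w\<^sub>2 > 0" "w\<^sub>3 > 0"
    and badly_approximable_ratio: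
      "badly_approximable (w\<^sub>2 / w\<^sub>1)" "badly_approximable (w\<^sub>3 / w\<^sub>1)" "badly_approximable (w\<^sub>3 / w\<^sub>2)"
begin

lemma badly_approximable_inverse_ratio:
  "badly_approximable (w\<^sub>1 / w\<^sub>2)" "badly_approximable (w\<^sub>1 / w\<^sub>3)" "badly_approximable (w\<^sub>2 / w\<^sub>3)"
  using badly_approximable_ratio[THEN badly_approximable_inverse] by simp_all

lemma swap12: "incommensurable_triple w\<^sub>2 w\<^sub>1 w\<^sub>3"
  using pos badly_approximable_ratio badly_approximable_inverse_ratio by unfold_locales

lemma swap13: "incommensurable_triple w\<^sub>3 w\<^sub>2 w\<^sub>1"
  using pos badly_approximable_inverse_ratio by unfold_locales

end

subsection \<open>The spectral side\<close>

definition residue_coeff :: "real \<Rightarrow> real \<Rightarrow> real \<Rightarrow> int \<Rightarrow> real" where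
  "residue_coeff w\<^sub>1 w\<^sub>2 w\<^sub>3 k =
    (- 1) powi (k + 1) / (4 * w\<^sub>1 * sin (pi * k * (w\<^sub>2 / w\<^sub>1)) * sin (pi * k * (w\<^sub>3 / w\<^sub>1)))"

definition residue_term :: "real \<Rightarrow> real \<Rightarrow> real \<Rightarrow> (real \<Rightarrow> complex) \<Rightarrow> int \<Rightarrow> complex" where
  "residue_term w\<^sub>1 w\<^sub>2 w\<^sub>3 f k = of_real (residue_coeff w\<^sub>1 w\<^sub>2 w\<^sub>3 k) * f (of_int k / w\<^sub>1)"

definition residue_sum :: "real \<Rightarrow> real \<Rightarrow> real \<Rightarrow> (real \<Rightarrow> complex) \<Rightarrow> complex" where
  "residue_sum w\<^sub>1 w\<^sub>2 w\<^sub>3 f = (\<Sum>\<^sub>\<infinity>k\<in>- {0}. residue_term w\<^sub>1 w\<^sub>2 w\<^sub>3 f k)"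

definition spectral_side :: "real \<Rightarrow> real \<Rightarrow> real \<Rightarrow> (real \<Rightarrow> complex) \<Rightarrow> complex" where
  "spectral_side w\<^sub>1 w\<^sub>2 w\<^sub>3 f = - (1 / (8 * pi\<^sup>2 * (w\<^sub>1 * w\<^sub>2 * w\<^sub>3))) * vderiv (vderiv f) 0
     - ((w\<^sub>1\<^sup>2 + w\<^sub>2\<^sup>2 + w\<^sub>3\<^sup>2) / (24 * (w\<^sub>1 * w\<^sub>2 * w\<^sub>3))) * f 0
     + (residue_sum w\<^sub>1 w\<^sub>2 w\<^sub>3 f + residue_sum w\<^sub>2 w\<^sub>1 w\<^sub>3 f + residue_sum w\<^sub>3 w\<^sub>1 w\<^sub>2 f)"

lemma residue_sum_commute: "residue_sum w\<^sub>1 w\<^sub>3 w\<^sub>2 f = residue_sum w\<^sub>1 w\<^sub>2 w\<^sub>3 f"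
  by (simp add: residue_sum_def residue_term_def residue_coeff_def mult_ac)

lemma spectral_side_swap12: "spectral_side w\<^sub>2 w\<^sub>1 w\<^sub>3 f = spectral_side w\<^sub>1 w\<^sub>2 w\<^sub>3 f"
  unfolding spectral_side_def residue_sum_commute[of w\<^sub>3 w\<^sub>2 w\<^sub>1] by (simp add: mult_ac add_ac)

lemma spectral_side_swap13: "spectral_side w\<^sub>3 w\<^sub>2 w\<^sub>1 f = spectral_side w\<^sub>1 w\<^sub>2 w\<^sub>3 f"
  unfolding spectral_side_def residue_sum_commute[of w\<^sub>3 w\<^sub>1 w\<^sub>2]
    residue_sum_commute[of w\<^sub>2 w\<^sub>1 w\<^sub>3] residue_sum_commute[of w\<^sub>1 w\<^sub>2 w\<^sub>3]
  by (simp add: mult_ac add_ac)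

lemma residue_sum_eq_0: "(\<And>k::int. k \<noteq> 0 \<Longrightarrow> f (of_int k / w\<^sub>1) = 0) \<Longrightarrow> residue_sum w\<^sub>1 w\<^sub>2 w\<^sub>3 f = 0"
  unfolding residue_sum_def residue_term_def by (rule infsum_0) auto

lemma sin_pi_ratio_nonzero:
  assumes "badly_approximable \<alpha>" "k \<noteq> 0" shows "sin (pi * of_int k * \<alpha>) \<noteq> 0"
proof -
  obtain c where "c > 0" and c_bound: "\<And>k. k \<noteq> 0 \<Longrightarrow> c / of_int \<bar>k\<bar> \<le> \<bar>sin (pi * of_int k * \<alpha>)\<bar>"
    using assms(1) by (rule badly_approximable_sin_ge) (rule that)
  have "0 < c / of_int \<bar>k\<bar>" using \<open>c > 0\<close> assms(2) by simp
  with c_bound[OF assms(2)] show ?thesis by auto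
qed

lemma residue_coeff_nonzero:
  assumes "w\<^sub>1 > 0" "badly_approximable (w\<^sub>2 / w\<^sub>1)" "badly_approximable (w\<^sub>3 / w\<^sub>1)" "k \<noteq> 0"
  shows "residue_coeff w\<^sub>1 w\<^sub>2 w\<^sub>3 k \<noteq> 0"
  using assms(1) sin_pi_ratio_nonzero[OF assms(2,4)] sin_pi_ratio_nonzero[OF assms(3,4)]
  by (simp add: residue_coeff_def)

lemma residue_coeff_quadratic_growth:
  assumes w_pos: "w\<^sub>1 > 0" and "badly_approximable (w\<^sub>2 / w\<^sub>1)" "badly_approximable (w\<^sub>3 / w\<^sub>1)"
  obtains C where "\<And>k. k \<noteq> 0 \<Longrightarrow> \<bar>residue_coeff w\<^sub>1 w\<^sub>2 w\<^sub>3 k\<bar> \<le> C * (of_int k / w\<^sub>1)\<^sup>2"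
proof -
  obtain a where a_bound: "a > 0" "\<And>k. k \<noteq> 0 \<Longrightarrow> a / of_int \<bar>k\<bar> \<le> \<bar>sin (pi * of_int k * (w\<^sub>2 / w\<^sub>1))\<bar>"
    using badly_approximable_sin_ge[OF assms(2)] by blast
  obtain b where b_bound: "b > 0" "\<And>k. k \<noteq> 0 \<Longrightarrow> b / of_int \<bar>k\<bar> \<le> \<bar>sin (pi * of_int k * (w\<^sub>3 / w\<^sub>1))\<bar>"
    using badly_approximable_sin_ge[OF assms(3)] by blast
  have "\<bar>residue_coeff w\<^sub>1 w\<^sub>2 w\<^sub>3 k\<bar> \<le> w\<^sub>1 / (4 * a * b) * (of_int k / w\<^sub>1)\<^sup>2" if k_nonzero: "k \<noteq> 0" for k
  proof -
    have "(a / \<bar>k\<bar>) * (b / \<bar>k\<bar>) \<le> \<bar>sin (pi * k * (w\<^sub>2 / w\<^sub>1))\<bar> * \<bar>sin (pi * k * (w\<^sub>3 / w\<^sub>1))\<bar>"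
      using a_bound b_bound k_nonzero by (intro mult_mono) auto
    moreover have "(a / \<bar>k\<bar>) * (b / \<bar>k\<bar>) > 0"
      using a_bound(1) b_bound(1) k_nonzero by (intro mult_pos_pos divide_pos_pos) auto
    ultimately have "1 / (\<bar>sin (pi * k * (w\<^sub>2 / w\<^sub>1))\<bar> * \<bar>sin (pi * k * (w\<^sub>3 / w\<^sub>1))\<bar>)
        \<le> 1 / ((a / \<bar>k\<bar>) * (b / \<bar>k\<bar>))"
      unfolding inverse_eq_divide[symmetric] by (rule le_imp_inverse_le)
    then have "1 / (4 * w\<^sub>1) * (1 / (\<bar>sin (pi * k * (w\<^sub>2 / w\<^sub>1))\<bar> * \<bar>sin (pi * k * (w\<^sub>3 / w\<^sub>1))\<bar>))
        \<le> 1 / (4 * w\<^sub>1) * (1 / ((a / \<bar>k\<bar>) * (b / \<bar>k\<bar>)))"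
      using w_pos by (intro mult_left_mono) auto
    also have "\<dots> = w\<^sub>1 / (4 * a * b) * (of_int k / w\<^sub>1)\<^sup>2" using w_pos by (simp add: power2_eq_square)
    finally show ?thesis using w_pos by (simp add: residue_coeff_def abs_mult power_int_abs mult_ac)
  qed
  then show thesis using that by blast
qed

lemma residue_term_abs_summable:
  assumes w_pos: "w\<^sub>1 > 0" and "badly_approximable (w\<^sub>2 / w\<^sub>1)" "badly_approximable (w\<^sub>3 / w\<^sub>1)"
    and decay_f: "rapid_decay f"
  shows "(\<lambda>k. norm (residue_term w\<^sub>1 w\<^sub>2 w\<^sub>3 f k)) summable_on (- {0})"
proof -
  obtain C where C_bound: "\<And>k. k \<noteq> 0 \<Longrightarrow> \<bar>residue_coeff w\<^sub>1 w\<^sub>2 w\<^sub>3 k\<bar> \<le> C * (of_int k / w\<^sub>1)\<^sup>2"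
    using residue_coeff_quadratic_growth[OF assms(1-3)] by blast
  have "(\<lambda>k::int. norm (f (of_int k / w\<^sub>1) * of_real ((of_int k / w\<^sub>1)\<^sup>2))) summable_on - {0}"
    by (rule summable_on_subset_banach[OF rapid_decay_abs_summable_int[OF w_pos
          rapid_decay_mult[OF decay_f poly_bounded_power[of 2]]]]) simp
  then have "(\<lambda>k::int. C * norm (f (of_int k / w\<^sub>1) * of_real ((of_int k / w\<^sub>1)\<^sup>2))) summable_on - {0}"
    by (rule summable_on_cmult_right)
  then show ?thesis
  proof (rule Infinite_Sum.abs_summable_on_comparison_test')
    fix k :: int assume "k \<in> - {0}"
    then have "\<bar>residue_coeff w\<^sub>1 w\<^sub>2 w\<^sub>3 k\<bar> * norm (f (of_int k / w\<^sub>1))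
        \<le> C * (of_int k / w\<^sub>1)\<^sup>2 * norm (f (of_int k / w\<^sub>1))"
      using C_bound by (intro mult_right_mono) auto
    then show "norm (residue_term w\<^sub>1 w\<^sub>2 w\<^sub>3 f k)
        \<le> C * norm (f (of_int k / w\<^sub>1) * of_real ((of_int k / w\<^sub>1)\<^sup>2))"
      by (simp add: residue_term_def norm_mult norm_power norm_divide power_divide mult_ac)
  qed
qed

lemma residue_sum_add:
  assumes "w\<^sub>1 > 0" "badly_approximable (w\<^sub>2 / w\<^sub>1)" "badly_approximable (w\<^sub>3 / w\<^sub>1)" "rapid_decay f"
      "rapid_decay g"
  shows "residue_sum w\<^sub>1 w\<^sub>2 w\<^sub>3 (\<lambda>x. f x + g x) = residue_sum w\<^sub>1 w\<^sub>2 w\<^sub>3 f + residue_sum w\<^sub>1 w\<^sub>2 w\<^sub>3 g"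
  using infsum_add[OF residue_term_abs_summable[THEN abs_summable_summable, OF assms(1-4)]
      residue_term_abs_summable[THEN abs_summable_summable, OF assms(1-3,5)]]
  by (simp add: residue_sum_def residue_term_def distrib_left)

subsection \<open>The summation formula\<close>

definition summation_formula :: "real \<Rightarrow> real \<Rightarrow> real \<Rightarrow> (real \<Rightarrow> complex) \<Rightarrow> bool" where
  "summation_formula w\<^sub>1 w\<^sub>2 w\<^sub>3 f \<longleftrightarrow>
    schwartz f \<and> lattice_pairing w\<^sub>1 w\<^sub>2 w\<^sub>3 (fourier f) = spectral_side w\<^sub>1 w\<^sub>2 w\<^sub>3 f"

lemma summation_formula_swap12: "summation_formula w\<^sub>2 w\<^sub>1 w\<^sub>3 f \<longleftrightarrow> summation_formula w\<^sub>1 w\<^sub>2 w\<^sub>3 f"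
  by (simp add: summation_formula_def lattice_pairing_def lattice_sum_swap12[of w\<^sub>2]
      spectral_side_swap12[of w\<^sub>2])

lemma summation_formula_swap13: "summation_formula w\<^sub>3 w\<^sub>2 w\<^sub>1 f \<longleftrightarrow> summation_formula w\<^sub>1 w\<^sub>2 w\<^sub>3 f"
  by (simp add: summation_formula_def lattice_pairing_def lattice_sum_swap13[of w\<^sub>3]
      spectral_side_swap13[of w\<^sub>3])

definition sinc_product :: "real \<Rightarrow> real \<Rightarrow> real \<Rightarrow> real \<Rightarrow> complex" where
  "sinc_product w\<^sub>1 w\<^sub>2 w\<^sub>3 t = sinc_wave w\<^sub>3 t * (sinc_wave w\<^sub>2 t * sinc_wave w\<^sub>1 t)"

definition denominator :: "real \<Rightarrow> real \<Rightarrow> real \<Rightarrow> real \<Rightarrow> complex" where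
  "denominator w\<^sub>1 w\<^sub>2 w\<^sub>3 t = (sinc_product w\<^sub>1 w\<^sub>2 w\<^sub>3 t)\<^sup>2 + (sin_wave w\<^sub>3 t * sin_wave w\<^sub>2 t)\<^sup>2
    + (sin_wave w\<^sub>3 t * sin_wave w\<^sub>1 t)\<^sup>2 + (sin_wave w\<^sub>1 t * sin_wave w\<^sub>2 t)\<^sup>2"

lemma multiplier_sinc_product:
  "w\<^sub>1 > 0 \<Longrightarrow> w\<^sub>2 > 0 \<Longrightarrow> w\<^sub>3 > 0 \<Longrightarrow> multiplier (sinc_product w\<^sub>1 w\<^sub>2 w\<^sub>3)"
  unfolding sinc_product_def[abs_def] by (intro multiplier_mult multiplier_sinc_wave)

lemma multiplier_denominator:
  "w\<^sub>1 > 0 \<Longrightarrow> w\<^sub>2 > 0 \<Longrightarrow> w\<^sub>3 > 0 \<Longrightarrow> multiplier (denominator w\<^sub>1 w\<^sub>2 w\<^sub>3)"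
  unfolding denominator_def[abs_def] power2_eq_square
  by (intro multiplier_add multiplier_mult multiplier_sin_wave multiplier_sinc_product)

lemma norm_denominator:
  "norm (denominator w\<^sub>1 w\<^sub>2 w\<^sub>3 t) = (norm (sinc_product w\<^sub>1 w\<^sub>2 w\<^sub>3 t))\<^sup>2
    + ((\<bar>sin (pi * w\<^sub>3 * t)\<bar> * \<bar>sin (pi * w\<^sub>2 * t)\<bar>)\<^sup>2 + (\<bar>sin (pi * w\<^sub>3 * t)\<bar> * \<bar>sin (pi * w\<^sub>1 * t)\<bar>)\<^sup>2
      + (\<bar>sin (pi * w\<^sub>1 * t)\<bar> * \<bar>sin (pi * w\<^sub>2 * t)\<bar>)\<^sup>2)"
proof -
  define r where "r = sinc (pi * w\<^sub>3 * t) * (sinc (pi * w\<^sub>2 * t) * sinc (pi * w\<^sub>1 * t))"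
  have sinc_product_eq: "sinc_product w\<^sub>1 w\<^sub>2 w\<^sub>3 t = of_real r"
    by (simp add: sinc_product_def sinc_wave_def r_def)
  have denominator: "denominator w\<^sub>1 w\<^sub>2 w\<^sub>3 t = of_real (r\<^sup>2 + (sin (pi * w\<^sub>3 * t) * sin (pi * w\<^sub>2 * t))\<^sup>2
      + (sin (pi * w\<^sub>3 * t) * sin (pi * w\<^sub>1 * t))\<^sup>2 + (sin (pi * w\<^sub>1 * t) * sin (pi * w\<^sub>2 * t))\<^sup>2)"
    by (simp add: denominator_def sinc_product_eq sin_wave_def)
  show ?thesis unfolding denominator norm_of_real sinc_product_eq by (simp add: power_mult_distrib)
qed

lemma norm_sinc_wave_ge:
  assumes "w > 0" "w * \<bar>t\<bar> \<le> 1/2" shows "2 / pi \<le> norm (sinc_wave w t)"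
proof (cases "t = 0")
  case True
  then show ?thesis using pi_gt3 by (simp add: sinc_wave_0 divide_le_eq)
next
  case False
  have "2 * \<bar>w * t\<bar> \<le> norm (sin_wave w t)"
    using two_abs_le_abs_sin_pi[of "w * t"] assms by (simp add: sin_wave_def abs_mult mult.assoc)
  also have "\<dots> = pi * \<bar>w * t\<bar> * norm (sinc_wave w t)"
    using assms by (simp add: sin_wave_eq_sinc_wave norm_mult abs_mult)
  finally show ?thesis using False assms by (simp add: divide_le_eq mult_ac abs_mult)
qed

lemma sum_squared_products_ge:
  fixes a b c \<eta> :: real
  assumes nonneg: "0 \<le> a" "0 \<le> b" "0 \<le> c" "0 \<le> \<eta>"
    and pairs: "2 * \<eta> \<le> a + b" "2 * \<eta> \<le> a + c" "2 * \<eta> \<le> b + c"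
  shows "\<eta> ^ 4 \<le> (c * b)\<^sup>2 + (c * a)\<^sup>2 + (a * b)\<^sup>2"
proof -
  have square: "\<eta> ^ 4 \<le> (x * y)\<^sup>2" if "\<eta> \<le> x" "\<eta> \<le> y" for x y
  proof -
    have "(\<eta> * \<eta>)\<^sup>2 \<le> (x * y)\<^sup>2" using that nonneg by (intro power_mono mult_mono) auto
    then show ?thesis by (simp add: power2_eq_square power4_eq_xxxx mult.assoc)
  qed
  consider "\<eta> \<le> a" "\<eta> \<le> b" | "\<eta> \<le> a" "\<eta> \<le> c" | "\<eta> \<le> b" "\<eta> \<le> c" using pairs by linarith
  then show ?thesis
    by cases (use square[of a b] square[of c a] square[of c b] in
        \<open>auto intro: order_trans add_nonneg_nonneg\<close>)
qed

context incommensurable_triple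
begin

lemma norm_denominator_ge_near_0:
  assumes "(w\<^sub>1 + w\<^sub>2 + w\<^sub>3) * \<bar>t\<bar> \<le> 1/2"
  shows "(2 / pi) ^ 6 \<le> norm (denominator w\<^sub>1 w\<^sub>2 w\<^sub>3 t)"
proof -
  have "0 \<le> w\<^sub>1 * \<bar>t\<bar>" "0 \<le> w\<^sub>2 * \<bar>t\<bar>" "0 \<le> w\<^sub>3 * \<bar>t\<bar>" using pos by auto
  then have "w\<^sub>1 * \<bar>t\<bar> \<le> 1/2" "w\<^sub>2 * \<bar>t\<bar> \<le> 1/2" "w\<^sub>3 * \<bar>t\<bar> \<le> 1/2"
    using assms unfolding distrib_right by linarith+
  then have "2 / pi * (2 / pi * (2 / pi)) \<le> norm (sinc_product w\<^sub>1 w\<^sub>2 w\<^sub>3 t)"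
    unfolding sinc_product_def norm_mult using pos by (intro mult_mono norm_sinc_wave_ge) auto
  then have "(2 / pi * (2 / pi * (2 / pi)))\<^sup>2 \<le> (norm (sinc_product w\<^sub>1 w\<^sub>2 w\<^sub>3 t))\<^sup>2"
    by (intro power_mono) auto
  also have "\<dots> \<le> norm (denominator w\<^sub>1 w\<^sub>2 w\<^sub>3 t)" by (simp add: norm_denominator)
  also have "(2 / pi * (2 / pi * (2 / pi)))\<^sup>2 = (2 / pi) ^ 6" by (simp add: eval_nat_numeral)
  finally show ?thesis .
qed

lemma norm_denominator_ge_min:
  obtains c where "c > 0" "\<And>t. (c * min \<bar>t\<bar> (1 / (1 + \<bar>t\<bar>))) ^ 4 \<le> norm (denominator w\<^sub>1 w\<^sub>2 w\<^sub>3 t)"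
proof -
  obtain c\<^sub>1\<^sub>2 where c\<^sub>1\<^sub>2_bound: "c\<^sub>1\<^sub>2 > 0"
      "\<And>t. c\<^sub>1\<^sub>2 * min \<bar>t\<bar> (1 / (1 + \<bar>t\<bar>)) \<le> \<bar>sin (pi * w\<^sub>1 * t)\<bar> + \<bar>sin (pi * w\<^sub>2 * t)\<bar>"
    using badly_approximable_sum_sines_ge[OF pos(1,2) badly_approximable_ratio(1)] by blast
  obtain c\<^sub>1\<^sub>3 where c\<^sub>1\<^sub>3_bound: "c\<^sub>1\<^sub>3 > 0"
      "\<And>t. c\<^sub>1\<^sub>3 * min \<bar>t\<bar> (1 / (1 + \<bar>t\<bar>)) \<le> \<bar>sin (pi * w\<^sub>1 * t)\<bar> + \<bar>sin (pi * w\<^sub>3 * t)\<bar>"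
    using badly_approximable_sum_sines_ge[OF pos(1,3) badly_approximable_ratio(2)] by blast
  obtain c\<^sub>2\<^sub>3 where c\<^sub>2\<^sub>3_bound: "c\<^sub>2\<^sub>3 > 0"
      "\<And>t. c\<^sub>2\<^sub>3 * min \<bar>t\<bar> (1 / (1 + \<bar>t\<bar>)) \<le> \<bar>sin (pi * w\<^sub>2 * t)\<bar> + \<bar>sin (pi * w\<^sub>3 * t)\<bar>"
    using badly_approximable_sum_sines_ge[OF pos(2,3) badly_approximable_ratio(3)] by blast
  define c where "c = min c\<^sub>1\<^sub>2 (min c\<^sub>1\<^sub>3 c\<^sub>2\<^sub>3)"
  have c_le: "c > 0" "c \<le> c\<^sub>1\<^sub>2" "c \<le> c\<^sub>1\<^sub>3" "c \<le> c\<^sub>2\<^sub>3"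
    using c\<^sub>1\<^sub>2_bound(1) c\<^sub>1\<^sub>3_bound(1) c\<^sub>2\<^sub>3_bound(1) by (auto simp: c_def)
  have "(c / 2 * min \<bar>t\<bar> (1 / (1 + \<bar>t\<bar>))) ^ 4 \<le> norm (denominator w\<^sub>1 w\<^sub>2 w\<^sub>3 t)" for t
  proof -
    define \<mu> where "\<mu> = min \<bar>t\<bar> (1 / (1 + \<bar>t\<bar>))"
    have "\<mu> \<ge> 0" by (simp add: \<mu>_def)
    then have "c * \<mu> \<le> c\<^sub>1\<^sub>2 * \<mu>" "c * \<mu> \<le> c\<^sub>1\<^sub>3 * \<mu>" "c * \<mu> \<le> c\<^sub>2\<^sub>3 * \<mu>"
      using c_le by (auto intro: mult_right_mono)
    then have "(c / 2 * \<mu>) ^ 4 \<le> (\<bar>sin (pi * w\<^sub>3 * t)\<bar> * \<bar>sin (pi * w\<^sub>2 * t)\<bar>)\<^sup>2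
        + (\<bar>sin (pi * w\<^sub>3 * t)\<bar> * \<bar>sin (pi * w\<^sub>1 * t)\<bar>)\<^sup>2 + (\<bar>sin (pi * w\<^sub>1 * t)\<bar> * \<bar>sin (pi * w\<^sub>2 * t)\<bar>)\<^sup>2"
      using c\<^sub>1\<^sub>2_bound(2)[of t] c\<^sub>1\<^sub>3_bound(2)[of t] c\<^sub>2\<^sub>3_bound(2)[of t] c_le(1) \<open>\<mu> \<ge> 0\<close>
      by (intro sum_squared_products_ge) (auto simp: \<mu>_def[symmetric])
    also have "\<dots> \<le> norm (denominator w\<^sub>1 w\<^sub>2 w\<^sub>3 t)" by (simp add: norm_denominator)
    finally show ?thesis by (simp add: \<mu>_def)
  qed
  with c_le(1) show thesis using that[of "c / 2"] by simp
qed

lemma norm_denominator_ge: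
  obtains c where "c > 0" "\<And>t. c \<le> norm (denominator w\<^sub>1 w\<^sub>2 w\<^sub>3 t) * (1 + \<bar>t\<bar>) ^ 4"
proof -
  obtain c where c_bound: "c > 0" "\<And>t. (c * min \<bar>t\<bar> (1 / (1 + \<bar>t\<bar>))) ^ 4 \<le> norm (denominator w\<^sub>1 w\<^sub>2 w\<^sub>3 t)"
    using norm_denominator_ge_min by blast
  define \<delta> where "\<delta> = min 1 (1 / (2 * (w\<^sub>1 + w\<^sub>2 + w\<^sub>3)))"
  define C where "C = min ((2 / pi) ^ 6) ((c * \<delta>) ^ 4)"
  have \<delta>_pos: "\<delta> > 0" "\<delta> \<le> 1" using pos by (auto simp: \<delta>_def)
  have "C \<le> norm (denominator w\<^sub>1 w\<^sub>2 w\<^sub>3 t) * (1 + \<bar>t\<bar>) ^ 4" for t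
  proof (cases "(w\<^sub>1 + w\<^sub>2 + w\<^sub>3) * \<bar>t\<bar> \<le> 1/2")
    case True
    have "C \<le> norm (denominator w\<^sub>1 w\<^sub>2 w\<^sub>3 t) * 1"
      using norm_denominator_ge_near_0[OF True] by (simp add: C_def min_le_iff_disj)
    also have "\<dots> \<le> norm (denominator w\<^sub>1 w\<^sub>2 w\<^sub>3 t) * (1 + \<bar>t\<bar>) ^ 4"
      by (intro mult_left_mono one_le_power) auto
    finally show ?thesis .
  next
    case False
    then have "\<delta> \<le> \<bar>t\<bar>" using pos by (simp add: \<delta>_def min_le_iff_disj divide_le_eq mult_ac)
    also have "\<dots> \<le> \<bar>t\<bar> * (1 + \<bar>t\<bar>)" by (simp add: mult_le_cancel_left1)
    finally have "\<delta> \<le> min \<bar>t\<bar> (1 / (1 + \<bar>t\<bar>)) * (1 + \<bar>t\<bar>)"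
      using \<delta>_pos(2) by (cases "\<bar>t\<bar> \<le> 1 / (1 + \<bar>t\<bar>)") auto
    then have "(c * \<delta>) ^ 4 \<le> (c * (min \<bar>t\<bar> (1 / (1 + \<bar>t\<bar>)) * (1 + \<bar>t\<bar>))) ^ 4"
      using c_bound(1) \<delta>_pos(1) by (intro power_mono mult_left_mono) auto
    also have "\<dots> = (c * min \<bar>t\<bar> (1 / (1 + \<bar>t\<bar>))) ^ 4 * (1 + \<bar>t\<bar>) ^ 4" by (simp add: power_mult_distrib)
    also have "\<dots> \<le> norm (denominator w\<^sub>1 w\<^sub>2 w\<^sub>3 t) * (1 + \<bar>t\<bar>) ^ 4"
      by (intro mult_right_mono c_bound) simp
    finally show ?thesis by (simp add: C_def min_le_iff_disj)
  qed
  moreover have "C > 0" using c_bound(1) \<delta>_pos(1) by (simp add: C_def)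
  ultimately show thesis using that by blast
qed

lemma spectral_side_add:
  assumes schwartz_f: "schwartz f" and schwartz_g: "schwartz g"
  shows "spectral_side w\<^sub>1 w\<^sub>2 w\<^sub>3 (\<lambda>x. f x + g x)
      = spectral_side w\<^sub>1 w\<^sub>2 w\<^sub>3 f + spectral_side w\<^sub>1 w\<^sub>2 w\<^sub>3 g"
proof -
  have "vderiv (vderiv (\<lambda>x. f x + g x)) 0 = vderiv (vderiv f) 0 + vderiv (vderiv g) 0"
    by (simp add: vderiv_add schwartz_vderiv schwartz_f schwartz_g)
  then show ?thesis
    unfolding spectral_side_def
    by (simp add: residue_sum_add pos badly_approximable_ratio badly_approximable_inverse_ratio
        schwartz_rapid_decay schwartz_f schwartz_g ring_distribs)
qed

lemma lattice_pairing_fourier_add: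
  assumes schwartz_f: "schwartz f" and schwartz_g: "schwartz g"
  shows "lattice_pairing w\<^sub>1 w\<^sub>2 w\<^sub>3 (fourier (\<lambda>x. f x + g x))
    = lattice_pairing w\<^sub>1 w\<^sub>2 w\<^sub>3 (fourier f) + lattice_pairing w\<^sub>1 w\<^sub>2 w\<^sub>3 (fourier g)"
proof -
  have reflect: "rapid_decay (\<lambda>x. fourier h (- x))" if "schwartz h" for h
    using rapid_decay_scale[OF rapid_decay_fourier[OF that], of "-1"] by simp
  have "fourier (\<lambda>x. f x + g x) = (\<lambda>t. fourier f t + fourier g t)"
    using schwartz_f schwartz_g by (intro ext fourier_add schwartz_integrable)
  then show ?thesis
    by (simp add: lattice_pairing_def lattice_sum_add pos rapid_decay_fourier reflect schwartz_f schwartz_g)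
qed

lemma summation_formula_add:
  "summation_formula w\<^sub>1 w\<^sub>2 w\<^sub>3 f \<Longrightarrow> summation_formula w\<^sub>1 w\<^sub>2 w\<^sub>3 g
      \<Longrightarrow> summation_formula w\<^sub>1 w\<^sub>2 w\<^sub>3 (\<lambda>x. f x + g x)"
  by (simp add: summation_formula_def schwartz_add lattice_pairing_fourier_add spectral_side_add)

lemma residue_sum_two_sines:
  fixes g :: "real \<Rightarrow> complex"
  assumes schwartz_g: "schwartz g"
  shows "residue_sum w\<^sub>1 w\<^sub>2 w\<^sub>3 (two_sines w\<^sub>2 w\<^sub>3 g)
    = - (1 / (4 * w\<^sub>1)) * ((\<Sum>\<^sub>\<infinity>k::int. (- 1) powi k * g (of_int k / w\<^sub>1)) - g 0)"
proof -
  define G where "G k = (- 1) powi k * g (of_int k / w\<^sub>1)" for k :: int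
  have "(\<lambda>k. norm (G k)) summable_on UNIV"
    using rapid_decay_abs_summable_int[OF pos(1) schwartz_rapid_decay[OF schwartz_g]]
    by (simp add: G_def norm_mult norm_power_int)
  then have G_summable: "G summable_on UNIV" by (rule abs_summable_summable)
  have "residue_sum w\<^sub>1 w\<^sub>2 w\<^sub>3 (two_sines w\<^sub>2 w\<^sub>3 g) = (\<Sum>\<^sub>\<infinity>k\<in>- {0}. - (1 / (4 * w\<^sub>1)) * G k)"
    unfolding residue_sum_def
  proof (rule infsum_cong)
    fix k :: int assume "k \<in> - {0}"
    then have nonzero: "sin (pi * k * (w\<^sub>2 / w\<^sub>1)) \<noteq> 0" "sin (pi * k * (w\<^sub>3 / w\<^sub>1)) \<noteq> 0"
      using sin_pi_ratio_nonzero[OF badly_approximable_ratio(1)]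
        sin_pi_ratio_nonzero[OF badly_approximable_ratio(2)] by blast+
    have sin_wave_ratio: "sin_wave v (of_int k / w\<^sub>1) = of_real (sin (pi * k * (v / w\<^sub>1)))" for v
      by (simp add: sin_wave_def mult_ac)
    have "complex_of_real ((- 1) powi (k + 1)) = - ((- 1) powi k)"
      by (simp add: power_int_add of_real_power_int)
    then show "residue_term w\<^sub>1 w\<^sub>2 w\<^sub>3 (two_sines w\<^sub>2 w\<^sub>3 g) k = - (1 / (4 * w\<^sub>1)) * G k"
      unfolding residue_term_def two_sines_def sin_wave_ratio residue_coeff_def G_def
        of_real_divide of_real_mult
      using nonzero pos by (simp add: field_simps)
  qed
  also have "\<dots> = - (1 / (4 * w\<^sub>1)) * infsum G (UNIV - {0})"
    unfolding Compl_eq_Diff_UNIV by (rule infsum_cmult_right')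
  also have "infsum G (UNIV - {0}) = infsum G UNIV - g 0"
    using G_summable by (subst infsum_Diff) (auto simp: G_def)
  finally show ?thesis by (simp add: G_def[abs_def])
qed

lemma vderiv2_two_sines_0:
  fixes g :: "real \<Rightarrow> complex"
  assumes schwartz_g: "schwartz g"
  shows "vderiv (vderiv (two_sines w\<^sub>2 w\<^sub>3 g)) 0 = 2 * pi\<^sup>2 * w\<^sub>2 * w\<^sub>3 * g 0"
proof -
  have sine_mult: "schwartz (\<lambda>t. sin_wave w\<^sub>2 t * g t)"
    by (intro schwartz_multiplier_mult multiplier_sin_wave schwartz_g)
  show ?thesis
    unfolding two_sines_def[abs_def]
      vderiv2_mult[OF multiplier_sin_wave sine_mult] vderiv_mult[OF multiplier_sin_wave schwartz_g]
    by (simp add: vderiv_sin_wave_0 sin_wave_def power2_eq_square)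
qed

lemma summation_formula_two_sines:
  assumes schwartz_g: "schwartz g" shows "summation_formula w\<^sub>1 w\<^sub>2 w\<^sub>3 (two_sines w\<^sub>2 w\<^sub>3 g)"
proof -
  have residues: "residue_sum w\<^sub>2 w\<^sub>1 w\<^sub>3 (two_sines w\<^sub>2 w\<^sub>3 g) = 0"
      "residue_sum w\<^sub>3 w\<^sub>1 w\<^sub>2 (two_sines w\<^sub>2 w\<^sub>3 g) = 0"
    by (auto intro!: residue_sum_eq_0 simp: two_sines_def sin_wave_int_ratio pos)
  have "two_sines w\<^sub>2 w\<^sub>3 g 0 = 0" by (simp add: two_sines_def sin_wave_def)
  then have "spectral_side w\<^sub>1 w\<^sub>2 w\<^sub>3 (two_sines w\<^sub>2 w\<^sub>3 g)
      = - (1 / (4 * w\<^sub>1)) * (\<Sum>\<^sub>\<infinity>k::int. (- 1) powi k * g (of_int k / w\<^sub>1))"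
    unfolding spectral_side_def residues residue_sum_two_sines[OF schwartz_g]
      vderiv2_two_sines_0[OF schwartz_g]
    using pos by (simp add: field_simps power2_eq_square)
  then show ?thesis
    by (simp add: summation_formula_def lattice_pairing_two_sines schwartz_two_sines pos schwartz_g)
qed

lemma vderiv2_three_sincs_0:
  fixes g :: "real \<Rightarrow> complex"
  assumes schwartz_g: "schwartz g"
  shows "vderiv (vderiv (three_sincs w\<^sub>1 w\<^sub>2 w\<^sub>3 g)) 0
    = vderiv (vderiv g) 0 - pi\<^sup>2 / 3 * (w\<^sub>1\<^sup>2 + w\<^sub>2\<^sup>2 + w\<^sub>3\<^sup>2) * g 0"
proof -
  have sinc_mult: "vderiv (vderiv (\<lambda>t. sinc_wave w t * h t)) 0 = vderiv (vderiv h) 0 - (pi * w)\<^sup>2 / 3 * h 0"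
    if "w > 0" "schwartz h" for w and h :: "real \<Rightarrow> complex"
    using that vderiv_sinc_wave_0[of w]
    by (subst vderiv2_mult[OF multiplier_sinc_wave]) (auto simp: sinc_wave_0)
  have sinc_schwartz: "schwartz (\<lambda>t. sinc_wave w t * h t)"
    if "w > 0" "schwartz h" for w and h :: "real \<Rightarrow> complex"
    using that by (intro schwartz_multiplier_mult multiplier_sinc_wave)
  have "vderiv (vderiv (three_sincs w\<^sub>1 w\<^sub>2 w\<^sub>3 g)) 0
    = vderiv (vderiv g) 0 - (pi * w\<^sub>1)\<^sup>2 / 3 * g 0 - (pi * w\<^sub>2)\<^sup>2 / 3 * g 0 - (pi * w\<^sub>3)\<^sup>2 / 3 * g 0"
    unfolding three_sincs_def[abs_def]
    using sinc_mult[OF pos(1) schwartz_g] sinc_mult[OF pos(2) sinc_schwartz[OF pos(1) schwartz_g]]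
      sinc_mult[OF pos(3) sinc_schwartz[OF pos(2) sinc_schwartz[OF pos(1) schwartz_g]]]
    by (simp add: sinc_wave_0)
  then show ?thesis by (simp add: power_mult_distrib algebra_simps add_divide_distrib)
qed

lemma summation_formula_three_sincs:
  assumes schwartz_g: "schwartz g" shows "summation_formula w\<^sub>1 w\<^sub>2 w\<^sub>3 (three_sincs w\<^sub>1 w\<^sub>2 w\<^sub>3 g)"
proof -
  have residues: "residue_sum w\<^sub>1 w\<^sub>2 w\<^sub>3 (three_sincs w\<^sub>1 w\<^sub>2 w\<^sub>3 g) = 0"
      "residue_sum w\<^sub>2 w\<^sub>1 w\<^sub>3 (three_sincs w\<^sub>1 w\<^sub>2 w\<^sub>3 g) = 0"
      "residue_sum w\<^sub>3 w\<^sub>1 w\<^sub>2 (three_sincs w\<^sub>1 w\<^sub>2 w\<^sub>3 g) = 0"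
    by (auto intro!: residue_sum_eq_0 simp: three_sincs_def sinc_wave_int_ratio pos)
  have "three_sincs w\<^sub>1 w\<^sub>2 w\<^sub>3 g 0 = g 0" by (simp add: three_sincs_def sinc_wave_0)
  then have "spectral_side w\<^sub>1 w\<^sub>2 w\<^sub>3 (three_sincs w\<^sub>1 w\<^sub>2 w\<^sub>3 g)
      = - (1 / (8 * pi\<^sup>2 * (w\<^sub>1 * w\<^sub>2 * w\<^sub>3))) * vderiv (vderiv g) 0"
    unfolding spectral_side_def residues vderiv2_three_sincs_0[OF schwartz_g]
    using pos by (simp add: field_simps)
  then show ?thesis
    by (simp add: summation_formula_def lattice_pairing_three_sincs schwartz_three_sincs pos schwartz_g)
qed

lemma denominator_mult_eq:
  "denominator w\<^sub>1 w\<^sub>2 w\<^sub>3 t * h t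
    = three_sincs w\<^sub>1 w\<^sub>2 w\<^sub>3 (\<lambda>t. sinc_product w\<^sub>1 w\<^sub>2 w\<^sub>3 t * h t) t
      + two_sines w\<^sub>2 w\<^sub>3 (\<lambda>t. sin_wave w\<^sub>3 t * sin_wave w\<^sub>2 t * h t) t
      + two_sines w\<^sub>1 w\<^sub>3 (\<lambda>t. sin_wave w\<^sub>3 t * sin_wave w\<^sub>1 t * h t) t
      + two_sines w\<^sub>2 w\<^sub>1 (\<lambda>t. sin_wave w\<^sub>1 t * sin_wave w\<^sub>2 t * h t) t"
  by (simp add: denominator_def sinc_product_def three_sincs_def two_sines_def
      power2_eq_square distrib_left distrib_right mult_ac)

theorem summation_formula_schwartz:
  assumes schwartz_f: "schwartz f" shows "summation_formula w\<^sub>1 w\<^sub>2 w\<^sub>3 f"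
proof -
  let ?D = "denominator w\<^sub>1 w\<^sub>2 w\<^sub>3"
  obtain c where c_bound: "c > 0" "\<And>t. c \<le> norm (?D t) * (1 + \<bar>t\<bar>) ^ 4"
    using norm_denominator_ge by blast
  define h where "h t = inverse (?D t) * f t" for t
  have "?D t \<noteq> 0" for t using c_bound(2)[of t] c_bound(1) by auto
  then have f_eq: "f = (\<lambda>t. ?D t * h t)" by (auto simp: h_def)
  have factor: "schwartz (\<lambda>t. u t * h t)" if "multiplier u" for u
    unfolding h_def
    by (intro schwartz_multiplier_mult that schwartz_f
        multiplier_inverse[OF multiplier_denominator[OF pos] c_bound])
  note factors = factor[OF multiplier_sinc_product[OF pos]]
    factor[OF multiplier_mult[OF multiplier_sin_wave multiplier_sin_wave]]
  have "summation_formula w\<^sub>1 w\<^sub>2 w\<^sub>3 (two_sines w\<^sub>1 w\<^sub>3 (\<lambda>t. sin_wave w\<^sub>3 t * sin_wave w\<^sub>1 t * h t))"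
    using incommensurable_triple.summation_formula_two_sines[OF swap12 factors(2)]
    by (simp add: summation_formula_swap12)
  moreover have "summation_formula w\<^sub>1 w\<^sub>2 w\<^sub>3 (two_sines w\<^sub>2 w\<^sub>1 (\<lambda>t. sin_wave w\<^sub>1 t * sin_wave w\<^sub>2 t * h t))"
    using incommensurable_triple.summation_formula_two_sines[OF swap13 factors(2)]
    by (simp add: summation_formula_swap13)
  ultimately show ?thesis
    unfolding f_eq denominator_mult_eq
    by (intro summation_formula_add summation_formula_three_sincs summation_formula_two_sines factors)
qed

end

subsection \<open>Test functions and supports\<close>

abbreviation closed_support :: "(real \<Rightarrow> complex) \<Rightarrow> real set" where
  "closed_support \<phi> \<equiv> closure {x. \<phi> x \<noteq> 0}"

lemma not_in_closed_support: "x \<notin> closed_support \<phi> \<Longrightarrow> \<phi> x = 0"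
  using closure_subset[of "{x. \<phi> x \<noteq> 0}"] by auto

lemma closed_support_vderiv: "closed_support (vderiv \<phi>) \<subseteq> closed_support \<phi>"
proof (rule closure_minimal)
  have zero: "\<phi> y = 0" if "y \<notin> closed_support \<phi>" for y
    using that by (rule not_in_closed_support)
  have "vderiv \<phi> x = 0" if "x \<notin> closed_support \<phi>" for x
  proof -
    have "(\<phi> has_vector_derivative 0) (at x)"
      by (rule has_vector_derivative_transform_within_open[of "\<lambda>_. 0" _ x "- closed_support \<phi>"])
        (use that in \<open>auto intro: zero\<close>)
    then show ?thesis by (simp add: vderiv_def vector_derivative_at)
  qed
  then show "{x. vderiv \<phi> x \<noteq> 0} \<subseteq> closed_support \<phi>" by blast
qed simp

lemma closed_support_mult: "closed_support (\<lambda>x. u x * \<phi> x) \<subseteq> closed_support \<phi>"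
  by (intro closure_mono) auto

lemma schwartz_of_compact_support:
  assumes "smooth \<phi>" "compact (closed_support \<phi>)" shows "schwartz \<phi>"
proof -
  define P where "P g \<longleftrightarrow> smooth_class (\<lambda>_. True) g \<and> closed_support g \<subseteq> closed_support \<phi>" for g
  have "P \<phi>" using assms(1) by (simp add: P_def smooth_iff_smooth_class)
  then have "smooth_class rapid_decay \<phi>"
  proof (cases rule: smooth_class_coinduct)
    case (mem g)
    have "bounded (range (\<lambda>x. x ^ m *\<^sub>R g x))" for m
    proof -
      have "continuous_on (closed_support \<phi>) g"
        using mem
        unfolding P_def by (blast intro: continuous_on_has_vector_derivative smooth_class_has_vderiv)
      then have "compact ((\<lambda>x. x ^ m *\<^sub>R g x) ` closed_support \<phi>)"
        using assms(2) by (intro compact_continuous_image continuous_intros)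
      then have "bounded (insert 0 ((\<lambda>x. x ^ m *\<^sub>R g x) ` closed_support \<phi>))"
        by (simp add: compact_imp_bounded)
      moreover have "g x = 0" if "x \<notin> closed_support \<phi>" for x
        using mem that by (intro not_in_closed_support) (auto simp: P_def)
      then have "range (\<lambda>x. x ^ m *\<^sub>R g x) \<subseteq> insert 0 ((\<lambda>x. x ^ m *\<^sub>R g x) ` closed_support \<phi>)"
        by fastforce
      ultimately show ?thesis by (rule bounded_subset)
    qed
    then show "rapid_decay g" by (simp add: rapid_decay_iff_bounded)
  next
    case (deriv g)
    then have "P (vderiv g)"
      unfolding P_def using smooth_class_vderiv closed_support_vderiv by blast
    with deriv show "\<exists>g'. P g' \<and> (\<forall>x. (g has_vector_derivative g' x) (at x))"
      unfolding P_def by (blast intro: smooth_class_has_vderiv)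
  qed
  then show ?thesis by (simp add: schwartz_iff_smooth_class)
qed

definition test_function :: "real set \<Rightarrow> (real \<Rightarrow> complex) \<Rightarrow> bool" where
  "test_function U \<phi> \<longleftrightarrow> smooth \<phi> \<and> compact (closed_support \<phi>) \<and> closed_support \<phi> \<subseteq> U"

lemma vanishes_on_iff: "vanishes_on u U \<longleftrightarrow> (\<forall>\<phi>. test_function U \<phi> \<longrightarrow> u \<phi> = 0)"
  by (auto simp: vanishes_on_def test_function_def)

lemma test_function_schwartz: "test_function U \<phi> \<Longrightarrow> schwartz \<phi>"
  by (simp add: test_function_def schwartz_of_compact_support)

lemma test_function_mono: "test_function U \<phi> \<Longrightarrow> U \<subseteq> V \<Longrightarrow> test_function V \<phi>"
  by (auto simp: test_function_def)

lemma test_function_eq_0: "test_function U \<phi> \<Longrightarrow> x \<notin> U \<Longrightarrow> \<phi> x = 0"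
  unfolding test_function_def by (blast intro: not_in_closed_support)

lemma compact_closed_support:
  assumes "compact K" "closed_support \<phi> \<subseteq> K" shows "compact (closed_support \<phi>)"
  using assms by (metis bounded_subset closed_closure compact_eq_bounded_closed)

lemma test_function_vderiv:
  assumes "test_function U \<phi>" shows "test_function U (vderiv \<phi>)"
  using assms schwartz_smooth[OF schwartz_vderiv[OF test_function_schwartz[OF assms]]]
    closed_support_vderiv compact_closed_support
  unfolding test_function_def by (meson order_trans)

lemma test_function_multiplier_mult:
  assumes "multiplier u" "test_function U \<phi>" shows "test_function U (\<lambda>x. u x * \<phi> x)"
  using assms(2)
    schwartz_smooth[OF schwartz_multiplier_mult[OF assms(1) test_function_schwartz[OF assms(2)]]]
    closed_support_mult compact_closed_support
  unfolding test_function_def by (meson order_trans)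

lemma distr_supp_subset:
  assumes "closed S" "\<And>\<phi>. test_function (- S) \<phi> \<Longrightarrow> u \<phi> = 0" shows "distr_supp u \<subseteq> S"
  using assms unfolding distr_supp_def vanishes_on_iff by (auto simp: open_Compl)

lemma in_distr_suppI:
  assumes "\<And>U. open U \<Longrightarrow> x \<in> U \<Longrightarrow> \<exists>\<phi>. test_function U \<phi> \<and> u \<phi> \<noteq> 0" shows "x \<in> distr_supp u"
  using assms unfolding distr_supp_def vanishes_on_iff by auto

definition flat_exp :: "real poly \<Rightarrow> real \<Rightarrow> real" where
  "flat_exp p x = (if x \<le> 0 then 0 else poly p (inverse x) / exp (inverse x))"

lemma poly_div_exp_tendsto_0: "((\<lambda>x::real. poly p x / exp x) \<longlongrightarrow> 0) at_top"
proof -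
  have "((\<lambda>x::real. \<Sum>i\<le>degree p. coeff p i * (x ^ i / exp x)) \<longlongrightarrow> (\<Sum>i\<le>degree p. coeff p i * 0)) at_top"
    by (intro tendsto_intros tendsto_power_div_exp_0)
  then show ?thesis by (simp add: poly_altdef sum_divide_distrib)
qed

lemma flat_exp_tendsto_0: "(flat_exp p \<longlongrightarrow> 0) (at 0)"
proof (rule filterlim_split_at)
  show "(flat_exp p \<longlongrightarrow> 0) (at_left 0)"
    by (rule tendsto_eventually) (auto simp: eventually_at_filter flat_exp_def)
  have "\<forall>\<^sub>F x in at_right 0. poly p (inverse x) / exp (inverse x) = flat_exp p x"
    by (auto simp: eventually_at_filter flat_exp_def)
  then show "(flat_exp p \<longlongrightarrow> 0) (at_right 0)"
    by (rule Lim_transform_eventually[OF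
          filterlim_compose[OF poly_div_exp_tendsto_0 filterlim_inverse_at_top_right]])
qed

lemma DERIV_flat_exp:
  "(flat_exp p has_real_derivative flat_exp (pCons 0 (pCons 0 (p - pderiv p))) x) (at x)"
proof (cases x "0::real" rule: linorder_cases)
  case less
  show ?thesis
    by (rule has_field_derivative_transform_within_open[of "\<lambda>_. 0" _ x "{..<0}"])
      (use less in \<open>auto simp: flat_exp_def\<close>)
next
  case equal
  have quotient: "(flat_exp p (0 + h) - flat_exp p 0) / h = flat_exp (pCons 0 p) h" for h
    by (simp add: flat_exp_def field_simps)
  have "flat_exp q 0 = 0" for q by (simp add: flat_exp_def)
  then show ?thesis unfolding equal DERIV_def quotient by (simp add: flat_exp_tendsto_0)
next
  case greater
  then have "((\<lambda>x. poly p (inverse x) / exp (inverse x)) has_real_derivative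
      flat_exp (pCons 0 (pCons 0 (p - pderiv p))) x) (at x)"
    by (auto intro!: derivative_eq_intros DERIV_chain2[OF poly_DERIV]
        simp: flat_exp_def divide_simps power2_eq_square algebra_simps)
  then show ?thesis
    by (rule has_field_derivative_transform_within_open[of _ _ x "{0<..}"])
      (use greater in \<open>auto simp: flat_exp_def\<close>)
qed

lemma smooth_flat_exp: "smooth (\<lambda>x. of_real (flat_exp p x))"
proof -
  define P where "P f \<longleftrightarrow> (\<exists>p. f = (\<lambda>x. complex_of_real (flat_exp p x)))" for f
  have "P (\<lambda>x. of_real (flat_exp p x))" by (auto simp: P_def)
  then have "smooth_class (\<lambda>_. True) (\<lambda>x. complex_of_real (flat_exp p x))"
  proof (cases rule: smooth_class_coinduct)
    case (deriv f)
    then show "\<exists>f'. P f' \<and> (\<forall>x. (f has_vector_derivative f' x) (at x))"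
      unfolding P_def by (blast intro: has_vector_derivative_of_real DERIV_flat_exp)
  qed simp
  then show ?thesis by (simp add: smooth_iff_smooth_class)
qed

lemma smooth_mult: "smooth f \<Longrightarrow> smooth g \<Longrightarrow> smooth (\<lambda>x. f x * g x)"
  unfolding smooth_iff_smooth_class by (rule smooth_class_mult) auto

lemma smooth_affine: "smooth f \<Longrightarrow> smooth (\<lambda>x. f (a * x + b))"
  unfolding smooth_iff_smooth_class by (rule smooth_class_affine) auto

lemma exists_test_function:
  assumes "open U" "x \<in> U" obtains \<phi> where "test_function U \<phi>" "\<phi> x \<noteq> 0"
proof -
  obtain r where cball_subset: "r > 0" "cball x r \<subseteq> U" using assms open_contains_cball by blast
  define \<phi> where "\<phi> y = complex_of_real (flat_exp 1 (1 * y + (r - x)))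
      * of_real (flat_exp 1 ((- 1) * y + (r + x)))" for y
  have "smooth \<phi>" unfolding \<phi>_def[abs_def] by (intro smooth_mult smooth_affine smooth_flat_exp)
  moreover have support: "closed_support \<phi> \<subseteq> cball x r"
    by (intro closure_minimal) (auto simp: \<phi>_def flat_exp_def dist_real_def split: if_splits)
  moreover have "compact (closed_support \<phi>)" by (rule compact_closed_support[OF compact_cball support])
  moreover have "\<phi> x \<noteq> 0" using cball_subset(1) by (simp add: \<phi>_def flat_exp_def)
  ultimately show thesis using that cball_subset(2) unfolding test_function_def by blast
qed

subsection \<open>The support of the spectral side\<close>

definition dual_lattice :: "real \<Rightarrow> real set" where
  "dual_lattice w = range (\<lambda>k::int. of_int k / w)"

lemma dual_lattice_memI [intro]: "of_int k / w \<in> dual_lattice w"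
  by (auto simp: dual_lattice_def)

lemma zero_in_dual_lattice: "0 \<in> dual_lattice w"
  using dual_lattice_memI[of 0] by simp

lemma closed_dual_lattice_diff:
  assumes "w > 0" shows "closed (dual_lattice w - A)"
proof -
  have "dual_lattice w - A = (\<lambda>x. x * w) -` (of_int ` {k. of_int k / w \<notin> A})"
    using assms
    by (auto simp: dual_lattice_def image_iff) (metis nonzero_mult_div_cancel_right less_irrefl)+
  then show ?thesis by (simp only:) (intro continuous_closed_vimage closed_of_int_image continuous_intros)
qed

lemma dual_lattices_meet_at_0:
  assumes "v > 0" "w > 0" "badly_approximable (w / v)" "x \<in> dual_lattice v" "x \<in> dual_lattice w"
  shows "x = 0"
proof -
  obtain j where j_eq: "x = of_int j / v" using assms(4) by (auto simp: dual_lattice_def)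
  obtain k where k_eq: "x = of_int k / w" using assms(5) by (auto simp: dual_lattice_def)
  have "of_int j * (w / v) = x * w" using j_eq by simp
  also have "\<dots> = of_int k" using k_eq assms(2) by simp
  finally have "sin (pi * of_int j * (w / v)) = sin (pi * of_int k)" by (simp only: mult.assoc)
  also have "\<dots> = 0" by (simp add: sin_int_times_real mult.commute)
  finally have "sin (pi * of_int j * (w / v)) = 0" .
  then show ?thesis using sin_pi_ratio_nonzero[OF assms(3), of j] j_eq by auto
qed

definition spectrum :: "real \<Rightarrow> real \<Rightarrow> real \<Rightarrow> real set" where
  "spectrum w\<^sub>1 w\<^sub>2 w\<^sub>3 = dual_lattice w\<^sub>1 \<union> dual_lattice w\<^sub>2 \<union> dual_lattice w\<^sub>3"

lemma zero_in_spectrum: "0 \<in> spectrum w\<^sub>1 w\<^sub>2 w\<^sub>3"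
  by (simp add: spectrum_def zero_in_dual_lattice)

lemma spectral_side_of_zero_on_spectrum:
  assumes "\<And>x. x \<in> spectrum w\<^sub>1 w\<^sub>2 w\<^sub>3 \<Longrightarrow> f x = 0"
  shows "spectral_side w\<^sub>1 w\<^sub>2 w\<^sub>3 f = - (1 / (8 * pi\<^sup>2 * (w\<^sub>1 * w\<^sub>2 * w\<^sub>3))) * vderiv (vderiv f) 0"
proof -
  have "residue_sum w\<^sub>1 w\<^sub>2 w\<^sub>3 f = 0" "residue_sum w\<^sub>2 w\<^sub>1 w\<^sub>3 f = 0" "residue_sum w\<^sub>3 w\<^sub>1 w\<^sub>2 f = 0"
    by (intro residue_sum_eq_0 assms; auto simp: spectrum_def)+
  then show ?thesis using assms[OF zero_in_spectrum] by (simp add: spectral_side_def)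
qed

context incommensurable_triple
begin

lemma closed_spectrum_diff: "closed (spectrum w\<^sub>1 w\<^sub>2 w\<^sub>3 - A)"
  unfolding spectrum_def Un_Diff using pos by (intro closed_Un closed_dual_lattice_diff)

lemma spectral_side_single_frequency:
  assumes k_nonzero: "k \<noteq> 0" and vanishing: "\<And>y. y \<in> spectrum w\<^sub>1 w\<^sub>2 w\<^sub>3 - {of_int k / w\<^sub>1} \<Longrightarrow> f y = 0"
    and "vderiv (vderiv f) 0 = 0"
  shows "spectral_side w\<^sub>1 w\<^sub>2 w\<^sub>3 f = residue_term w\<^sub>1 w\<^sub>2 w\<^sub>3 f k"
proof -
  have nonzero: "of_int k / w\<^sub>1 \<noteq> 0" using k_nonzero pos by simp
  have "of_int k / w\<^sub>1 \<notin> dual_lattice w\<^sub>2" "of_int k / w\<^sub>1 \<notin> dual_lattice w\<^sub>3"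
    using dual_lattices_meet_at_0[OF pos(1,2) badly_approximable_ratio(1)]
      dual_lattices_meet_at_0[OF pos(1,3) badly_approximable_ratio(2)] nonzero by blast+
  then have "of_int j / w\<^sub>2 \<noteq> of_int k / w\<^sub>1" "of_int j / w\<^sub>3 \<noteq> of_int k / w\<^sub>1" for j :: int
    by (metis dual_lattice_memI)+
  then have "residue_sum w\<^sub>2 w\<^sub>1 w\<^sub>3 f = 0" "residue_sum w\<^sub>3 w\<^sub>1 w\<^sub>2 f = 0"
    by (intro residue_sum_eq_0 vanishing; auto simp: spectrum_def)+
  moreover have "residue_sum w\<^sub>1 w\<^sub>2 w\<^sub>3 f = (\<Sum>\<^sub>\<infinity>j\<in>{k}. residue_term w\<^sub>1 w\<^sub>2 w\<^sub>3 f j)"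
    unfolding residue_sum_def
  proof (rule infsum_cong_neutral)
    fix j assume "j \<in> - {0} - {k}"
    then have "f (of_int j / w\<^sub>1) = 0" using pos(1) by (intro vanishing) (auto simp: spectrum_def)
    then show "residue_term w\<^sub>1 w\<^sub>2 w\<^sub>3 f j = 0" by (simp add: residue_term_def)
  qed (use k_nonzero in auto)
  moreover have "f 0 = 0" using nonzero by (intro vanishing) (auto simp: zero_in_spectrum)
  ultimately show ?thesis using assms(3) by (simp add: spectral_side_def)
qed

lemma nonzero_frequency_in_support:
  assumes u_eq: "\<And>f. schwartz f \<Longrightarrow> u f = spectral_side w\<^sub>1 w\<^sub>2 w\<^sub>3 f"
    and x_frequency: "x \<in> dual_lattice w\<^sub>1" "x \<noteq> 0"
  shows "x \<in> distr_supp u"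
proof (rule in_distr_suppI)
  obtain k where k_eq: "x = of_int k / w\<^sub>1" "k \<noteq> 0" using x_frequency by (auto simp: dual_lattice_def)
  fix U assume open_U: "open U" "x \<in> U"
  define V where "V = U - (spectrum w\<^sub>1 w\<^sub>2 w\<^sub>3 - {x})"
  have "open V" "x \<in> V" using open_U closed_spectrum_diff by (auto simp: V_def)
  then obtain \<phi> where test_\<phi>: "test_function V \<phi>" "\<phi> x \<noteq> 0" by (rule exists_test_function)
  have zero: "0 \<notin> V" using x_frequency(2) by (simp add: V_def zero_in_spectrum)
  have "spectral_side w\<^sub>1 w\<^sub>2 w\<^sub>3 \<phi> = residue_term w\<^sub>1 w\<^sub>2 w\<^sub>3 \<phi> k"
  proof (rule spectral_side_single_frequency[OF k_eq(2)])
    show "\<phi> y = 0" if "y \<in> spectrum w\<^sub>1 w\<^sub>2 w\<^sub>3 - {of_int k / w\<^sub>1}" for y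
      using that k_eq(1) by (intro test_function_eq_0[OF test_\<phi>(1)]) (auto simp: V_def)
    show "vderiv (vderiv \<phi>) 0 = 0"
      by (rule test_function_eq_0[OF test_function_vderiv[OF test_function_vderiv[OF test_\<phi>(1)]] zero])
  qed
  then have "u \<phi> \<noteq> 0"
    using u_eq[OF test_function_schwartz[OF test_\<phi>(1)]] test_\<phi>(2) k_eq
      residue_coeff_nonzero[OF pos(1) badly_approximable_ratio(1,2) k_eq(2)]
    by (simp add: residue_term_def)
  then show "\<exists>\<phi>. test_function U \<phi> \<and> u \<phi> \<noteq> 0"
    using test_function_mono[OF test_\<phi>(1), of U] by (auto simp: V_def)
qed

lemma zero_in_support:
  assumes u_eq: "\<And>f. schwartz f \<Longrightarrow> u f = spectral_side w\<^sub>1 w\<^sub>2 w\<^sub>3 f"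
  shows "0 \<in> distr_supp u"
proof (rule in_distr_suppI)
  fix U :: "real set" assume open_U: "open U" "0 \<in> U"
  define V where "V = U - (spectrum w\<^sub>1 w\<^sub>2 w\<^sub>3 - {0})"
  have "open V" "0 \<in> V" using open_U closed_spectrum_diff by (auto simp: V_def)
  then obtain \<phi> where test_\<phi>: "test_function V \<phi>" "\<phi> 0 \<noteq> 0" by (rule exists_test_function)
  \<comment> \<open>The squared sine removes the contribution of \<open>\<delta>\<^sub>0\<close> and keeps that of its second derivative.\<close>
  define \<psi>\<^sub>1 where "\<psi>\<^sub>1 t = sin_wave 1 t * \<phi> t" for t
  define \<psi>\<^sub>2 where "\<psi>\<^sub>2 t = sin_wave 1 t * \<psi>\<^sub>1 t" for t
  have test_\<psi>: "test_function V \<psi>\<^sub>1" "test_function V \<psi>\<^sub>2"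
    unfolding \<psi>\<^sub>2_def[abs_def] \<psi>\<^sub>1_def[abs_def]
    by (intro test_function_multiplier_mult multiplier_sin_wave test_\<phi>)+
  have "vderiv \<psi>\<^sub>1 0 = pi * \<phi> 0"
    unfolding \<psi>\<^sub>1_def[abs_def] vderiv_mult[OF multiplier_sin_wave test_function_schwartz[OF test_\<phi>(1)]]
    by (simp add: vderiv_sin_wave_0 sin_wave_def)
  then have "vderiv (vderiv \<psi>\<^sub>2) 0 = 2 * pi\<^sup>2 * \<phi> 0"
    unfolding \<psi>\<^sub>2_def[abs_def] vderiv2_mult[OF multiplier_sin_wave test_function_schwartz[OF test_\<psi>(1)]]
    by (simp add: vderiv_sin_wave_0 sin_wave_def \<psi>\<^sub>1_def power2_eq_square)
  moreover have "\<psi>\<^sub>2 y = 0" if "y \<in> spectrum w\<^sub>1 w\<^sub>2 w\<^sub>3" for y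
  proof (cases "y = 0")
    case False
    with that show ?thesis by (intro test_function_eq_0[OF test_\<psi>(2)]) (auto simp: V_def)
  qed (simp add: \<psi>\<^sub>2_def sin_wave_def)
  ultimately have "u \<psi>\<^sub>2 \<noteq> 0"
    using pos test_\<phi>(2)
    by (simp add: u_eq test_function_schwartz[OF test_\<psi>(2)] spectral_side_of_zero_on_spectrum)
  then show "\<exists>\<phi>. test_function U \<phi> \<and> u \<phi> \<noteq> 0"
    using test_function_mono[OF test_\<psi>(2), of U] by (auto simp: V_def)
qed

theorem distr_supp_eq_spectrum:
  assumes u_eq: "\<And>f. schwartz f \<Longrightarrow> u f = spectral_side w\<^sub>1 w\<^sub>2 w\<^sub>3 f"
  shows "distr_supp u = spectrum w\<^sub>1 w\<^sub>2 w\<^sub>3"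
proof (rule antisym)
  show "distr_supp u \<subseteq> spectrum w\<^sub>1 w\<^sub>2 w\<^sub>3"
  proof (rule distr_supp_subset)
    show "closed (spectrum w\<^sub>1 w\<^sub>2 w\<^sub>3)" using closed_spectrum_diff[of "{}"] by simp
    fix \<phi> assume test_\<phi>: "test_function (- spectrum w\<^sub>1 w\<^sub>2 w\<^sub>3) \<phi>"
    then have "vderiv (vderiv \<phi>) 0 = 0"
      by (rule test_function_eq_0[OF test_function_vderiv[OF test_function_vderiv]])
        (simp add: zero_in_spectrum)
    moreover have "\<phi> x = 0" if "x \<in> spectrum w\<^sub>1 w\<^sub>2 w\<^sub>3" for x
      using that by (intro test_function_eq_0[OF test_\<phi>]) simp
    ultimately show "u \<phi> = 0"
      by (simp add: u_eq[OF test_function_schwartz[OF test_\<phi>]] spectral_side_of_zero_on_spectrum)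
  qed
  have u12: "u f = spectral_side w\<^sub>2 w\<^sub>1 w\<^sub>3 f" and u13: "u f = spectral_side w\<^sub>3 w\<^sub>2 w\<^sub>1 f"
      if "schwartz f" for f
    using u_eq[OF that] spectral_side_swap12[of w\<^sub>2 w\<^sub>1 w\<^sub>3 f] spectral_side_swap13[of w\<^sub>3 w\<^sub>2 w\<^sub>1 f]
    by simp_all
  have "x \<in> distr_supp u" if "x \<in> spectrum w\<^sub>1 w\<^sub>2 w\<^sub>3" "x \<noteq> 0" for x
    using that(1) unfolding spectrum_def
  proof (elim UnE)
    assume "x \<in> dual_lattice w\<^sub>1"
    then show ?thesis by (intro nonzero_frequency_in_support[OF u_eq] that)
  next
    assume "x \<in> dual_lattice w\<^sub>2"
    then show ?thesis
      by (intro incommensurable_triple.nonzero_frequency_in_support[OF swap12 u12] that)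
  next
    assume "x \<in> dual_lattice w\<^sub>3"
    then show ?thesis
      by (intro incommensurable_triple.nonzero_frequency_in_support[OF swap13 u13] that)
  qed
  then show "spectrum w\<^sub>1 w\<^sub>2 w\<^sub>3 \<subseteq> distr_supp u" using zero_in_support[OF u_eq] by blast
qed

end

subsection \<open>Tempered Dirac combs\<close>

lemma schwartz_seminorm_ge:
  assumes "schwartz f" shows "norm (x ^ m *\<^sub>R (vderiv ^^ n) f x) \<le> schwartz_seminorm m n f"
proof -
  have "bounded (range (\<lambda>x. x ^ m *\<^sub>R (vderiv ^^ n) f x))" using assms by (simp add: schwartz_def)
  then have "bdd_above (range (\<lambda>x. norm (x ^ m *\<^sub>R (vderiv ^^ n) f x)))"
    unfolding bounded_iff by (auto intro: bdd_aboveI2)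
  then show ?thesis unfolding schwartz_seminorm_def by (rule cSUP_upper[OF UNIV_I])
qed

lemma schwartz_seminorm_nonneg: "schwartz f \<Longrightarrow> 0 \<le> schwartz_seminorm m n f"
  by (rule order_trans[OF norm_ge_zero schwartz_seminorm_ge])

lemma schwartz_seminorm_le_sum:
  assumes "schwartz f" "m \<le> N" "n \<le> N"
  shows "schwartz_seminorm m n f \<le> (\<Sum>m\<le>N. \<Sum>n\<le>N. schwartz_seminorm m n f)"
proof -
  have "schwartz_seminorm m n f \<le> (\<Sum>n\<le>N. schwartz_seminorm m n f)"
    using assms by (intro member_le_sum schwartz_seminorm_nonneg) auto
  also have "\<dots> \<le> (\<Sum>m\<le>N. \<Sum>n\<le>N. schwartz_seminorm m n f)"
    using assms by (intro member_le_sum[of m] sum_nonneg schwartz_seminorm_nonneg) auto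
  finally show ?thesis .
qed

lemma norm_schwartz_le:
  assumes schwartz_f: "schwartz f"
  shows "norm (f x) \<le> 2 ^ Suc N * (\<Sum>m\<le>N. \<Sum>n\<le>N. schwartz_seminorm m n f) * (1 / (1 + \<bar>x\<bar>) ^ N)"
proof -
  define S where "S = (\<Sum>m\<le>N. \<Sum>n\<le>N. schwartz_seminorm m n f)"
  have "norm (f x) \<le> S" "norm (x ^ N *\<^sub>R f x) \<le> S"
    using schwartz_seminorm_ge[OF schwartz_f, of x 0 0] schwartz_seminorm_ge[OF schwartz_f, of x N 0]
      schwartz_seminorm_le_sum[OF schwartz_f, of 0 N 0] schwartz_seminorm_le_sum[OF schwartz_f, of N N 0]
    by (simp_all add: S_def)
  then have "norm (f x) \<le> 2 ^ N * (S + S) / (1 + \<bar>x\<bar>) ^ N" by (rule norm_le_of_weighted_bounds)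
  then show ?thesis unfolding S_def[symmetric] by (simp add: mult_ac)
qed

theorem tempered_dirac_comb:
  assumes weight_summable: "(\<lambda>x. 1 / (1 + \<bar>x\<bar>) ^ N) summable_on \<Lambda>"
  shows "tempered_distribution (dirac_comb \<Lambda>)"
proof -
  have summable: "f summable_on \<Lambda>" if "schwartz f" for f
    by (rule abs_summable_summable[OF Infinite_Sum.abs_summable_on_comparison_test'[OF
            summable_on_cmult_right[OF weight_summable] norm_schwartz_le[OF that]]])
  define C where "C = 2 ^ Suc N * (\<Sum>\<^sub>\<infinity>x\<in>\<Lambda>. 1 / (1 + \<bar>x\<bar>) ^ N)"
  have "norm (dirac_comb \<Lambda> f) \<le> C * (\<Sum>m\<le>N. \<Sum>n\<le>N. schwartz_seminorm m n f)" if schwartz_f: "schwartz f" for f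
  proof -
    have "norm (infsum f \<Lambda>) \<le> 2 ^ Suc N * (\<Sum>m\<le>N. \<Sum>n\<le>N. schwartz_seminorm m n f)
        * (\<Sum>\<^sub>\<infinity>x\<in>\<Lambda>. 1 / (1 + \<bar>x\<bar>) ^ N)"
      by (rule norm_infsum_le[OF has_sum_infsum[OF summable[OF schwartz_f]]
            has_sum_cmult_right[OF has_sum_infsum[OF weight_summable]] norm_schwartz_le[OF schwartz_f]])
    then show ?thesis by (simp add: dirac_comb_def dirac_def C_def mult_ac)
  qed
  moreover have "dirac_comb \<Lambda> (\<lambda>x. f x + g x) = dirac_comb \<Lambda> f + dirac_comb \<Lambda> g"
    if "schwartz f" "schwartz g" for f g
    using infsum_add[OF summable summable, OF that] by (simp add: dirac_comb_def dirac_def)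
  moreover have "dirac_comb \<Lambda> (\<lambda>x. c * f x) = c * dirac_comb \<Lambda> f" for c f
    by (simp add: dirac_comb_def dirac_def infsum_cmult_right')
  ultimately show ?thesis unfolding tempered_distribution_def by blast
qed

lemma has_sum_symmetric_range:
  fixes l :: "'a \<Rightarrow> real" and f :: "real \<Rightarrow> 'b :: topological_comm_monoid_add"
  assumes "inj l" "\<And>p. l p > 0"
    and "((\<lambda>p. f (l p)) has_sum a) UNIV" "((\<lambda>p. f (- l p)) has_sum b) UNIV"
  shows "(f has_sum (a + b)) (range l \<union> uminus ` range l)"
proof (rule has_sum_Un_disjoint)
  show "(f has_sum a) (range l)" using assms(1,3) by (simp add: has_sum_reindex o_def)
  have "inj (\<lambda>p. - l p)" using assms(1) by (simp add: inj_def)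
  then show "(f has_sum b) (uminus ` range l)"
    using assms(4) by (simp add: image_image has_sum_reindex o_def)
  show "range l \<inter> uminus ` range l = {}"
    using assms(2) by (auto simp: disjoint_iff) (metis add_pos_pos add.right_inverse less_irrefl)
qed

definition symmetric_cone :: "real \<Rightarrow> real \<Rightarrow> real \<Rightarrow> real set" where
  "symmetric_cone w\<^sub>1 w\<^sub>2 w\<^sub>3 =
    range (lattice_point w\<^sub>1 w\<^sub>2 w\<^sub>3) \<union> uminus ` range (lattice_point w\<^sub>1 w\<^sub>2 w\<^sub>3)"

lemma symmetric_cone_eq:
  "symmetric_cone w\<^sub>1 w\<^sub>2 w\<^sub>3 =
    {(w\<^sub>1 + w\<^sub>2 + w\<^sub>3) / 2 + real n\<^sub>1 * w\<^sub>1 + real n\<^sub>2 * w\<^sub>2 + real n\<^sub>3 * w\<^sub>3 | n\<^sub>1 n\<^sub>2 n\<^sub>3. True} \<union>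
    uminus ` {(w\<^sub>1 + w\<^sub>2 + w\<^sub>3) / 2 + real n\<^sub>1 * w\<^sub>1 + real n\<^sub>2 * w\<^sub>2 + real n\<^sub>3 * w\<^sub>3 | n\<^sub>1 n\<^sub>2 n\<^sub>3. True}"
proof -
  have point: "lattice_point w\<^sub>1 w\<^sub>2 w\<^sub>3 ((i, j), k)
      = (w\<^sub>1 + w\<^sub>2 + w\<^sub>3) / 2 + real i * w\<^sub>1 + real j * w\<^sub>2 + real k * w\<^sub>3"
    for i j k by (simp add: lattice_point_def algebra_simps add_divide_distrib)
  have "range (lattice_point w\<^sub>1 w\<^sub>2 w\<^sub>3) = {lattice_point w\<^sub>1 w\<^sub>2 w\<^sub>3 ((i, j), k) | i j k. True}"
    by (auto simp: image_iff)
  then show ?thesis unfolding symmetric_cone_def point by simp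
qed

context
  fixes w\<^sub>1 w\<^sub>2 w\<^sub>3 :: real
  assumes w_pos: "w\<^sub>1 > 0" "w\<^sub>2 > 0" "w\<^sub>3 > 0" and inj: "inj (lattice_point w\<^sub>1 w\<^sub>2 w\<^sub>3)"
begin

lemmas has_sum_symmetric_cone =
  has_sum_symmetric_range[OF inj lattice_point_pos[OF w_pos], folded symmetric_cone_def]

lemma tempered_dirac_comb_symmetric_cone: "tempered_distribution (dirac_comb (symmetric_cone w\<^sub>1 w\<^sub>2 w\<^sub>3))"
proof (rule tempered_dirac_comb)
  let ?S = "\<Sum>\<^sub>\<infinity>p. 1 / (1 + lattice_point w\<^sub>1 w\<^sub>2 w\<^sub>3 p) ^ 6"
  have "((\<lambda>p. 1 / (1 + \<bar>lattice_point w\<^sub>1 w\<^sub>2 w\<^sub>3 p\<bar>) ^ 6) has_sum ?S) UNIV"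
    using has_sum_infsum[OF summable_on_lattice[OF w_pos]]
    by (simp add: abs_of_pos lattice_point_pos w_pos)
  then show "(\<lambda>x. 1 / (1 + \<bar>x\<bar>) ^ 6) summable_on symmetric_cone w\<^sub>1 w\<^sub>2 w\<^sub>3"
    by (intro has_sum_imp_summable[OF has_sum_symmetric_cone[where a = ?S and b = ?S]]) simp_all
qed

lemma dirac_comb_symmetric_cone:
  assumes decay_F: "rapid_decay F"
  shows "dirac_comb (symmetric_cone w\<^sub>1 w\<^sub>2 w\<^sub>3) F = lattice_pairing w\<^sub>1 w\<^sub>2 w\<^sub>3 F"
proof -
  have "rapid_decay (\<lambda>x. F (- x))" using rapid_decay_scale[OF decay_F, of "-1"] by simp
  then have "(F has_sum lattice_pairing w\<^sub>1 w\<^sub>2 w\<^sub>3 F) (symmetric_cone w\<^sub>1 w\<^sub>2 w\<^sub>3)"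
    unfolding lattice_pairing_def lattice_sum_def
    by (intro has_sum_symmetric_cone has_sum_infsum rapid_decay_summable_lattice[OF w_pos]
        rapid_decay_summable_lattice[OF w_pos, of "\<lambda>x. F (- x)"] decay_F)
  then show ?thesis by (simp add: dirac_comb_def dirac_def infsumI)
qed

end

theorem (in incommensurable_triple) distr_fourier_dirac_comb:
  assumes "inj (lattice_point w\<^sub>1 w\<^sub>2 w\<^sub>3)" "schwartz f"
  shows "distr_fourier (dirac_comb (symmetric_cone w\<^sub>1 w\<^sub>2 w\<^sub>3)) f = spectral_side w\<^sub>1 w\<^sub>2 w\<^sub>3 f"
  using summation_formula_schwartz[OF assms(2)]
  by (simp add: distr_fourier_def dirac_comb_symmetric_cone pos assms rapid_decay_fourier
      summation_formula_def)

lemma (in incommensurable_triple) spectral_side_eq_single_sum: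
  fixes f :: "real \<Rightarrow> complex" and T :: "int \<Rightarrow> complex"
  assumes schwartz_f: "schwartz f"
    and T_eq: "\<And>k. k \<noteq> 0 \<Longrightarrow>
      T k = residue_term w\<^sub>1 w\<^sub>2 w\<^sub>3 f k + residue_term w\<^sub>2 w\<^sub>1 w\<^sub>3 f k + residue_term w\<^sub>3 w\<^sub>1 w\<^sub>2 f k"
  shows "(\<lambda>k. norm (T k)) summable_on (- {0})"
    and "spectral_side w\<^sub>1 w\<^sub>2 w\<^sub>3 f = - (1 / (8 * pi\<^sup>2 * (w\<^sub>1 * w\<^sub>2 * w\<^sub>3))) * vderiv (vderiv f) 0
      - ((w\<^sub>1\<^sup>2 + w\<^sub>2\<^sup>2 + w\<^sub>3\<^sup>2) / (24 * (w\<^sub>1 * w\<^sub>2 * w\<^sub>3))) * f 0 + (\<Sum>\<^sub>\<infinity>k\<in>- {0}. T k)"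
proof -
  have terms: "(\<lambda>k. norm (residue_term w\<^sub>1 w\<^sub>2 w\<^sub>3 f k)) summable_on - {0}"
      "(\<lambda>k. norm (residue_term w\<^sub>2 w\<^sub>1 w\<^sub>3 f k)) summable_on - {0}"
      "(\<lambda>k. norm (residue_term w\<^sub>3 w\<^sub>1 w\<^sub>2 f k)) summable_on - {0}"
    by (intro residue_term_abs_summable pos badly_approximable_ratio badly_approximable_inverse_ratio
        schwartz_rapid_decay schwartz_f)+
  have "(\<lambda>k. norm (residue_term w\<^sub>1 w\<^sub>2 w\<^sub>3 f k) + norm (residue_term w\<^sub>2 w\<^sub>1 w\<^sub>3 f k)
      + norm (residue_term w\<^sub>3 w\<^sub>1 w\<^sub>2 f k)) summable_on - {0}"
    by (intro summable_on_add terms)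
  then show "(\<lambda>k. norm (T k)) summable_on - {0}"
    by (rule Infinite_Sum.abs_summable_on_comparison_test')
      (simp add: T_eq norm_triangle_le add_right_mono norm_triangle_ineq)
  have "(\<Sum>\<^sub>\<infinity>k\<in>- {0}. T k) = (\<Sum>\<^sub>\<infinity>k\<in>- {0}. residue_term w\<^sub>1 w\<^sub>2 w\<^sub>3 f k
      + residue_term w\<^sub>2 w\<^sub>1 w\<^sub>3 f k + residue_term w\<^sub>3 w\<^sub>1 w\<^sub>2 f k)"
    by (rule infsum_cong) (simp add: T_eq)
  also have "\<dots> = residue_sum w\<^sub>1 w\<^sub>2 w\<^sub>3 f + residue_sum w\<^sub>2 w\<^sub>1 w\<^sub>3 f + residue_sum w\<^sub>3 w\<^sub>1 w\<^sub>2 f"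
    using terms[THEN abs_summable_summable] by (simp add: residue_sum_def infsum_add summable_on_add)
  finally show "spectral_side w\<^sub>1 w\<^sub>2 w\<^sub>3 f = - (1 / (8 * pi\<^sup>2 * (w\<^sub>1 * w\<^sub>2 * w\<^sub>3))) * vderiv (vderiv f) 0
      - ((w\<^sub>1\<^sup>2 + w\<^sub>2\<^sup>2 + w\<^sub>3\<^sup>2) / (24 * (w\<^sub>1 * w\<^sub>2 * w\<^sub>3))) * f 0 + (\<Sum>\<^sub>\<infinity>k\<in>- {0}. T k)"
    by (simp add: spectral_side_def)
qed

subsection \<open>The triple \<open>1, \<surd>2, \<surd>3\<close>\<close>

lemma sqrt_irrational:
  assumes "m\<^sup>2 < n" "n < (Suc m)\<^sup>2" shows "sqrt (real n) \<notin> \<rat>"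
proof
  assume "sqrt (real n) \<in> \<rat>"
  then obtain a b :: nat where fraction: "b \<noteq> 0" "\<bar>sqrt (real n)\<bar> = real a / real b" "coprime a b"
    by (rule Rats_abs_nat_div_natE)
  then have "(sqrt (real n))\<^sup>2 = (real a / real b)\<^sup>2" by (metis power2_abs)
  then have "real (n * b\<^sup>2) = real (a\<^sup>2)" using fraction(1) by (simp add: power_divide field_simps)
  then have square: "n * b\<^sup>2 = a\<^sup>2" by (simp only: of_nat_eq_iff)
  then have "b\<^sup>2 dvd a\<^sup>2" by (metis dvd_triv_right)
  with fraction(3) have "b = 1"
    by (metis coprime_common_divisor_nat dvd_refl pow_divides_pow_iff zero_less_numeral)
  with square assms have "m < a" "a < Suc m" by (auto intro: power_less_imp_less_base)
  then show False by simp
qed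

lemma sqrt_2_3_6_irrational: "sqrt 2 \<notin> \<rat>" "sqrt 3 \<notin> \<rat>" "sqrt 6 \<notin> \<rat>"
  using sqrt_irrational[of 1 2] sqrt_irrational[of 1 3] sqrt_irrational[of 2 6]
  by (simp_all add: power2_eq_square)

lemma int_combination_irrational_eq_0:
  fixes a b :: int
  assumes "\<alpha> \<notin> \<rat>" "of_int a + of_int b * \<alpha> = (0::real)" shows "a = 0 \<and> b = 0"
proof -
  have "b = 0"
  proof (rule ccontr)
    assume "b \<noteq> 0"
    with assms(2) have "\<alpha> = of_int (- a) / of_int b" by (simp add: field_simps eq_neg_iff_add_eq_0)
    with assms(1) show False by auto
  qed
  with assms(2) show ?thesis by simp
qed

lemma int_combination_1_sqrt2_sqrt3_eq_0:
  fixes a b c :: int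
  assumes "of_int a + of_int b * sqrt 2 + of_int c * sqrt 3 = 0" shows "a = 0 \<and> b = 0 \<and> c = 0"
proof -
  have "of_int b * sqrt 2 + of_int c * sqrt 3 = - of_int a" using assms by linarith
  then have "(of_int b * sqrt 2 + of_int c * sqrt 3)\<^sup>2 = (- real_of_int a)\<^sup>2" by (rule arg_cong)
  then have "of_int (2 * b\<^sup>2 + 3 * c\<^sup>2 - a\<^sup>2) + of_int (2 * b * c) * sqrt 6 = 0"
    using real_sqrt_mult[of 2 3] by (simp add: power2_sum power_mult_distrib algebra_simps)
  from int_combination_irrational_eq_0[OF sqrt_2_3_6_irrational(3) this] have "b = 0 \<or> c = 0" by simp
  then show ?thesis
    using assms int_combination_irrational_eq_0[OF sqrt_2_3_6_irrational(1), of a b]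
      int_combination_irrational_eq_0[OF sqrt_2_3_6_irrational(2), of a c] by auto
qed

lemma inj_lattice_point_1_sqrt2_sqrt3: "inj (lattice_point 1 (sqrt 2) (sqrt 3))"
proof (rule injI)
  fix p q assume point_eq: "lattice_point 1 (sqrt 2) (sqrt 3) p = lattice_point 1 (sqrt 2) (sqrt 3) q"
  obtain i j k i' j' k' where pair_eqs: "p = ((i, j), k)" "q = ((i', j'), k')" by (metis surj_pair)
  have "of_int (int i - int i') + of_int (int j - int j') * sqrt 2 + of_int (int k - int k') * sqrt 3 = 0"
    using point_eq by (simp add: pair_eqs lattice_point_def algebra_simps)
  from int_combination_1_sqrt2_sqrt3_eq_0[OF this] show "p = q" by (simp add: pair_eqs)
qed

lemma incommensurable_triple_1_sqrt2_sqrt3: "incommensurable_triple 1 (sqrt 2) (sqrt 3)"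
proof
  have "sqrt 6 = sqrt 3 * sqrt 2" by (simp flip: real_sqrt_mult)
  then have "sqrt 6 = sqrt 3 / sqrt 2 * 2" by (simp add: field_simps)
  then have "sqrt 3 / sqrt 2 \<notin> \<rat>"
    using sqrt_2_3_6_irrational(3) Rats_mult[of "sqrt 3 / sqrt 2" 2] by auto
  then show "badly_approximable (sqrt 3 / sqrt 2)"
    by (intro badly_approximable_quadratic) (auto simp: power_divide)
  show "badly_approximable (sqrt 2 / 1)" "badly_approximable (sqrt 3 / 1)"
    using sqrt_2_3_6_irrational by (auto intro: badly_approximable_quadratic)
qed auto

theorem theorem1p1:
  fixes \<omega>\<^sub>1 \<omega>\<^sub>2 \<omega>\<^sub>3 a P Q :: real
    and \<Lambda>\<^sub>1 \<Lambda> :: "real set"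
    and b c d :: "int \<Rightarrow> real"
    and T :: "int \<Rightarrow> functional"
  assumes "\<omega>\<^sub>1 = 1" and "\<omega>\<^sub>2 = sqrt 2" and "\<omega>\<^sub>3 = sqrt 3"
    and "a = (\<omega>\<^sub>1 + \<omega>\<^sub>2 + \<omega>\<^sub>3) / 2"
    and "\<Lambda>\<^sub>1 = {a + real n\<^sub>1 * \<omega>\<^sub>1 + real n\<^sub>2 * \<omega>\<^sub>2 + real n\<^sub>3 * \<omega>\<^sub>3 | n\<^sub>1 n\<^sub>2 n\<^sub>3 :: nat. True}"
    and "\<Lambda> = \<Lambda>\<^sub>1 \<union> uminus ` \<Lambda>\<^sub>1"
    and "P = \<omega>\<^sub>1 * \<omega>\<^sub>2 * \<omega>\<^sub>3" and "Q = \<omega>\<^sub>1\<^sup>2 + \<omega>\<^sub>2\<^sup>2 + \<omega>\<^sub>3\<^sup>2"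
    and "\<And>k. k \<noteq> 0 \<Longrightarrow>
      b k = (- 1) powi (k + 1) / (4 * \<omega>\<^sub>1 * sin (pi * k * (\<omega>\<^sub>2 / \<omega>\<^sub>1)) * sin (pi * k * (\<omega>\<^sub>3 / \<omega>\<^sub>1)))"
    and "\<And>k. k \<noteq> 0 \<Longrightarrow>
      c k = (- 1) powi (k + 1) / (4 * \<omega>\<^sub>2 * sin (pi * k * (\<omega>\<^sub>1 / \<omega>\<^sub>2)) * sin (pi * k * (\<omega>\<^sub>3 / \<omega>\<^sub>2)))"
    and "\<And>k. k \<noteq> 0 \<Longrightarrow>
      d k = (- 1) powi (k + 1) / (4 * \<omega>\<^sub>3 * sin (pi * k * (\<omega>\<^sub>1 / \<omega>\<^sub>3)) * sin (pi * k * (\<omega>\<^sub>2 / \<omega>\<^sub>3)))"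
    and "\<And>k f. T k f =
      b k *\<^sub>R dirac (real_of_int k) f + c k *\<^sub>R dirac (k / sqrt 2) f + d k *\<^sub>R dirac (k / sqrt 3) f"
  shows "tempered_distribution (dirac_comb \<Lambda>)
    \<and> (\<forall>f. schwartz f \<longrightarrow>
          (\<lambda>k. norm (T k f)) summable_on (- {0})
        \<and> distr_fourier (dirac_comb \<Lambda>) f
            = - (1 / (8 * pi\<^sup>2 * P)) *\<^sub>R distr_deriv (distr_deriv (dirac 0)) f
              - (Q / (24 * P)) *\<^sub>R dirac 0 f
              + (\<Sum>\<^sub>\<infinity>k\<in>- {0}. T k f))
    \<and> distr_supp (distr_fourier (dirac_comb \<Lambda>))
        = \<int> \<union> {real_of_int k / sqrt 2 | k. True} \<union> {real_of_int k / sqrt 3 | k. True}"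
proof -
  interpret incommensurable_triple \<omega>\<^sub>1 \<omega>\<^sub>2 \<omega>\<^sub>3
    unfolding assms(1-3) by (rule incommensurable_triple_1_sqrt2_sqrt3)
  have inj: "inj (lattice_point \<omega>\<^sub>1 \<omega>\<^sub>2 \<omega>\<^sub>3)"
    unfolding assms(1-3) by (rule inj_lattice_point_1_sqrt2_sqrt3)
  have \<Lambda>_eq: "\<Lambda> = symmetric_cone \<omega>\<^sub>1 \<omega>\<^sub>2 \<omega>\<^sub>3" unfolding symmetric_cone_eq assms(4-6) ..
  have fourier: "distr_fourier (dirac_comb \<Lambda>) f = spectral_side \<omega>\<^sub>1 \<omega>\<^sub>2 \<omega>\<^sub>3 f" if "schwartz f" for f
    unfolding \<Lambda>_eq using inj that by (rule distr_fourier_dirac_comb)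
  have T_eq: "T k f = residue_term \<omega>\<^sub>1 \<omega>\<^sub>2 \<omega>\<^sub>3 f k + residue_term \<omega>\<^sub>2 \<omega>\<^sub>1 \<omega>\<^sub>3 f k
      + residue_term \<omega>\<^sub>3 \<omega>\<^sub>1 \<omega>\<^sub>2 f k"
    if "k \<noteq> 0" for k f
    unfolding assms(12) residue_term_def residue_coeff_def assms(9-11)[OF that, symmetric]
    by (simp add: dirac_def scaleR_conv_of_real assms(1-3))
  have "tempered_distribution (dirac_comb \<Lambda>)"
    unfolding \<Lambda>_eq using pos inj by (rule tempered_dirac_comb_symmetric_cone)
  moreover have "spectrum \<omega>\<^sub>1 \<omega>\<^sub>2 \<omega>\<^sub>3
      = \<int> \<union> {real_of_int k / sqrt 2 | k. True} \<union> {real_of_int k / sqrt 3 | k. True}"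
    by (auto simp: spectrum_def dual_lattice_def Ints_def assms(1-3))
  ultimately show ?thesis
    using distr_supp_eq_spectrum[OF fourier] spectral_side_eq_single_sum[OF _ T_eq]
    by (simp add: fourier distr_deriv_def dirac_def assms(7,8) scaleR_conv_of_real)
qed

end
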